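(* Let $\mathcal T_h$ be a mesh as in the context, $p\ge1$ and $0<\epsilon<(\overline\sigma_t/\overline\sigma_a)^{1/2}$. The map $\mathsf H_h^\epsilon:V_h\to V_h$ is self-adjoint and positive definite in the inner product $m_t(u,v)=(\overline\sigma_tu,v)_\Omega$, and $$0\prec\mathsf H_h^\epsilon\preceq I.$$ Let $\lambda_{\max}^\epsilon:=\lambda_{\max}(\mathsf H_h^\epsilon)$ denote its largest eigenvalue. Then $0<\lambda_{\max}^\epsilon\le1$. If $\mathcal E_h^\partial\neq\varnothing$ and homogeneous vacuum inflow is imposed (through the zero exterior trace on physical boundary faces), then $$\mathsf H_h^\epsilon\prec I,\qquad\lambda_{\max}^\epsilon<1.$$ Consequently the bilinear form $$a_{{\rm ex},h}^\epsilon(u,v)=\frac1\epsilon\big(\overline\sigma_t[(\mathsf H_h^\epsilon)^{-1}u-c_\epsilon u],v\big)_\Omega$$ on $V_h$ is symmetric positive definite.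
   Context: $\Omega\subset\mathbb R^d$, $d\in\{2,3\}$, is a bounded connected Lipschitz polytopal domain. $\overline\sigma_t,\overline\sigma_a>0$ are constants, $\sigma_t^\epsilon=\overline\sigma_t/\epsilon$, $\sigma_s^\epsilon=\overline\sigma_t/\epsilon-\epsilon\overline\sigma_a$, $c_\epsilon=\sigma_s^\epsilon/\sigma_t^\epsilon=1-\epsilon^2\overline\sigma_a/\overline\sigma_t$. Mesh. $\mathcal T_h$ is a finite, connected, face-to-face partition of $\Omega$ into bounded Lipschitz polytopes (not necessarily convex). $\mathcal E_h^\circ$, $\mathcal E_h^\partial$ are the sets of interior and physical boundary faces, $\mathcal E_h=\mathcal E_h^\circ\cup\mathcal E_h^\partial$. An interior face $e$ has adjacent elements $K^+,K^-$ and a fixed unit normal $\vec n_e$ directed from $K^+$ to $K^-$; a boundary face has a unique adjacent element $K^+$ and $\vec n_e$ is the outward unit normal. With $v^\pm$ the traces from $K^\pm$, $[v]=v^+-v^-$; on boundary faces the zero exterior trace $v^-:=0$ is used, so $[v]=v^+$. $(\cdot,\cdot)_K$, $(\cdot,\cdot)_\Omega$, $\langle\cdot,\cdot\rangle_e$ are $L^2$ inner products. For $p\ge1$, $V_h=\{v\in L^2(\Omega): v|_K\in\mathbb P_p(K)\ \forall K\in\mathcal T_h\}$. Quadrature. $\{(\vec\omega_m,w_m)\}_{m=1}^{N_\omega}\subset\mathbb S^{d-1}\times(0,1)$ is a set of distinct pairs with $\sum_mw_m=1$, $\sum_mw_m\vec\omega_m=\vec0$, $\sum_mw_m\vec\omega_m\otimes\vec\omega_m=\frac1dI$,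 and for every $m$ there is an index $\overline m$ with $\vec\omega_{\overline m}=-\vec\omega_m$, $w_{\overline m}=w_m$. Transport form. On a face $e$, $u_m^{\rm up}=u^+$ if $\vec\omega_m\cdot\vec n_e\ge0$ and $u_m^{\rm up}=u^-$ if $\vec\omega_m\cdot\vec n_e<0$ (with $u^-=0$ on boundary faces). For $u,v\in V_h$, $$b_{m,h}^\epsilon(u,v)=-\sum_{K\in\mathcal T_h}(u,\vec\omega_m\cdot\nabla v)_K+\sum_{e\in\mathcal E_h}\langle(\vec\omega_m\cdot\vec n_e)u_m^{\rm up},[v]\rangle_e+(\sigma_t^\epsilon u,v)_\Omega.$$ Each directional problem with form $b_{m,h}^\epsilon$ is uniquely solvable in $V_h$. Scalar response. For $g\in V_h$ let $\widehat\Psi_{m,h}^\epsilon(g)\in V_h$ solve $\epsilon b_{m,h}^\epsilon(\widehat\Psi_{m,h}^\epsilon(g),v)=(\overline\sigma_tg,v)_\Omega$ for all $v\in V_h$, and put $\mathsf H_h^\epsilon g=\sum_mw_m\widehat\Psi_{m,h}^\epsilon(g)$. The Loewner order $\prec,\preceq$ between $m_t$-self-adjoint maps is with respect to $m_t$: $A\preceq B$ means $m_t((B-A)v,v)\ge0$ for all $v\in V_h$, and $A\prec B$ means $m_t((B-A)v,v)>0$ for all $v\ne0$. *)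

theory Defs
  imports "HOL-Analysis.Analysis"
begin

section \<open>Lipschitz polytopes\<close>

text \<open>A finite union of convex polytopes, all of affine dimension k; the union itself need be
  neither convex nor connected.\<close>

definition polytopal_set :: "int \<Rightarrow> 'a::euclidean_space set \<Rightarrow> bool" where
  "polytopal_set k S \<longleftrightarrow>
     (\<exists>P. finite P \<and> P \<noteq> {} \<and> S = \<Union>P \<and> (\<forall>C\<in>P. polytope C \<and> aff_dim C = k))"

text \<open>Near each boundary point U is the open epigraph, over some hyperplane orthogonal to a unit
  vector, of a Lipschitz function of the orthogonal projection to that hyperplane.\<close>

definition lipschitz_domain :: "'a::euclidean_space set \<Rightarrow> bool" where
  "lipschitz_domain U \<longleftrightarrow> open U \<and>
     (\<forall>x\<in>frontier U. \<exists>\<nu> r L (\<phi> :: 'a \<Rightarrow> real). norm \<nu> = 1 \<and> 0 < r \<and>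
        L-lipschitz_on {z. \<nu> \<bullet> z = 0} \<phi> \<and>
        (\<forall>y\<in>ball x r. y \<in> U \<longleftrightarrow> \<phi> (y - (\<nu> \<bullet> y) *\<^sub>R \<nu>) < \<nu> \<bullet> y))"

text \<open>Boundedness and nonemptiness follow from the first conjunct.\<close>

definition lipschitz_polytope :: "'a::euclidean_space set \<Rightarrow> bool" where
  "lipschitz_polytope U \<longleftrightarrow> polytopal_set (int DIM('a)) (closure U) \<and> lipschitz_domain U"

section \<open>Meshes\<close>

text \<open>The elements are open sets, the faces are closed flat sets.  The last component is the
  fixed unit normal of a face.  The value of \<open>Kminus\<close> on a boundary face is irrelevant.\<close>

record ('d::finite) mesh =
  elems :: "(real^'d) set set"
  faces :: "(real^'d) set set"
  Kplus :: "(real^'d) set \<Rightarrow> (real^'d) set"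
  Kminus :: "(real^'d) set \<Rightarrow> (real^'d) set"
  nrm :: "(real^'d) set \<Rightarrow> real^'d"

definition boundary_faces :: "(real^'d::finite) set \<Rightarrow> 'd mesh \<Rightarrow> (real^'d) set set" where
  "boundary_faces \<Omega> M = {e \<in> faces M. e \<subseteq> frontier \<Omega>}"

definition interior_faces :: "(real^'d::finite) set \<Rightarrow> 'd mesh \<Rightarrow> (real^'d) set set" where
  "interior_faces \<Omega> M = faces M - boundary_faces \<Omega> M"

definition adjacent_elems :: "'d::finite mesh \<Rightarrow> (real^'d) set \<Rightarrow> (real^'d) set set" where
  "adjacent_elems M e = {K \<in> elems M. e \<subseteq> frontier K}"

definition outward_unit_normal ::
  "'a::euclidean_space set \<Rightarrow> 'a set \<Rightarrow> 'a \<Rightarrow> bool" where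
  "outward_unit_normal K e n \<longleftrightarrow> norm n = 1 \<and>
     (\<forall>x\<in>e. \<forall>y\<in>e. n \<bullet> (x - y) = 0) \<and>
     (\<forall>x\<in>rel_interior e. \<exists>\<delta>>0. \<forall>t. 0 < t \<and> t < \<delta> \<longrightarrow>
        x - t *\<^sub>R n \<in> K \<and> x + t *\<^sub>R n \<notin> closure K)"

text \<open>The face-to-face condition: the boundary of every element is a union of mesh faces, distinct
  mesh faces do not overlap, and a face is adjacent to exactly the elements \<open>Kplus\<close> and
  \<open>Kminus\<close> (interior faces), respectively to \<open>Kplus\<close> only (boundary faces).  Coplanar pieces of
  the boundary of an element may be different faces.  The mesh is connected if any two elements
  are joined by a chain of elements crossing interior faces.\<close>

definition is_mesh :: "(real^'d::finite) set \<Rightarrow> 'd mesh \<Rightarrow> bool" where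
  "is_mesh \<Omega> M \<longleftrightarrow>
     finite (elems M) \<and> finite (faces M) \<and>
     (\<forall>K\<in>elems M. lipschitz_polytope K) \<and>
     pairwise disjnt (elems M) \<and>
     closure \<Omega> = (\<Union>K\<in>elems M. closure K) \<and>
     (\<forall>e\<in>faces M. polytopal_set (int CARD('d) - 1) e) \<and>
     (\<forall>K\<in>elems M. frontier K = \<Union>{e \<in> faces M. e \<subseteq> frontier K}) \<and>
     pairwise (\<lambda>e e'. rel_interior e \<inter> rel_interior e' = {}) (faces M) \<and>
     (\<forall>e\<in>interior_faces \<Omega> M.
        Kplus M e \<noteq> Kminus M e \<and> adjacent_elems M e = {Kplus M e, Kminus M e} \<and>
        outward_unit_normal (Kplus M e) e (nrm M e) \<and>
        outward_unit_normal (Kminus M e) e (- nrm M e)) \<and>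
     (\<forall>e\<in>boundary_faces \<Omega> M.
        adjacent_elems M e = {Kplus M e} \<and>
        outward_unit_normal (Kplus M e) e (nrm M e)) \<and>
     (\<forall>K\<in>elems M. \<forall>K'\<in>elems M.
        (K, K') \<in> {(A, B). \<exists>e\<in>interior_faces \<Omega> M. {A, B} = {Kplus M e, Kminus M e}}\<^sup>*)"

section \<open>The discontinuous polynomial space\<close>

text \<open>Polynomial functions of total degree at most p; the multi-indices of total degree at most
  p form a finite set.\<close>

definition polys :: "nat \<Rightarrow> (real^'d::finite \<Rightarrow> real) set" where
  "polys p = {q. \<exists>c :: ('d \<Rightarrow> nat) \<Rightarrow> real.
     \<forall>x. q x = (\<Sum>\<alpha> | (\<Sum>i\<in>UNIV. \<alpha> i) \<le> p. c \<alpha> * (\<Prod>i\<in>UNIV. (x $ i) ^ \<alpha> i))}"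

text \<open>Every class of square integrable functions on the domain that is polynomial on each (open)
  element is represented by the unique function below that equals its polynomials on the elements
  and is 0 elsewhere (on the null set of faces, and outside the domain).  Hence the zero element of
  the space is the zero function.  Square integrability is automatic since elements are bounded.\<close>

definition Vh :: "'d::finite mesh \<Rightarrow> nat \<Rightarrow> (real^'d \<Rightarrow> real) set" where
  "Vh M p = {v. (\<forall>K\<in>elems M. \<exists>q\<in>polys p. \<forall>x\<in>K. v x = q x) \<and>
                (\<forall>x. x \<notin> \<Union>(elems M) \<longrightarrow> v x = 0)}"

definition trace_from :: "(real^'d::finite) set \<Rightarrow> (real^'d \<Rightarrow> real) \<Rightarrow> real^'d \<Rightarrow> real" where
  "trace_from K v x = Lim (at x within K) v"

definition trace_plus ::
  "'d::finite mesh \<Rightarrow> (real^'d) set \<Rightarrow> (real^'d \<Rightarrow> real) \<Rightarrow> real^'d \<Rightarrow> real" where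
  "trace_plus M e v = trace_from (Kplus M e) v"

text \<open>The zero exterior trace on boundary faces encodes homogeneous vacuum inflow.\<close>

definition trace_minus ::
  "(real^'d::finite) set \<Rightarrow> 'd mesh \<Rightarrow> (real^'d) set \<Rightarrow> (real^'d \<Rightarrow> real) \<Rightarrow> real^'d \<Rightarrow> real" where
  "trace_minus \<Omega> M e v =
     (if e \<in> boundary_faces \<Omega> M then (\<lambda>x. 0) else trace_from (Kminus M e) v)"

definition jump ::
  "(real^'d::finite) set \<Rightarrow> 'd mesh \<Rightarrow> (real^'d) set \<Rightarrow> (real^'d \<Rightarrow> real) \<Rightarrow> real^'d \<Rightarrow> real" where
  "jump \<Omega> M e v x = trace_plus M e v x - trace_minus \<Omega> M e v x"

definition upwind ::
  "(real^'d::finite) set \<Rightarrow> 'd mesh \<Rightarrow> real^'d \<Rightarrow> (real^'d) set \<Rightarrow> (real^'d \<Rightarrow> real) \<Rightarrow>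
    real^'d \<Rightarrow> real" where
  "upwind \<Omega> M \<omega> e u =
     (if 0 \<le> \<omega> \<bullet> nrm M e then trace_plus M e u else trace_minus \<Omega> M e u)"

section \<open>Inner products\<close>

definition inner_L2 :: "(real^'d::finite) set \<Rightarrow> (real^'d \<Rightarrow> real) \<Rightarrow> (real^'d \<Rightarrow> real) \<Rightarrow> real" where
  "inner_L2 S u v = (LINT x:S|lborel. u x * v x)"

text \<open>The (d-1)-dimensional Lebesgue measure on the hyperplane of points y with n . y = c, for a
  unit vector n: the push-forward of d-dimensional Lebesgue measure on the slab of thickness 1
  above the hyperplane under the orthogonal projection.\<close>

definition hyperplane_measure :: "real^'d::finite \<Rightarrow> real \<Rightarrow> (real^'d) measure" where
  "hyperplane_measure n c =
     distr (restrict_space lborel {y. c \<le> n \<bullet> y \<and> n \<bullet> y \<le> c + 1}) borel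
       (\<lambda>y. y - (n \<bullet> y - c) *\<^sub>R n)"

text \<open>The choice of a point of e is immaterial, as e lies in one hyperplane orthogonal to its
  normal.\<close>

definition face_measure :: "'d::finite mesh \<Rightarrow> (real^'d) set \<Rightarrow> (real^'d) measure" where
  "face_measure M e = hyperplane_measure (nrm M e) (nrm M e \<bullet> (SOME x. x \<in> e))"

definition inner_face ::
  "'d::finite mesh \<Rightarrow> (real^'d) set \<Rightarrow> (real^'d \<Rightarrow> real) \<Rightarrow> (real^'d \<Rightarrow> real) \<Rightarrow> real" where
  "inner_face M e u v = (LINT x:e|face_measure M e. u x * v x)"

definition grad :: "(real^'d::finite \<Rightarrow> real) \<Rightarrow> real^'d \<Rightarrow> real^'d" where
  "grad v x = (\<chi> i. frechet_derivative v (at x) (axis i 1))"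

section \<open>Quadrature, transport form and scalar response\<close>

definition is_quadrature :: "nat \<Rightarrow> (nat \<Rightarrow> real^'d::finite) \<Rightarrow> (nat \<Rightarrow> real) \<Rightarrow> bool" where
  "is_quadrature N \<omega> w \<longleftrightarrow>
     (\<forall>m\<in>{1..N}. norm (\<omega> m) = 1 \<and> 0 < w m \<and> w m < 1) \<and>
     inj_on (\<lambda>m. (\<omega> m, w m)) {1..N} \<and>
     (\<Sum>m=1..N. w m) = 1 \<and>
     (\<Sum>m=1..N. w m *\<^sub>R \<omega> m) = 0 \<and>
     (\<Sum>m=1..N. w m *\<^sub>R (\<chi> i j. \<omega> m $ i * \<omega> m $ j)) = (1 / real CARD('d)) *\<^sub>R (mat 1 :: real^'d^'d) \<and>
     (\<forall>m\<in>{1..N}. \<exists>m'\<in>{1..N}. \<omega> m' = - \<omega> m \<and> w m' = w m)"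

text \<open>Below, \<open>st\<close> and \<open>sa\<close> are the constants \<open>\<sigma>\<^sub>t\<close> and \<open>\<sigma>\<^sub>a\<close> (with bars), before scaling by
  \<open>\<epsilon>\<close>.\<close>

definition sigma_t :: "real \<Rightarrow> real \<Rightarrow> real" where
  "sigma_t st \<epsilon> = st / \<epsilon>"

definition sigma_s :: "real \<Rightarrow> real \<Rightarrow> real \<Rightarrow> real" where
  "sigma_s st sa \<epsilon> = st / \<epsilon> - \<epsilon> * sa"

definition c_ratio :: "real \<Rightarrow> real \<Rightarrow> real \<Rightarrow> real" where
  "c_ratio st sa \<epsilon> = sigma_s st sa \<epsilon> / sigma_t st \<epsilon>"

definition transport_form ::
  "(real^'d::finite) set \<Rightarrow> 'd mesh \<Rightarrow> real \<Rightarrow> real \<Rightarrow> real^'d \<Rightarrow>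
    (real^'d \<Rightarrow> real) \<Rightarrow> (real^'d \<Rightarrow> real) \<Rightarrow> real" where
  "transport_form \<Omega> M st \<epsilon> \<omega> u v =
     - (\<Sum>K\<in>elems M. inner_L2 K u (\<lambda>x. \<omega> \<bullet> grad v x))
     + (\<Sum>e\<in>faces M. inner_face M e (\<lambda>x. (\<omega> \<bullet> nrm M e) * upwind \<Omega> M \<omega> e u x) (jump \<Omega> M e v))
     + inner_L2 \<Omega> (\<lambda>x. sigma_t st \<epsilon> * u x) v"

text \<open>Well defined because the directional problem is uniquely solvable.\<close>

definition directional_solution ::
  "(real^'d::finite) set \<Rightarrow> 'd mesh \<Rightarrow> nat \<Rightarrow> real \<Rightarrow> real \<Rightarrow> real^'d \<Rightarrow>
    (real^'d \<Rightarrow> real) \<Rightarrow> real^'d \<Rightarrow> real" where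
  "directional_solution \<Omega> M p st \<epsilon> \<omega> g =
     (THE \<psi>. \<psi> \<in> Vh M p \<and>
        (\<forall>v\<in>Vh M p. \<epsilon> * transport_form \<Omega> M st \<epsilon> \<omega> \<psi> v = inner_L2 \<Omega> (\<lambda>x. st * g x) v))"

definition scalar_response ::
  "(real^'d::finite) set \<Rightarrow> 'd mesh \<Rightarrow> nat \<Rightarrow> nat \<Rightarrow> (nat \<Rightarrow> real^'d) \<Rightarrow> (nat \<Rightarrow> real) \<Rightarrow>
    real \<Rightarrow> real \<Rightarrow> (real^'d \<Rightarrow> real) \<Rightarrow> real^'d \<Rightarrow> real" where
  "scalar_response \<Omega> M p N \<omega> w st \<epsilon> g =
     (\<lambda>x. \<Sum>m=1..N. w m * directional_solution \<Omega> M p st \<epsilon> (\<omega> m) g x)"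

definition m_t ::
  "(real^'d::finite) set \<Rightarrow> real \<Rightarrow> (real^'d \<Rightarrow> real) \<Rightarrow> (real^'d \<Rightarrow> real) \<Rightarrow> real" where
  "m_t \<Omega> st u v = inner_L2 \<Omega> (\<lambda>x. st * u x) v"

definition a_ex ::
  "(real^'d::finite) set \<Rightarrow> 'd mesh \<Rightarrow> nat \<Rightarrow> nat \<Rightarrow> (nat \<Rightarrow> real^'d) \<Rightarrow> (nat \<Rightarrow> real) \<Rightarrow>
    real \<Rightarrow> real \<Rightarrow> real \<Rightarrow> (real^'d \<Rightarrow> real) \<Rightarrow> (real^'d \<Rightarrow> real) \<Rightarrow> real" where
  "a_ex \<Omega> M p N \<omega> w st sa \<epsilon> u v =
     (1 / \<epsilon>) * inner_L2 \<Omega>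
       (\<lambda>x. st * (inv_into (Vh M p) (scalar_response \<Omega> M p N \<omega> w st \<epsilon>) u x - c_ratio st sa \<epsilon> * u x)) v"

section \<open>Forms and maps on a space of real functions\<close>

definition linear_map_on :: "('a \<Rightarrow> real) set \<Rightarrow> (('a \<Rightarrow> real) \<Rightarrow> ('a \<Rightarrow> real)) \<Rightarrow> bool" where
  "linear_map_on V A \<longleftrightarrow> (\<forall>u\<in>V. A u \<in> V) \<and>
     (\<forall>u\<in>V. \<forall>v\<in>V. \<forall>a b. A (\<lambda>x. a * u x + b * v x) = (\<lambda>x. a * A u x + b * A v x))"

definition self_adjoint_on ::
  "('a \<Rightarrow> real) set \<Rightarrow> (('a \<Rightarrow> real) \<Rightarrow> ('a \<Rightarrow> real) \<Rightarrow> real) \<Rightarrow>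
    (('a \<Rightarrow> real) \<Rightarrow> ('a \<Rightarrow> real)) \<Rightarrow> bool" where
  "self_adjoint_on V m A \<longleftrightarrow> linear_map_on V A \<and> (\<forall>u\<in>V. \<forall>v\<in>V. m (A u) v = m u (A v))"

definition positive_definite_on ::
  "('a \<Rightarrow> real) set \<Rightarrow> (('a \<Rightarrow> real) \<Rightarrow> ('a \<Rightarrow> real) \<Rightarrow> real) \<Rightarrow>
    (('a \<Rightarrow> real) \<Rightarrow> ('a \<Rightarrow> real)) \<Rightarrow> bool" where
  "positive_definite_on V m A \<longleftrightarrow> (\<forall>v\<in>V. v \<noteq> (\<lambda>x. 0) \<longrightarrow> 0 < m (A v) v)"

definition loewner_le ::
  "('a \<Rightarrow> real) set \<Rightarrow> (('a \<Rightarrow> real) \<Rightarrow> ('a \<Rightarrow> real) \<Rightarrow> real) \<Rightarrow>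
    (('a \<Rightarrow> real) \<Rightarrow> ('a \<Rightarrow> real)) \<Rightarrow> (('a \<Rightarrow> real) \<Rightarrow> ('a \<Rightarrow> real)) \<Rightarrow> bool" where
  "loewner_le V m A B \<longleftrightarrow> (\<forall>v\<in>V. 0 \<le> m (\<lambda>x. B v x - A v x) v)"

definition loewner_less ::
  "('a \<Rightarrow> real) set \<Rightarrow> (('a \<Rightarrow> real) \<Rightarrow> ('a \<Rightarrow> real) \<Rightarrow> real) \<Rightarrow>
    (('a \<Rightarrow> real) \<Rightarrow> ('a \<Rightarrow> real)) \<Rightarrow> (('a \<Rightarrow> real) \<Rightarrow> ('a \<Rightarrow> real)) \<Rightarrow> bool" where
  "loewner_less V m A B \<longleftrightarrow> (\<forall>v\<in>V. v \<noteq> (\<lambda>x. 0) \<longrightarrow> 0 < m (\<lambda>x. B v x - A v x) v)"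

text \<open>Only real eigenvalues are considered, which are all of them for a self-adjoint map.\<close>

definition eigenvalues_on :: "('a \<Rightarrow> real) set \<Rightarrow> (('a \<Rightarrow> real) \<Rightarrow> ('a \<Rightarrow> real)) \<Rightarrow> real set" where
  "eigenvalues_on V A = {l. \<exists>v\<in>V. v \<noteq> (\<lambda>x. 0) \<and> A v = (\<lambda>x. l * v x)}"

definition lambda_max :: "('a \<Rightarrow> real) set \<Rightarrow> (('a \<Rightarrow> real) \<Rightarrow> ('a \<Rightarrow> real)) \<Rightarrow> real" where
  "lambda_max V A = Max (eigenvalues_on V A)"

definition bilinear_form_on ::
  "('a \<Rightarrow> real) set \<Rightarrow> (('a \<Rightarrow> real) \<Rightarrow> ('a \<Rightarrow> real) \<Rightarrow> real) \<Rightarrow> bool" where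
  "bilinear_form_on V a \<longleftrightarrow>
     (\<forall>u\<in>V. \<forall>v\<in>V. \<forall>z\<in>V. \<forall>r s.
        a (\<lambda>x. r * u x + s * v x) z = r * a u z + s * a v z \<and>
        a z (\<lambda>x. r * u x + s * v x) = r * a z u + s * a z v)"

definition spd_form_on ::
  "('a \<Rightarrow> real) set \<Rightarrow> (('a \<Rightarrow> real) \<Rightarrow> ('a \<Rightarrow> real) \<Rightarrow> real) \<Rightarrow> bool" where
  "spd_form_on V a \<longleftrightarrow> bilinear_form_on V a \<and>
     (\<forall>u\<in>V. \<forall>v\<in>V. a u v = a v u) \<and>
     (\<forall>v\<in>V. v \<noteq> (\<lambda>x. 0) \<longrightarrow> 0 < a v v)"

end

theory Submission
  imports Defs "HOL-Library.Function_Algebras"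
begin

text \<open>Integration by parts on every element turns the transport form into its energy identity
  \<open>b(u, u) = 1/2 \<Sum>\<^sub>e |\<omega> \<cdot> n\<^sub>e| \<parallel>[u]\<parallel>\<^sup>2 + \<sigma>\<^sub>t \<parallel>u\<parallel>\<^sup>2\<close> and shows that reversing the direction
  transposes the form. Hence each solution map is bounded by its right-hand side, opposite
  directions have adjoint solution maps, and the weighted average over the symmetric quadrature is
  self-adjoint with \<open>0 < H \<le> I\<close>. If the upper bound is attained at g, then g solves every
  directional problem with itself as right-hand side and has no jumps, so all its directional
  derivatives vanish; by isotropy of the quadrature and connectedness of the mesh g is constant, and
  the vacuum boundary makes it zero. By convexity of the squared norm \<open>H\<^sup>2 \<le> H\<close>, so that
  \<open>H\<^sup>-\<^sup>1 - c \<ge> (1 - c) I\<close>.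

  Green's formula on a nonconvex polytope is obtained by slicing it into lines parallel to the
  direction. Almost every such line crosses the boundary only in relative interiors of faces not
  parallel to it, where the normals tell whether it enters or leaves, so that the formula reduces to
  the fundamental theorem of calculus on the line.\<close>

section \<open>Positive definite forms on finite-dimensional function spaces\<close>

text \<open>\<open>Vh M p\<close> is treated as the span of a finite set of functions. Solvability
  and the comparison of quadratic forms are proved by adjoining one spanning function at a time, as
  in the Gram-Schmidt process; the comparison replaces compactness of the unit sphere in the
  eigenvalue argument. Multiplying the transport form by \<epsilon> cancels the 1/\<epsilon> in the
  total cross section, so the scaled forms dominate \<open>m_t\<close> with constant exactly 1. Both
  bounds \<open>H <= I\<close> and \<open>H^2 <= H\<close> rest on this constant, and the strict
  inequality \<open>c < 1\<close> then suffices for the exact form. A face carries the push-forward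
  of volume measure from a slab, so surface integrals reduce to Fubini, translations and shears. Two
  features of the meshes need care. Elements may be disconnected, so that constancy on an element
  comes from the identity theorem for polynomials and not from a connectedness argument. The
  covering condition speaks of closures only, so the Lipschitz property of the domain is what places
  the open elements inside it and excludes slits.\<close>

interpretation fs: vector_space "\<lambda>c (f::'a \<Rightarrow> real) x. c * f x"
  by unfold_locales (auto simp: fun_eq_iff algebra_simps)

lemma span_lincomb:
  assumes "u \<in> fs.span B" "v \<in> fs.span B"
  shows "(\<lambda>x. r * u x + s * v x) \<in> fs.span B"
proof -
  have "(\<lambda>x. r * u x) + (\<lambda>x. s * v x) \<in> fs.span B"
    by (intro fs.span_add fs.span_scale assms)
  then show ?thesis by (simp add: plus_fun_def)
qed

lemma span_zero_fun: "(\<lambda>x. 0) \<in> fs.span B"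
  using fs.span_zero[of B] by (simp add: zero_fun_def)

lemma span_sum_fun:
  assumes "finite I" "\<And>i. i \<in> I \<Longrightarrow> f i \<in> fs.span B"
  shows "(\<lambda>x. \<Sum>i\<in>I. c i * f i x) \<in> fs.span B"
  using assms
proof (induction I rule: finite_induct)
  case (insert i I)
  then show ?case using span_lincomb[of "f i" B "\<lambda>x. \<Sum>i\<in>I. c i * f i x" "c i" 1] by simp
qed (simp add: span_zero_fun)

lemma span_insertE:
  assumes "u \<in> fs.span (insert b B)"
  obtains u' r where "u' \<in> fs.span B" "u = (\<lambda>x. 1 * u' x + r * b x)"
proof -
  from assms obtain k where "u - (\<lambda>x. k * b x) \<in> fs.span B"
    by (auto simp: fs.span_insert)
  then show ?thesis
    by (rule that[of _ k]) (auto simp: fun_eq_iff)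
qed

lemma span_insert_shiftedE:
  assumes "v \<in> fs.span (insert b B)" "z \<in> fs.span B"
  obtains v' r where "v' \<in> fs.span B" "v = (\<lambda>x. 1 * v' x + r * (1 * b x + (-1) * z x))"
proof -
  obtain v' r where v': "v' \<in> fs.span B" "v = (\<lambda>x. 1 * v' x + r * b x)"
    using assms(1) by (rule span_insertE)
  have "(\<lambda>x. 1 * v' x + r * z x) \<in> fs.span B" by (rule span_lincomb[OF v'(1) assms(2)])
  then show ?thesis by (rule that[of _ r]) (simp add: v'(2) algebra_simps)
qed

lemma bilinear_formD:
  assumes "bilinear_form_on V a" "u \<in> V" "v \<in> V" "z \<in> V"
  shows "a (\<lambda>x. r * u x + s * v x) z = r * a u z + s * a v z"
    and "a z (\<lambda>x. r * u x + s * v x) = r * a z u + s * a z v"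
  using assms unfolding bilinear_form_on_def by blast+

lemma bilinear_form_on_subset:
  "bilinear_form_on V a \<Longrightarrow> W \<subseteq> V \<Longrightarrow> bilinear_form_on W a"
  unfolding bilinear_form_on_def by (meson subsetD)

lemma bilinear_form_zero:
  assumes "bilinear_form_on V a" "z \<in> V" "(\<lambda>x. 0) \<in> V"
  shows "a (\<lambda>x. 0) z = 0" "a z (\<lambda>x. 0) = 0"
  using bilinear_formD[OF assms(1,3,3,2), of 0 0] by auto

text \<open>Gram-Schmidt induction that also covers the nonsymmetric transport forms: the new
  function is corrected by some \<open>z\<close> of the old span so that \<open>a b'\<close>
  vanishes there. In this splitting the system is triangular: the induction hypothesis solves the
  old part and one scalar equation remains.\<close>

lemma positive_bilinear_form_solvable:
  assumes "finite B" "bilinear_form_on (fs.span B) a"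
    and "\<And>u. u \<in> fs.span B \<Longrightarrow> u \<noteq> (\<lambda>x. 0) \<Longrightarrow> 0 < a u u"
    and "\<And>u v r s. u \<in> fs.span B \<Longrightarrow> v \<in> fs.span B \<Longrightarrow>
           l (\<lambda>x. r * u x + s * v x) = r * l u + s * (l v :: real)"
  shows "\<exists>u\<in>fs.span B. \<forall>v\<in>fs.span B. a u v = l v"
  using assms
proof (induction B arbitrary: l rule: finite_induct)
  case empty
  have z: "(\<lambda>x. 0) \<in> fs.span {}" by (rule span_zero_fun)
  have "l (\<lambda>x. 0) = 0"
    using empty.prems(3)[OF z z, of 0 0] by simp
  moreover have "fs.span {} = {\<lambda>x. 0}" by (simp add: zero_fun_def)
  ultimately show ?case
    using bilinear_form_zero[OF empty.prems(1) z z] by auto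
next
  case (insert b B)
  let ?V = "fs.span (insert b B)" and ?W = "fs.span B"
  have sub: "?W \<subseteq> ?V" by (rule fs.span_mono) auto
  have b: "b \<in> ?V" by (simp add: fs.span_base)
  have bilW: "bilinear_form_on ?W a"
    using insert.prems(1) sub by (rule bilinear_form_on_subset)
  note D = bilinear_formD[OF insert.prems(1)]
  have posW: "\<And>u. u \<in> ?W \<Longrightarrow> u \<noteq> (\<lambda>x. 0) \<Longrightarrow> 0 < a u u"
    using insert.prems(2) sub by blast
  note IH = insert.IH[OF bilW posW]
  obtain u0 where u0: "u0 \<in> ?W" "\<forall>v\<in>?W. a u0 v = l v"
    using IH[of l] insert.prems(3) sub by blast
  obtain z where z: "z \<in> ?W" "\<forall>v\<in>?W. a z v = a b v"
    using IH[of "a b"] D(2)[OF _ _ b] sub by blast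
  define b' where "b' = (\<lambda>x. 1 * b x + (-1) * z x)"
  have b'V: "b' \<in> ?V" unfolding b'_def using b z sub by (intro span_lincomb) auto
  have ort: "a b' v = 0" if "v \<in> ?W" for v
    unfolding b'_def using D(1)[OF b _ , of z v 1 "-1"] z that sub by (auto simp: subset_iff)
  show ?case
  proof (cases "b' = (\<lambda>x. 0)")
    case True
    then have "b = z" by (auto simp: b'_def fun_eq_iff)
    then have "?V = ?W" using z(1) by (simp add: fs.span_redundant)
    then show ?thesis using u0 by auto
  next
    case False
    then have pos: "0 < a b' b'" using insert.prems(2) b'V by blast
    \<comment> \<open>Testing \<open>u0 + t b'\<close> with \<open>b'\<close> determines
      \<open>t\<close>; tests from the old span do not see the summand \<open>t b'\<close>, by
      \<open>ort\<close>.\<close>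
    define t where "t = (l b' - a u0 b') / a b' b'"
    define u where "u = (\<lambda>x. 1 * u0 x + t * b' x)"
    have uV: "u \<in> ?V" unfolding u_def using u0 sub b'V by (intro span_lincomb) auto
    have "a u v = l v" if vV: "v \<in> ?V" for v
    proof -
      obtain v' r where v': "v' \<in> ?W" "v = (\<lambda>x. 1 * v' x + r * b' x)"
        unfolding b'_def using vV z(1) by (rule span_insert_shiftedE)
      have "v' \<in> ?V" "u0 \<in> ?V" using v' u0 sub by auto
      then have "a u v = a u v' + r * a u b'"
        using D(2)[OF _ b'V uV, of v' 1 r] v' by simp
      also have "a u v' = l v'"
        using D(1)[OF \<open>u0 \<in> ?V\<close> b'V \<open>v' \<in> ?V\<close>, of 1 t] ort u0 v' by (simp add: u_def)
      also have "a u b' = l b'"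
        using D(1)[OF \<open>u0 \<in> ?V\<close> b'V b'V, of 1 t] pos by (simp add: u_def t_def)
      also have "l v' + r * l b' = l v"
        using insert.prems(3)[OF \<open>v' \<in> ?V\<close> b'V, of 1 r] v' by simp
      finally show ?thesis .
    qed
    then show ?thesis using uV by blast
  qed
qed

lemma spd_formD:
  assumes "spd_form_on V m"
  shows "bilinear_form_on V m" "\<And>u v. u \<in> V \<Longrightarrow> v \<in> V \<Longrightarrow> m u v = m v u"
    "\<And>u. u \<in> V \<Longrightarrow> u \<noteq> (\<lambda>x. 0) \<Longrightarrow> 0 < m u u"
  using assms by (auto simp: spd_form_on_def)

lemma spd_form_nonneg:
  assumes "spd_form_on V m" "u \<in> V"
  shows "0 \<le> m u u"
proof (cases "u = (\<lambda>x. 0)")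
  case True
  then show ?thesis using bilinear_form_zero[OF spd_formD(1)[OF assms(1)] assms(2)] assms(2) by simp
next
  case False
  then show ?thesis using spd_formD(3)[OF assms False] by simp
qed

lemma form_square_lincomb:
  assumes "bilinear_form_on V m" "u \<in> V" "v \<in> V" "(\<lambda>x. r * u x + s * v x) \<in> V" "m u v = m v u"
  shows "m (\<lambda>x. r * u x + s * v x) (\<lambda>x. r * u x + s * v x) =
           r\<^sup>2 * m u u + 2 * r * s * m u v + s\<^sup>2 * m v v"
  using bilinear_formD[OF assms(1)] assms(2-5) by (simp add: algebra_simps power2_eq_square)

text \<open>Equivalence of norms in finite dimension by induction. Splitting off a function that is
  \<open>a\<close>-orthogonal to the old span makes \<open>a\<close> additive over the two
  components, while \<open>m\<close> is subadditive up to a factor 2.\<close>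

lemma spd_forms_equivalent:
  assumes "finite B" "spd_form_on (fs.span B) m" "spd_form_on (fs.span B) a"
  shows "\<exists>C>0. \<forall>u\<in>fs.span B. m u u \<le> C * a u u"
  using assms
proof (induction B rule: finite_induct)
  case empty
  have "fs.span {} = {\<lambda>x. 0}" by (simp add: zero_fun_def)
  moreover have "m (\<lambda>x. 0) (\<lambda>x. 0) = 0" "a (\<lambda>x. 0) (\<lambda>x. 0) = 0"
    using bilinear_form_zero(1)[OF spd_formD(1)[OF empty(1)] span_zero_fun span_zero_fun]
      bilinear_form_zero(1)[OF spd_formD(1)[OF empty(2)] span_zero_fun span_zero_fun] by auto
  ultimately show ?case by (auto intro: exI[of _ 1])
next
  case (insert b B)
  let ?V = "fs.span (insert b B)" and ?W = "fs.span B"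
  have sub: "?W \<subseteq> ?V" by (rule fs.span_mono) auto
  have b: "b \<in> ?V" by (simp add: fs.span_base)
  have spdW: "spd_form_on ?W m" "spd_form_on ?W a"
    using insert.prems bilinear_form_on_subset[OF _ sub] sub unfolding spd_form_on_def by blast+
  obtain C where C: "C > 0" "\<And>u. u \<in> ?W \<Longrightarrow> m u u \<le> C * a u u"
    using insert.IH[OF spdW] by blast
  note D = bilinear_formD[OF spd_formD(1)[OF insert.prems(2)]]
  have "\<exists>z\<in>?W. \<forall>v\<in>?W. a z v = a b v"
    using insert.hyps(1) spd_formD(1,3)[OF spdW(2)] D(2)[OF _ _ b] sub
    by (intro positive_bilinear_form_solvable) (blast | auto)+
  then obtain z where z: "z \<in> ?W" "\<And>v. v \<in> ?W \<Longrightarrow> a z v = a b v" by blast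
  define b' where "b' = (\<lambda>x. 1 * b x + (-1) * z x)"
  have b'V: "b' \<in> ?V" unfolding b'_def using b z sub by (intro span_lincomb) auto
  have ort: "a b' v = 0" if "v \<in> ?W" for v
    unfolding b'_def using D(1)[OF b _ , of z v 1 "-1"] z that sub by (auto simp: subset_iff)
  show ?case
  proof (cases "b' = (\<lambda>x. 0)")
    case True
    then have "b = z" by (auto simp: b'_def fun_eq_iff)
    then have "?V = ?W" using z(1) by (simp add: fs.span_redundant)
    then show ?thesis using C by auto
  next
    case False
    then have pos: "0 < a b' b'" using spd_formD(3)[OF insert.prems(2)] b'V by blast
    have mb: "0 \<le> m b' b'" using spd_form_nonneg[OF insert.prems(1) b'V] .
    \<comment> \<open>The 2 comes from \<open>m(x + y, x + y) <= 2 m(x, x) + 2 m(y, y)\<close>; the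
      quotient pays for the component along \<open>b'\<close>.\<close>
    define C' where "C' = 2 * C + 2 * m b' b' / a b' b'"
    have C': "C' > 0" using C(1) mb pos by (simp add: C'_def add_pos_nonneg)
    have "m v v \<le> C' * a v v" if vV: "v \<in> ?V" for v
    proof -
      obtain v' r where v': "v' \<in> ?W" "v = (\<lambda>x. 1 * v' x + r * b' x)"
        unfolding b'_def using vV z(1) by (rule span_insert_shiftedE)
      have v'V: "v' \<in> ?V" using v' sub by auto
      have sa: "a v' b' = a b' v'" "m v' b' = m b' v'"
        using spd_formD(2) insert.prems v'V b'V by blast+
      have a: "a v v = a v' v' + r\<^sup>2 * a b' b'"
        using form_square_lincomb[of ?V a v' b' 1 r, OF spd_formD(1)[OF insert.prems(2)] v'V b'V _ sa(1)]
          vV v' ort[OF v'(1)] sa by simp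
      \<comment> \<open>Positivity of \<open>m\<close> at this reflected combination bounds the
        mixed term.\<close>
      have w: "(\<lambda>x. 1 * v' x + (- r) * b' x) \<in> ?V" by (intro span_lincomb v'V b'V)
      have "m v v = m v' v' + 2 * r * m v' b' + r\<^sup>2 * m b' b'"
        using form_square_lincomb[of ?V m v' b' 1 r, OF spd_formD(1)[OF insert.prems(1)] v'V b'V _ sa(2)]
          vV v' by simp
      also have "\<dots> \<le> 2 * m v' v' + 2 * r\<^sup>2 * m b' b'"
        using spd_form_nonneg[OF insert.prems(1) w]
          form_square_lincomb[of ?V m v' b' 1 "-r", OF spd_formD(1)[OF insert.prems(1)] v'V b'V w sa(2)]
        by (simp add: mult.commute)
      also have "\<dots> \<le> 2 * (C * a v' v') + 2 * r\<^sup>2 * m b' b'"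
        using C(2)[OF v'(1)] by simp
      also have "\<dots> \<le> C' * a v v"
      proof -
        have "C' * a v v = 2 * C * a v' v' + 2 * C * r\<^sup>2 * a b' b'
               + 2 * m b' b' / a b' b' * a v' v' + 2 * r\<^sup>2 * m b' b'"
          using pos by (simp add: C'_def a field_simps)
        moreover have "0 \<le> 2 * m b' b' / a b' b' * a v' v'"
          using mb pos spd_form_nonneg[OF insert.prems(2) v'V] by simp
        moreover have "0 \<le> 2 * C * r\<^sup>2 * a b' b'" using C(1) pos by simp
        ultimately show ?thesis by simp
      qed
      finally show ?thesis .
    qed
    then show ?thesis using C' by blast
  qed
qed

lemma linear_map_onD:
  assumes "linear_map_on V A" "u \<in> V"
  shows "A u \<in> V" "v \<in> V \<Longrightarrow> A (\<lambda>x. a * u x + b * v x) = (\<lambda>x. a * A u x + b * A v x)"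
  using assms unfolding linear_map_on_def by blast+

text \<open>The supremum of the Rayleigh quotient is an eigenvalue: otherwise the corresponding shifted
  form would be definite, hence bounded below, and the supremum could be lowered.\<close>

lemma self_adjoint_eigenvalue_exists:
  assumes fin: "finite B" and spd: "spd_form_on (fs.span B) m"
    and sa: "self_adjoint_on (fs.span B) m A"
    and bd: "\<And>u. u \<in> fs.span B \<Longrightarrow> m (A u) u \<le> c * m u u"
    and v0: "v0 \<in> fs.span B" "v0 \<noteq> (\<lambda>x. 0)"
  shows "eigenvalues_on (fs.span B) A \<noteq> {}"
proof
  let ?V = "fs.span B"
  assume empty: "eigenvalues_on ?V A = {}"
  note D = bilinear_formD[OF spd_formD(1)[OF spd]]
  have lin: "linear_map_on ?V A" and sym: "\<And>u v. u \<in> ?V \<Longrightarrow> v \<in> ?V \<Longrightarrow> m (A u) v = m u (A v)"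
    using sa by (auto simp: self_adjoint_on_def)
  define R where "R = (\<lambda>u. m (A u) u / m u u) ` (?V - {\<lambda>x. 0})"
  have mpos: "0 < m u u" if "u \<in> ?V - {\<lambda>x. 0}" for u using spd_formD(3)[OF spd] that by blast
  have bdd: "bdd_above R"
    unfolding R_def by (rule bdd_aboveI2[of _ _ c]) (use mpos bd in \<open>auto simp: divide_le_eq\<close>)
  have ne: "R \<noteq> {}" using v0 by (auto simp: R_def)
  define l where "l = Sup R"
  define a where "a = (\<lambda>u v. m (\<lambda>x. l * u x + (-1) * A u x) v)"
  have aeq: "a u v = l * m u v - m (A u) v" if "u \<in> ?V" "v \<in> ?V" for u v
    using D(1)[of u "A u" v l "-1"] linear_map_onD(1)[OF lin that(1)] that by (simp add: a_def)
  have ub: "m (A u) u \<le> l * m u u" if "u \<in> ?V" for u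
  proof (cases "u = (\<lambda>x. 0)")
    case True
    then show ?thesis
      using bilinear_form_zero[OF spd_formD(1)[OF spd]] that linear_map_onD(1)[OF lin that] by simp
  next
    case False
    then have "m (A u) u / m u u \<le> l"
      unfolding l_def using bdd that by (intro cSup_upper) (auto simp: R_def)
    then show ?thesis using mpos[of u] False that by (simp add: divide_le_eq)
  qed
  have bil: "bilinear_form_on ?V a"
    unfolding bilinear_form_on_def
  proof (intro ballI allI)
    fix u v z r s assume V: "u \<in> ?V" "v \<in> ?V" "z \<in> ?V"
    have AV: "A u \<in> ?V" "A v \<in> ?V" "A z \<in> ?V" using linear_map_onD(1)[OF lin] V by auto
    have uv: "(\<lambda>x. r * u x + s * v x) \<in> ?V" by (intro span_lincomb V)
    show "a (\<lambda>x. r * u x + s * v x) z = r * a u z + s * a v z \<and>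
          a z (\<lambda>x. r * u x + s * v x) = r * a z u + s * a z v"
      using linear_map_onD(2)[OF lin V(1,2)] D V AV uv by (simp add: aeq algebra_simps)
  qed
  have asym: "a u v = a v u" if "u \<in> ?V" "v \<in> ?V" for u v
    using sym[OF that] spd_formD(2)[OF spd] that linear_map_onD(1)[OF lin] by (simp add: aeq)
  have apos: "0 < a u u" if u: "u \<in> ?V" "u \<noteq> (\<lambda>x. 0)" for u
  proof (rule ccontr)
    assume "\<not> 0 < a u u"
    then have 0: "a u u = 0" using ub[OF u(1)] by (simp add: aeq u)
    \<comment> \<open>A null vector of a semidefinite form is orthogonal to everything. Testing with
      \<open>l u - A u\<close> itself then makes \<open>u\<close> an eigenvector.\<close>
    have ort: "a u v = 0" if v: "v \<in> ?V" for v
    proof (rule ccontr)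
      assume n: "a u v \<noteq> 0"
      have vv: "0 \<le> a v v" using ub[OF v] by (simp add: aeq v)
      \<comment> \<open>As \<open>a u u = 0\<close>, the form is affine in \<open>t\<close> along
        \<open>t u + v\<close>; this \<open>t\<close> gives it the value -1.\<close>
      define t where "t = - (a v v + 1) / (2 * a u v)"
      have w: "(\<lambda>x. t * u x + 1 * v x) \<in> ?V" by (intro span_lincomb u v)
      have "0 \<le> a (\<lambda>x. t * u x + 1 * v x) (\<lambda>x. t * u x + 1 * v x)"
        using ub[OF w] unfolding aeq[OF w w] by linarith
      also have "\<dots> = 2 * t * a u v + a v v"
        using form_square_lincomb[of ?V a u v t 1, OF bil u(1) v w asym[OF u(1) v]] 0 by simp
      also have "\<dots> = -1" using n by (simp add: t_def field_simps)
      finally show False by simp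
    qed
    define z where "z = (\<lambda>x. l * u x + (-1) * A u x)"
    have z: "z \<in> ?V" unfolding z_def by (intro span_lincomb u linear_map_onD(1)[OF lin])
    have "m z z = 0" using ort[OF z] by (simp add: a_def z_def)
    then have "z = (\<lambda>x. 0)" using spd_formD(3)[OF spd z] by force
    then have "A u = (\<lambda>x. l * u x)" by (auto simp: z_def fun_eq_iff)
    then have "l \<in> eigenvalues_on ?V A" using u by (auto simp: eigenvalues_on_def)
    then show False using empty by simp
  qed
  have "spd_form_on ?V a" using bil asym apos by (auto simp: spd_form_on_def)
  then obtain C where C: "C > 0" "\<And>u. u \<in> ?V \<Longrightarrow> m u u \<le> C * a u u"
    using spd_forms_equivalent[OF fin spd] by blast
  have "r \<le> l - 1 / C" if "r \<in> R" for r
  proof -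
    from that obtain u where u: "u \<in> ?V" "u \<noteq> (\<lambda>x. 0)" "r = m (A u) u / m u u"
      by (auto simp: R_def)
    have p: "0 < m u u" using mpos u by auto
    have "m (A u) u \<le> (l - 1 / C) * m u u"
      using C(2)[OF u(1)] C(1) by (simp add: aeq[OF u(1) u(1)] field_simps)
    then show ?thesis using p u by (simp add: divide_le_eq)
  qed
  then have "l \<le> l - 1 / C" unfolding l_def using ne by (intro cSup_least)
  then show False using C(1) by simp
qed

lemma bilinear_form_sum:
  assumes bil: "bilinear_form_on (fs.span B) m" and "finite I" "f ` I \<subseteq> fs.span B" "z \<in> fs.span B"
  shows "m (\<lambda>x. \<Sum>i\<in>I. c i * f i x) z = (\<Sum>i\<in>I. c i * m (f i) z)
    \<and> (\<lambda>x. \<Sum>i\<in>I. c i * f i x) \<in> fs.span B"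
  using assms(2,3)
proof (induction I rule: finite_induct)
  case empty
  then show ?case
    using bilinear_form_zero(1)[OF bil assms(4) span_zero_fun] span_zero_fun by simp
next
  case (insert t T)
  then have T: "(\<lambda>x. \<Sum>i\<in>T. c i * f i x) \<in> fs.span B" and t: "f t \<in> fs.span B" by auto
  show ?case
    using insert bilinear_formD(1)[OF bil t T assms(4), of "c t" 1] span_lincomb[OF t T, of "c t" 1]
    by simp
qed

text \<open>Choosing one eigenvector per eigenvalue gives an \<open>m\<close>-orthogonal, hence
  independent family, which cannot be larger than the spanning set.\<close>

lemma self_adjoint_finite_eigenvalues:
  assumes fin: "finite B" and spd: "spd_form_on (fs.span B) m"
    and sa: "self_adjoint_on (fs.span B) m A"
  shows "finite (eigenvalues_on (fs.span B) A)"
proof -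
  let ?V = "fs.span B" and ?E = "eigenvalues_on (fs.span B) A"
  note D = bilinear_formD[OF spd_formD(1)[OF spd]]
  define f where "f = (\<lambda>l. SOME v. v \<in> ?V \<and> v \<noteq> (\<lambda>x. 0) \<and> A v = (\<lambda>x. l * v x))"
  have f: "f l \<in> ?V" "f l \<noteq> (\<lambda>x. 0)" "A (f l) = (\<lambda>x. l * f l x)" if "l \<in> ?E" for l
  proof -
    have "\<exists>v. v \<in> ?V \<and> v \<noteq> (\<lambda>x. 0) \<and> A v = (\<lambda>x. l * v x)"
      using that by (auto simp: eigenvalues_on_def)
    from someI_ex[OF this] show "f l \<in> ?V" "f l \<noteq> (\<lambda>x. 0)" "A (f l) = (\<lambda>x. l * f l x)"
      by (auto simp: f_def)
  qed
  have ort: "m (f l) (f k) = 0" if "l \<in> ?E" "k \<in> ?E" "l \<noteq> k" for l k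
  proof -
    have "l * m (f l) (f k) = m (A (f l)) (f k)"
      using D(1)[OF f(1)[OF that(1)] f(1)[OF that(1)] f(1)[OF that(2)], of l 0] f(3)[OF that(1)] by simp
    also have "\<dots> = m (f l) (A (f k))"
      using sa f(1) that unfolding self_adjoint_on_def by blast
    also have "\<dots> = k * m (f l) (f k)"
      using D(2)[OF f(1)[OF that(2)] f(1)[OF that(2)] f(1)[OF that(1)], of k 0] f(3)[OF that(2)] by simp
    finally show ?thesis using that(3) by simp
  qed
  have "inj_on f ?E"
  proof (rule inj_onI, rule ccontr)
    fix l k assume "l \<in> ?E" "k \<in> ?E" "f l = f k" "l \<noteq> k"
    then show False using ort[of l k] spd_formD(3)[OF spd f(1) f(2), of l] by simp
  qed
  have "\<not> fs.dependent (f ` ?E)"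
  proof
    assume "fs.dependent (f ` ?E)"
    then obtain T c v where T: "finite T" "T \<subseteq> f ` ?E" "(\<Sum>v\<in>T. (\<lambda>x. c v * v x)) = 0"
      "v \<in> T" "c v \<noteq> 0"
      unfolding fs.dependent_explicit by blast
    have TV: "T \<subseteq> ?V" using T f by auto
    have z: "(\<lambda>x. \<Sum>u\<in>T. c u * u x) = (\<lambda>x. 0)"
    proof
      fix x
      have "(\<Sum>u\<in>T. c u * u x) = (\<Sum>v\<in>T. (\<lambda>x. c v * v x)) x"
        using T(1) by (induction T rule: finite_induct) auto
      then show "(\<Sum>u\<in>T. c u * u x) = 0" using T(3) by simp
    qed
    have "0 = m (\<lambda>x. \<Sum>u\<in>T. c u * u x) v"
      unfolding z using bilinear_form_zero(1)[OF spd_formD(1)[OF spd] _ span_zero_fun] TV T(4) by auto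
    also have "\<dots> = (\<Sum>u\<in>T. c u * m u v)"
      using bilinear_form_sum[OF spd_formD(1)[OF spd] T(1), of "\<lambda>u. u" v c] TV T(4) by auto
    also have "\<dots> = (\<Sum>u\<in>T. if u = v then c v * m v v else 0)"
    proof (rule sum.cong)
      fix u assume u: "u \<in> T"
      obtain l k where "l \<in> ?E" "k \<in> ?E" "u = f l" "v = f k"
        using u T(2,4) by blast
      then show "c u * m u v = (if u = v then c v * m v v else 0)"
        using ort[of l k] by auto
    qed simp
    also have "\<dots> = c v * m v v" using T by simp
    finally have "m v v = 0" using T(5) by simp
    moreover obtain l where "l \<in> ?E" "v = f l" using T(2,4) by blast
    ultimately show False using spd_formD(3)[OF spd, of v] f(1,2)[of l] by simp
  qed
  then have "finite (f ` ?E)"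
    using fs.independent_span_bound[OF fin, of "f ` ?E"] f(1) by blast
  then show ?thesis using \<open>inj_on f ?E\<close> by (simp add: finite_image_iff)
qed


section \<open>Weighted averages of coercive solution maps paired by adjointness\<close>

locale averaged_response =
  fixes B :: "('a \<Rightarrow> real) set" and m :: "('a \<Rightarrow> real) \<Rightarrow> ('a \<Rightarrow> real) \<Rightarrow> real"
    and I :: "'i set" and w :: "'i \<Rightarrow> real" and s :: "'i \<Rightarrow> 'i"
    and b :: "'i \<Rightarrow> ('a \<Rightarrow> real) \<Rightarrow> ('a \<Rightarrow> real) \<Rightarrow> real"
    and T :: "'i \<Rightarrow> ('a \<Rightarrow> real) \<Rightarrow> ('a \<Rightarrow> real)"
  assumes finite_B: "finite B" and spd: "spd_form_on (fs.span B) m"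
    and finite_I: "finite I" and w_pos: "\<And>k. k \<in> I \<Longrightarrow> 0 < w k" and w_sum: "(\<Sum>k\<in>I. w k) = 1"
    and s_bij: "bij_betw s I I" and w_s: "\<And>k. k \<in> I \<Longrightarrow> w (s k) = w k"
    and bil: "\<And>k. k \<in> I \<Longrightarrow> bilinear_form_on (fs.span B) (b k)"
    and coercive: "\<And>k u. k \<in> I \<Longrightarrow> u \<in> fs.span B \<Longrightarrow> m u u \<le> b k u u"
    and adjoint: "\<And>k u v. k \<in> I \<Longrightarrow> u \<in> fs.span B \<Longrightarrow> v \<in> fs.span B \<Longrightarrow> b k u v = b (s k) v u"
    and T_in: "\<And>k g. k \<in> I \<Longrightarrow> g \<in> fs.span B \<Longrightarrow> T k g \<in> fs.span B"
    and T_eq: "\<And>k g v. k \<in> I \<Longrightarrow> g \<in> fs.span B \<Longrightarrow> v \<in> fs.span B \<Longrightarrow> b k (T k g) v = m g v"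
begin

abbreviation "V \<equiv> fs.span B"

definition H :: "('a \<Rightarrow> real) \<Rightarrow> ('a \<Rightarrow> real)" where
  "H g = (\<lambda>x. \<Sum>k\<in>I. w k * T k g x)"

lemmas mD = bilinear_formD[OF spd_formD(1)[OF spd]]
lemmas m_sym = spd_formD(2)[OF spd]
lemmas m_pos = spd_formD(3)[OF spd]
lemmas m_nonneg = spd_form_nonneg[OF spd]

lemma zero_of_m_zero: "u \<in> V \<Longrightarrow> m u u \<le> 0 \<Longrightarrow> u = (\<lambda>x. 0)"
  using m_pos by force

lemma H_in: "g \<in> V \<Longrightarrow> H g \<in> V"
  unfolding H_def
  using bilinear_form_sum[OF spd_formD(1)[OF spd] finite_I, of "\<lambda>k. T k g" g w] T_in by blast

lemma m_H: "g \<in> V \<Longrightarrow> z \<in> V \<Longrightarrow> m (H g) z = (\<Sum>k\<in>I. w k * m (T k g) z)"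
  unfolding H_def
  using bilinear_form_sum[OF spd_formD(1)[OF spd] finite_I, of "\<lambda>k. T k g" z w] T_in by blast

lemma T_unique:
  assumes "k \<in> I" "u \<in> V" "u' \<in> V" "\<And>v. v \<in> V \<Longrightarrow> b k u v = b k u' v"
  shows "u = u'"
proof -
  let ?d = "\<lambda>x. 1 * u x + (-1) * u' x"
  have d: "?d \<in> V" by (intro span_lincomb assms)
  have "b k ?d ?d = 0"
    using bilinear_formD(1)[OF bil[OF assms(1)] assms(2,3) d, of 1 "-1"] assms(4)[OF d] by simp
  then have "?d = (\<lambda>x. 0)" using coercive[OF assms(1) d] zero_of_m_zero[OF d] by simp
  then show ?thesis by (auto simp: fun_eq_iff)
qed

lemma T_linear:
  assumes "k \<in> I" "u \<in> V" "v \<in> V"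
  shows "T k (\<lambda>x. r * u x + t * v x) = (\<lambda>x. r * T k u x + t * T k v x)"
proof (rule T_unique[OF assms(1)])
  have uv: "(\<lambda>x. r * u x + t * v x) \<in> V" by (intro span_lincomb assms)
  show "T k (\<lambda>x. r * u x + t * v x) \<in> V" using T_in[OF assms(1) uv] .
  show "(\<lambda>x. r * T k u x + t * T k v x) \<in> V" by (intro span_lincomb T_in assms)
  fix z assume z: "z \<in> V"
  show "b k (T k (\<lambda>x. r * u x + t * v x)) z = b k (\<lambda>x. r * T k u x + t * T k v x) z"
    using bilinear_formD(1)[OF bil[OF assms(1)] T_in[OF assms(1,2)] T_in[OF assms(1,3)] z, of r t]
      T_eq[OF assms(1) _ z] assms uv mD(1)[OF assms(2,3) z, of r t] by simp
qed

lemma H_linear: "linear_map_on V H"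
  unfolding linear_map_on_def
proof (intro conjI ballI allI)
  fix u v r t assume "u \<in> V" "v \<in> V"
  then show "H (\<lambda>x. r * u x + t * v x) = (\<lambda>x. r * H u x + t * H v x)"
    using T_linear
    by (simp add: H_def fun_eq_iff sum.distrib sum_distrib_left algebra_simps cong: sum.cong)
qed (rule H_in)

lemma H_self_adjoint: "self_adjoint_on V m H"
  unfolding self_adjoint_on_def
proof (intro conjI ballI H_linear)
  fix f g assume f: "f \<in> V" and g: "g \<in> V"
  have sI: "s k \<in> I" if "k \<in> I" for k using s_bij that by (auto simp: bij_betw_def)
  have "m (T k f) g = m f (T (s k) g)" if k: "k \<in> I" for k
  proof -
    have "m (T k f) g = m g (T k f)" using m_sym T_in f g k by blast
    also have "\<dots> = b (s k) (T (s k) g) (T k f)" using T_eq[OF sI[OF k] g] T_in f k by simp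
    also have "\<dots> = b k (T k f) (T (s k) g)" using adjoint[OF k] T_in f g k sI by simp
    also have "\<dots> = m f (T (s k) g)" using T_eq[OF k f] T_in[OF sI[OF k] g] by simp
    finally show ?thesis .
  qed
  \<comment> \<open>Each weight is rewritten as \<open>w (s k)\<close>, so that the whole summand
    depends on \<open>s k\<close> and the sum can be reindexed.\<close>
  then have "m (H f) g = (\<Sum>k\<in>I. w (s k) * m f (T (s k) g))"
    using m_H[OF f g] w_s by simp
  also have "\<dots> = (\<Sum>k\<in>I. w k * m f (T k g))"
    by (rule sum.reindex_bij_betw[OF s_bij])
  also have "\<dots> = m (H g) f" using m_H[OF g f] m_sym[OF f] T_in g by simp
  also have "\<dots> = m f (H g)" using m_sym H_in f g by blast
  finally show "m (H f) g = m f (H g)" .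
qed

text \<open>Coercivity with constant 1, tested with the solution itself. The estimate serves twice:
  it makes the average positive, and it is the link from the squared norms of the solutions back to
  \<open>m (H g) g\<close>.\<close>

lemma m_T_lower: "k \<in> I \<Longrightarrow> g \<in> V \<Longrightarrow> m (T k g) (T k g) \<le> m (T k g) g"
  using coercive[of k "T k g"] T_eq[of k g "T k g"] T_in m_sym[of g "T k g"] by simp

lemma H_positive: "positive_definite_on V m H"
  unfolding positive_definite_on_def
proof (intro ballI impI)
  fix g assume g: "g \<in> V" "g \<noteq> (\<lambda>x. 0)"
  have "0 < m (T k g) g" if k: "k \<in> I" for k
  proof -
    have "T k g \<noteq> (\<lambda>x. 0)"
    proof
      assume "T k g = (\<lambda>x. 0)"
      then have "m g g = 0"
        using T_eq[OF k g(1) g(1)] bilinear_form_zero(1)[OF bil[OF k] g(1) span_zero_fun] by simp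
      then show False using m_pos g by force
    qed
    then show ?thesis using m_pos[OF T_in[OF k g(1)]] m_T_lower[OF k g(1)] by simp
  qed
  moreover have "I \<noteq> {}" using w_sum by auto
  ultimately show "0 < m (H g) g"
    unfolding m_H[OF g(1) g(1)] using w_pos finite_I by (intro sum_pos) auto
qed

lemma m_diff_expand:
  assumes "u \<in> V" "v \<in> V"
  shows "m (\<lambda>x. u x - v x) (\<lambda>x. u x - v x) = m u u - 2 * m u v + m v v"
    "(\<lambda>x. u x - v x) \<in> V"
proof -
  have V: "(\<lambda>x. 1 * u x + (-1) * v x) \<in> V" by (intro span_lincomb assms)
  then show "(\<lambda>x. u x - v x) \<in> V" by simp
  show "m (\<lambda>x. u x - v x) (\<lambda>x. u x - v x) = m u u - 2 * m u v + m v v"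
    using form_square_lincomb[of V m u v 1 "-1", OF spd_formD(1)[OF spd] assms V m_sym[OF assms]]
    by simp
qed

text \<open>Completing the square with \<open>b k (T k g) (T k g) = m g (T k g)\<close>. Both
  summands are nonnegative: the distance of \<open>g\<close> from its response and the excess of the
  form over \<open>m\<close>, which for transport is the jump energy.\<close>

lemma gap_expand:
  assumes "k \<in> I" "g \<in> V"
  shows "m g g - m (T k g) g = m (\<lambda>x. g x - T k g x) (\<lambda>x. g x - T k g x)
           + (b k (T k g) (T k g) - m (T k g) (T k g))"
  using m_diff_expand(1)[OF assms(2) T_in[OF assms]] T_eq[OF assms T_in[OF assms]]
    m_sym[OF assms(2) T_in[OF assms]] by simp

lemma gap_nonneg:
  assumes "k \<in> I" "g \<in> V"
  shows "0 \<le> m g g - m (T k g) g"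
  unfolding gap_expand[OF assms]
  using m_nonneg[OF m_diff_expand(2)[OF assms(2) T_in[OF assms]]] coercive[OF assms(1) T_in[OF assms]]
  by simp

lemma H_gap:
  assumes "g \<in> V"
  shows "m g g - m (H g) g = (\<Sum>k\<in>I. w k * (m g g - m (T k g) g))"
proof -
  have "m g g = (\<Sum>k\<in>I. w k) * m g g" by (simp add: w_sum)
  then show ?thesis
    by (simp add: m_H assms sum_subtractf right_diff_distrib sum_distrib_right)
qed

lemma H_le: "g \<in> V \<Longrightarrow> m (H g) g \<le> m g g"
  using H_gap[of g] gap_nonneg w_pos sum_nonneg[of I "\<lambda>k. w k * (m g g - m (T k g) g)"]
  by (simp add: less_imp_le)

text \<open>All gaps are nonnegative and all weights positive, so a vanishing average gap vanishes
  for each index; the square in \<open>gap_expand\<close> then forces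
  \<open>T k g = g\<close>.\<close>

lemma H_eqD:
  assumes g: "g \<in> V" "m g g \<le> m (H g) g" and k: "k \<in> I"
  shows "T k g = g" "b k g g = m g g"
proof -
  have "(\<Sum>k\<in>I. w k * (m g g - m (T k g) g)) = 0"
    using H_gap[OF g(1)] H_le[OF g(1)] g(2) by simp
  then have "\<forall>k\<in>I. w k * (m g g - m (T k g) g) = 0"
    using gap_nonneg[OF _ g(1)] w_pos
    by (subst (asm) sum_nonneg_eq_0_iff[OF finite_I]) (auto simp: less_imp_le)
  then have 0: "m g g - m (T k g) g = 0" using k w_pos[OF k] by auto
  note dV = m_diff_expand(2)[OF g(1) T_in[OF k g(1)]]
  have "m (\<lambda>x. g x - T k g x) (\<lambda>x. g x - T k g x) \<le> 0"
    using 0 unfolding gap_expand[OF k g(1)] using coercive[OF k T_in[OF k g(1)]] by simp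
  from zero_of_m_zero[OF dV this] show 1: "T k g = g" by (auto simp: fun_eq_iff)
  show "b k g g = m g g" using T_eq[OF k g(1) g(1)] 1 by simp
qed

lemma m_square_convex:
  assumes g: "g \<in> V"
  shows "m (H g) (H g) \<le> m (H g) g"
proof -
  note h = H_in[OF g]
  \<comment> \<open>The weighted variance of the responses about their mean \<open>H g\<close>; as
    the weights sum to 1, it equals the mean square minus the square of the mean.\<close>
  have "0 \<le> (\<Sum>k\<in>I. w k * m (\<lambda>x. T k g x - H g x) (\<lambda>x. T k g x - H g x))"
    using m_nonneg[OF m_diff_expand(2)[OF T_in[OF _ g] h]] w_pos
    by (intro sum_nonneg) (auto simp: less_imp_le)
  also have "\<dots> = (\<Sum>k\<in>I. w k * m (T k g) (T k g) - 2 * (w k * m (T k g) (H g)) + w k * m (H g) (H g))"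
    by (intro sum.cong refl, subst m_diff_expand(1)[OF T_in[OF _ g] h]) (simp_all add: algebra_simps)
  also have "\<dots> = (\<Sum>k\<in>I. w k * m (T k g) (T k g)) - m (H g) (H g)"
    by (simp add: sum.distrib sum_subtractf m_H[OF g h] w_sum
        flip: sum_distrib_left sum_distrib_right)
  also have "(\<Sum>k\<in>I. w k * m (T k g) (T k g)) \<le> m (H g) g"
    unfolding m_H[OF g g] using m_T_lower[OF _ g] w_pos
    by (intro sum_mono mult_left_mono) (auto simp: less_imp_le)
  finally show ?thesis by simp
qed

text \<open>Injectivity is definiteness. For surjectivity \<open>H u = g\<close> is solved weakly,
  with the positive form \<open>m (H u) v\<close>; the residual lies in the space and is therefore
  zero.\<close>

lemma H_bij: "bij_betw H V V"
  unfolding bij_betw_def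
proof
  show "inj_on H V"
  proof (rule inj_onI)
    fix u v assume uv: "u \<in> V" "v \<in> V" "H u = H v"
    note d = m_diff_expand(2)[OF uv(1,2)]
    have "H (\<lambda>x. 1 * u x + (-1) * v x) = (\<lambda>x. 0)"
      using linear_map_onD(2)[OF H_linear uv(1,2), of 1 "-1"] uv(3) by simp
    then have "m (H (\<lambda>x. u x - v x)) (\<lambda>x. u x - v x) = 0"
      using bilinear_form_zero(1)[OF spd_formD(1)[OF spd] d span_zero_fun] by simp
    then have "(\<lambda>x. u x - v x) = (\<lambda>x. 0)"
      using H_positive d unfolding positive_definite_on_def by force
    then show "u = v" by (auto simp: fun_eq_iff)
  qed
  show "H ` V = V"
  proof
    show "H ` V \<subseteq> V" using H_in by blast
    show "V \<subseteq> H ` V"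
    proof
      fix g assume g: "g \<in> V"
      have "bilinear_form_on V (\<lambda>u v. m (H u) v)"
        unfolding bilinear_form_on_def
        using linear_map_onD(2)[OF H_linear] H_in mD by (simp add: span_lincomb)
      then have "\<exists>u\<in>V. \<forall>v\<in>V. m (H u) v = m g v"
        using H_positive mD(2)[OF _ _ g] finite_B
        by (intro positive_bilinear_form_solvable) (auto simp: positive_definite_on_def)
      then obtain u where u: "u \<in> V" "\<And>v. v \<in> V \<Longrightarrow> m (H u) v = m g v" by blast
      note d = m_diff_expand(2)[OF H_in[OF u(1)] g]
      have "m (\<lambda>x. 1 * H u x + (-1) * g x) (\<lambda>x. H u x - g x) = 0"
        using mD(1)[OF H_in[OF u(1)] g d, of 1 "-1"] u(2)[OF d] by simp
      then have "(\<lambda>x. H u x - g x) = (\<lambda>x. 0)" using zero_of_m_zero[OF d] by simp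
      then have "H u = g" by (auto simp: fun_eq_iff)
      then show "g \<in> H ` V" using u by blast
    qed
  qed
qed

lemma shifted_inverse_spd:
  assumes "c < 1" "0 < e"
  shows "spd_form_on V (\<lambda>u v. e * m (\<lambda>x. inv_into V H u x - c * u x) v)"
proof -
  let ?G = "inv_into V H"
  have G: "?G u \<in> V" "H (?G u) = u" if "u \<in> V" for u
    using that H_bij by (auto simp: bij_betw_def inv_into_into f_inv_into_f)
  have Glin: "?G (\<lambda>x. r * u x + t * v x) = (\<lambda>x. r * ?G u x + t * ?G v x)"
    if "u \<in> V" "v \<in> V" for r t u v
  proof -
    have "H (\<lambda>x. r * ?G u x + t * ?G v x) = (\<lambda>x. r * u x + t * v x)"
      using linear_map_onD(2)[OF H_linear] G that by simp
    then show ?thesis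
      using bij_betw_inv_into_left[OF H_bij span_lincomb[OF G(1)[OF that(1)] G(1)[OF that(2)], of r t]]
      by simp
  qed
  have expand: "m (\<lambda>x. ?G u x - c * u x) v = m (?G u) v - c * m u v" if "u \<in> V" "v \<in> V" for u v
    using mD(1)[OF G(1)[OF that(1)] that, of 1 "-c"] by simp
  have sym: "m (?G u) v = m (?G v) u" if "u \<in> V" "v \<in> V" for u v
  proof -
    have "m (?G u) v = m (?G u) (H (?G v))" using G that by simp
    also have "\<dots> = m (H (?G u)) (?G v)"
      using H_self_adjoint G(1)[OF that(1)] G(1)[OF that(2)] unfolding self_adjoint_on_def by simp
    also have "\<dots> = m (?G v) u" using m_sym[OF that(1) G(1)[OF that(2)]] G(2)[OF that(1)] by simp
    finally show ?thesis .
  qed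
  show ?thesis
    unfolding spd_form_on_def
  proof (intro conjI ballI impI)
    show "bilinear_form_on V (\<lambda>u v. e * m (\<lambda>x. ?G u x - c * u x) v)"
      unfolding bilinear_form_on_def
    proof (intro ballI allI)
      fix u v z r t assume V: "u \<in> V" "v \<in> V" "z \<in> V"
      have uv: "(\<lambda>x. r * u x + t * v x) \<in> V" by (intro span_lincomb V)
      show "e * m (\<lambda>x. ?G (\<lambda>x. r * u x + t * v x) x - c * (r * u x + t * v x)) z =
              r * (e * m (\<lambda>x. ?G u x - c * u x) z) + t * (e * m (\<lambda>x. ?G v x - c * v x) z) \<and>
            e * m (\<lambda>x. ?G z x - c * z x) (\<lambda>x. r * u x + t * v x) =
              r * (e * m (\<lambda>x. ?G z x - c * z x) u) + t * (e * m (\<lambda>x. ?G z x - c * z x) v)"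
        unfolding expand[OF uv V(3)] expand[OF V(3) uv] expand[OF V(1,3)] expand[OF V(2,3)]
          expand[OF V(3,1)] expand[OF V(3,2)]
        unfolding Glin[OF V(1,2)]
          mD(1)[OF V] mD(1)[OF G(1)[OF V(1)] G(1)[OF V(2)] V(3)] mD(2)[OF V]
          mD(2)[OF V(1,2) G(1)[OF V(3)]]
        by (simp add: algebra_simps)
    qed
    fix u v assume uv: "u \<in> V" "v \<in> V"
    show "e * m (\<lambda>x. ?G u x - c * u x) v = e * m (\<lambda>x. ?G v x - c * v x) u"
      using expand uv sym m_sym by simp
  next
    fix v assume v: "v \<in> V" "v \<noteq> (\<lambda>x. 0)"
    \<comment> \<open>The inequality \<open>H^2 <= H\<close>, taken at the preimage of
      \<open>v\<close>.\<close>
    have "m v v \<le> m (?G v) v"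
      using m_square_convex[OF G(1)[OF v(1)]] G(2)[OF v(1)] m_sym[OF G(1)[OF v(1)] v(1)] by simp
    moreover have "c * m v v < m v v" using m_pos[OF v] assms(1) by simp
    ultimately show "0 < e * m (\<lambda>x. ?G v x - c * v x) v"
      using assms(2) expand[OF v(1) v(1)] by simp
  qed
qed

lemma eigenvectorE:
  assumes "l \<in> eigenvalues_on V H"
  obtains v where "v \<in> V" "v \<noteq> (\<lambda>x. 0)" "m (H v) v = l * m v v"
proof -
  from assms obtain v where v: "v \<in> V" "v \<noteq> (\<lambda>x. 0)" "H v = (\<lambda>x. l * v x)"
    unfolding eigenvalues_on_def by blast
  have "m (H v) v = l * m v v"
    using mD(1)[OF v(1) v(1) v(1), of l 0] v(3) by simp
  with v(1,2) show ?thesis by (rule that)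
qed

lemma eigenvalue_pos:
  assumes "l \<in> eigenvalues_on V H"
  shows "0 < l"
proof -
  obtain v where v: "v \<in> V" "v \<noteq> (\<lambda>x. 0)" "m (H v) v = l * m v v"
    using eigenvectorE[OF assms] .
  have "0 < m (H v) v" using H_positive v(1,2) by (simp add: positive_definite_on_def)
  then show ?thesis using m_pos[OF v(1,2)] unfolding v(3) by (rule zero_less_mult_pos2)
qed

lemma eigenvalue_le_1:
  assumes "l \<in> eigenvalues_on V H"
  shows "l \<le> 1"
proof -
  obtain v where v: "v \<in> V" "v \<noteq> (\<lambda>x. 0)" "m (H v) v = l * m v v"
    using eigenvectorE[OF assms] .
  then have "l * m v v \<le> 1 * m v v" using H_le[OF v(1)] by simp
  then show ?thesis using m_pos[OF v(1,2)] by (simp only: mult_le_cancel_right_pos)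
qed

lemma eigenvalue_less_1:
  assumes "loewner_less V m H (\<lambda>v. v)" "l \<in> eigenvalues_on V H"
  shows "l < 1"
proof -
  obtain v where v: "v \<in> V" "v \<noteq> (\<lambda>x. 0)" "m (H v) v = l * m v v"
    using eigenvectorE[OF assms(2)] .
  have "0 < m (\<lambda>x. 1 * v x + (-1) * H v x) v"
    using assms(1) v(1,2) unfolding loewner_less_def by simp
  then have "l * m v v < 1 * m v v"
    using mD(1)[OF v(1) H_in[OF v(1)] v(1), of 1 "-1"] v(3) by simp
  then show ?thesis using m_pos[OF v(1,2)] by (simp only: mult_less_cancel_right_pos)
qed

lemma eigenvalues_finite: "finite (eigenvalues_on V H)"
  using self_adjoint_finite_eigenvalues[OF finite_B spd H_self_adjoint] .

lemma eigenvalues_nonempty: "v \<in> V \<Longrightarrow> v \<noteq> (\<lambda>x. 0) \<Longrightarrow> eigenvalues_on V H \<noteq> {}"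
  using self_adjoint_eigenvalue_exists[OF finite_B spd H_self_adjoint, of 1] H_le by simp

end

section \<open>Lebesgue measure on slabs and hyperplanes\<close>

abbreviation slab :: "'a::euclidean_space \<Rightarrow> real \<Rightarrow> 'a set" where
  "slab a c \<equiv> {y. c \<le> a \<bullet> y \<and> a \<bullet> y \<le> c + 1}"

lemma slab_borel [measurable]: "slab a c \<in> sets borel"
  by measurable

lemma nn_integral_lborel_translate:
  fixes f :: "'a::euclidean_space \<Rightarrow> ennreal"
  assumes [measurable]: "f \<in> borel_measurable borel"
  shows "(\<integral>\<^sup>+x. f (c + x) \<partial>lborel) = (\<integral>\<^sup>+x. f x \<partial>lborel)"
proof -
  have "(\<integral>\<^sup>+x. f x \<partial>lborel) = (\<integral>\<^sup>+x. f x \<partial>distr lborel borel ((+) c))"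
    by (simp only: lborel_distr_plus)
  also have "\<dots> = (\<integral>\<^sup>+x. f (c + x) \<partial>lborel)"
    by (intro nn_integral_distr) auto
  finally show ?thesis ..
qed

text \<open>Along the line the value \<open>a \<bullet> y\<close> runs with speed
  \<open>a \<bullet> v\<close> through an interval of length 1. The identity is later inserted into
  integrals as a factor 1.\<close>

lemma nn_integral_slab_line:
  fixes a v x :: "'a::euclidean_space"
  assumes "a \<bullet> v \<noteq> 0"
  shows "ennreal \<bar>a \<bullet> v\<bar> * (\<integral>\<^sup>+t. indicator (slab a c) (x + t *\<^sub>R v) \<partial>lborel) = 1"
proof -
  let ?l = "(c - a \<bullet> x) / (a \<bullet> v)" and ?u = "(c + 1 - a \<bullet> x) / (a \<bullet> v)"
  have "indicator (slab a c) (x + t *\<^sub>R v) = (indicator {min ?l ?u..max ?l ?u} t :: ennreal)" for t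
    using assms
    by (cases "0 < a \<bullet> v")
       (auto simp: indicator_def inner_add_right min_def max_def field_simps not_less split: if_splits)
  then have "(\<integral>\<^sup>+t. indicator (slab a c) (x + t *\<^sub>R v) \<partial>lborel) = ennreal (max ?l ?u - min ?l ?u)"
    by simp
  also have "max ?l ?u - min ?l ?u = 1 / \<bar>a \<bullet> v\<bar>"
    using assms by (auto simp: min_def max_def field_simps abs_if)
  finally show ?thesis using assms by (simp flip: ennreal_mult)
qed

text \<open>Cavalieri's principle in any direction transversal to the slab, without adapted
  coordinates: insert the factor 1 of \<open>nn_integral_slab_line\<close>, exchange the integrals,
  translate by \<open>- t v\<close>, exchange back and reflect \<open>t\<close>.\<close>

lemma nn_integral_slab_fubini:
  fixes a v :: "'a::euclidean_space" and g :: "'a \<Rightarrow> ennreal"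
  assumes av: "a \<bullet> v \<noteq> 0" and g[measurable]: "g \<in> borel_measurable borel"
  shows "(\<integral>\<^sup>+x. g x \<partial>lborel) =
    ennreal \<bar>a \<bullet> v\<bar> * (\<integral>\<^sup>+x. indicator (slab a c) x * (\<integral>\<^sup>+t. g (x + t *\<^sub>R v) \<partial>lborel) \<partial>lborel)"
proof -
  have "(\<integral>\<^sup>+x. g x \<partial>lborel) =
      (\<integral>\<^sup>+x. ennreal \<bar>a \<bullet> v\<bar> * (\<integral>\<^sup>+t. g x * indicator (slab a c) (x + t *\<^sub>R v) \<partial>lborel) \<partial>lborel)"
    using nn_integral_slab_line[OF av]
    by (simp add: nn_integral_cmult mult.left_commute)
  also have "\<dots> = ennreal \<bar>a \<bullet> v\<bar> *
      (\<integral>\<^sup>+x. \<integral>\<^sup>+t. g x * indicator (slab a c) (x + t *\<^sub>R v) \<partial>lborel \<partial>lborel)"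
    by (simp add: nn_integral_cmult)
  also have "(\<integral>\<^sup>+x. \<integral>\<^sup>+t. g x * indicator (slab a c) (x + t *\<^sub>R v) \<partial>lborel \<partial>lborel) =
      (\<integral>\<^sup>+t. \<integral>\<^sup>+x. g x * indicator (slab a c) (x + t *\<^sub>R v) \<partial>lborel \<partial>lborel)"
    by (rule lborel_pair.Fubini'[symmetric]) simp
  also have "\<dots> = (\<integral>\<^sup>+t. \<integral>\<^sup>+x. g (x - t *\<^sub>R v) * indicator (slab a c) x \<partial>lborel \<partial>lborel)"
  proof (rule nn_integral_cong)
    fix t :: real
    show "(\<integral>\<^sup>+x. g x * indicator (slab a c) (x + t *\<^sub>R v) \<partial>lborel) =
        (\<integral>\<^sup>+x. g (x - t *\<^sub>R v) * indicator (slab a c) x \<partial>lborel)"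
      by (subst nn_integral_lborel_translate[of _ "- t *\<^sub>R v", symmetric]) simp_all
  qed
  also have "\<dots> = (\<integral>\<^sup>+x. \<integral>\<^sup>+t. g (x - t *\<^sub>R v) * indicator (slab a c) x \<partial>lborel \<partial>lborel)"
    by (rule lborel_pair.Fubini') simp
  also have "\<dots> = (\<integral>\<^sup>+x. indicator (slab a c) x * (\<integral>\<^sup>+t. g (x + t *\<^sub>R v) \<partial>lborel) \<partial>lborel)"
  proof (rule nn_integral_cong)
    fix x :: 'a
    have "(\<integral>\<^sup>+t. g (x - t *\<^sub>R v) \<partial>lborel) = (\<integral>\<^sup>+t. g (x + t *\<^sub>R v) \<partial>lborel)"
      by (subst nn_integral_real_affine[of "\<lambda>t. g (x + t *\<^sub>R v)" "-1" 0]) simp_all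
    then show "(\<integral>\<^sup>+t. g (x - t *\<^sub>R v) * indicator (slab a c) x \<partial>lborel) =
        indicator (slab a c) x * (\<integral>\<^sup>+t. g (x + t *\<^sub>R v) \<partial>lborel)"
      by (simp add: nn_integral_multc mult.commute)
  qed
  finally show ?thesis .
qed

text \<open>The shift \<open>f\<close> is constant on every line parallel to \<open>k\<close>, so
  the shear translates each of these lines rigidly; Fubini along \<open>k\<close> does the
  rest.\<close>

lemma nn_integral_shear:
  fixes k :: "'a::euclidean_space" and g :: "'a \<Rightarrow> ennreal"
  assumes g[measurable]: "g \<in> borel_measurable borel" and f[measurable]: "f \<in> borel_measurable borel"
    and inv: "\<And>x t. f (x + t *\<^sub>R k) = f x"
  shows "(\<integral>\<^sup>+x. g (x + f x *\<^sub>R k) \<partial>lborel) = (\<integral>\<^sup>+x. g x \<partial>lborel)"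
proof (cases "k = 0")
  case False
  then have k: "k \<bullet> k \<noteq> 0" by simp
  have "(\<integral>\<^sup>+t. g ((x + t *\<^sub>R k) + f (x + t *\<^sub>R k) *\<^sub>R k) \<partial>lborel) = (\<integral>\<^sup>+t. g (x + t *\<^sub>R k) \<partial>lborel)" for x
    by (subst nn_integral_lborel_translate[of "\<lambda>t. g (x + t *\<^sub>R k)" "f x", symmetric])
       (simp_all add: inv algebra_simps)
  then show ?thesis
    by (subst (1 2) nn_integral_slab_fubini[OF k, of _ 0]) simp_all
qed simp

text \<open>A function constant along \<open>v\<close> lives on the set of lines parallel to
  \<open>v\<close>. Any transversal slab may parametrize these lines, and the factor is the
  reciprocal of the length of parameter that a line spends in it.\<close>

lemma nn_integral_slab_change:
  fixes a b v :: "'a::euclidean_space" and g :: "'a \<Rightarrow> ennreal"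
  assumes "a \<bullet> v \<noteq> 0" "b \<bullet> v \<noteq> 0" and [measurable]: "g \<in> borel_measurable borel"
    and inv: "\<And>x t. g (x + t *\<^sub>R v) = g x"
  shows "ennreal \<bar>b \<bullet> v\<bar> * (\<integral>\<^sup>+x. g x * indicator (slab b d) x \<partial>lborel) =
         ennreal \<bar>a \<bullet> v\<bar> * (\<integral>\<^sup>+x. g x * indicator (slab a c) x \<partial>lborel)"
proof -
  have "(\<integral>\<^sup>+x. g x * indicator (slab b d) x \<partial>lborel) = ennreal \<bar>a \<bullet> v\<bar> *
      (\<integral>\<^sup>+x. indicator (slab a c) x * (g x * (\<integral>\<^sup>+t. indicator (slab b d) (x + t *\<^sub>R v) \<partial>lborel)) \<partial>lborel)"
    by (subst nn_integral_slab_fubini[OF assms(1), of _ c]) (simp_all add: inv nn_integral_cmult)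
  then have "ennreal \<bar>b \<bullet> v\<bar> * (\<integral>\<^sup>+x. g x * indicator (slab b d) x \<partial>lborel) = ennreal \<bar>a \<bullet> v\<bar> *
      (\<integral>\<^sup>+x. ennreal \<bar>b \<bullet> v\<bar> * (indicator (slab a c) x * (g x * (\<integral>\<^sup>+t. indicator (slab b d) (x + t *\<^sub>R v) \<partial>lborel))) \<partial>lborel)"
    by (subst nn_integral_cmult) (measurable, simp add: mult.left_commute)
  also have "(\<integral>\<^sup>+x. ennreal \<bar>b \<bullet> v\<bar> * (indicator (slab a c) x * (g x * (\<integral>\<^sup>+t. indicator (slab b d) (x + t *\<^sub>R v) \<partial>lborel))) \<partial>lborel)
     = (\<integral>\<^sup>+x. g x * indicator (slab a c) x \<partial>lborel)"
  proof (rule nn_integral_cong)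
    fix x
    have "ennreal \<bar>b \<bullet> v\<bar> * (indicator (slab a c) x * (g x * (\<integral>\<^sup>+t. indicator (slab b d) (x + t *\<^sub>R v) \<partial>lborel)))
      = g x * indicator (slab a c) x * (ennreal \<bar>b \<bullet> v\<bar> * (\<integral>\<^sup>+t. indicator (slab b d) (x + t *\<^sub>R v) \<partial>lborel))"
      by (simp add: ac_simps)
    then show "ennreal \<bar>b \<bullet> v\<bar> * (indicator (slab a c) x * (g x * (\<integral>\<^sup>+t. indicator (slab b d) (x + t *\<^sub>R v) \<partial>lborel)))
      = g x * indicator (slab a c) x"
      by (simp add: nn_integral_slab_line[OF assms(2)])
  qed
  finally show ?thesis .
qed

text \<open>Projection along \<open>\<omega>\<close> onto the hyperplane
  \<open>n \<bullet> y = c\<close>. For \<open>\<omega>\<close> parallel to the hyperplane the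
  quotient is 0 and the map is the identity; in Green's formula such a face carries the factor
  \<open>sgn 0\<close>.\<close>

definition skew_proj :: "'a::euclidean_space \<Rightarrow> 'a \<Rightarrow> real \<Rightarrow> 'a \<Rightarrow> 'a" where
  "skew_proj \<omega> n c x = x + ((c - n \<bullet> x) / (n \<bullet> \<omega>)) *\<^sub>R \<omega>"

lemma skew_proj_measurable [measurable]: "skew_proj \<omega> n c \<in> borel_measurable borel"
  unfolding skew_proj_def[abs_def] by measurable

text \<open>A measure on the lines parallel to \<open>\<omega>\<close>, each represented by its
  points in the slab rather than by a point of the orthogonal complement. For a unit vector every
  line meets the slab in a segment of length 1.\<close>

definition slab_measure :: "'a::euclidean_space \<Rightarrow> 'a measure" where
  "slab_measure \<omega> = density lborel (indicator (slab \<omega> 0))"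

lemma slab_measure_sets [simp, measurable_cong]: "sets (slab_measure \<omega>) = sets borel"
  and slab_measure_space [simp]: "space (slab_measure \<omega>) = UNIV"
  by (auto simp: slab_measure_def)

lemma hyperplane_measure_sets [simp, measurable_cong]: "sets (hyperplane_measure n c) = sets borel"
  and hyperplane_measure_space [simp]: "space (hyperplane_measure n c) = UNIV"
  by (auto simp: hyperplane_measure_def)

lemma nn_integral_hyperplane_measure:
  fixes n :: "real^'d::finite"
  assumes [measurable]: "f \<in> borel_measurable borel"
  shows "(\<integral>\<^sup>+x. f x \<partial>hyperplane_measure n c) =
    (\<integral>\<^sup>+x. f (x - (n \<bullet> x - c) *\<^sub>R n) * indicator (slab n c) x \<partial>lborel)"
proof -
  have "(\<lambda>y. y - (n \<bullet> y - c) *\<^sub>R n) \<in> restrict_space lborel (slab n c) \<rightarrow>\<^sub>M borel"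
    by (rule measurable_restrict_space1) measurable
  then show ?thesis
    unfolding hyperplane_measure_def
    by (subst nn_integral_distr) (simp_all add: nn_integral_restrict_space)
qed

text \<open>The integrand is constant along \<open>\<omega>\<close>, so the slab across
  \<open>\<omega>\<close> may be exchanged for the one across \<open>n\<close>; this produces the
  cosine \<open>\<bar>n \<bullet> \<omega>\<bar>\<close>. A shear parallel to the hyperplane then
  turns the skew projection into the orthogonal one of \<open>hyperplane_measure\<close>.\<close>

lemma nn_integral_skew_proj:
  fixes n \<omega> :: "real^'d::finite"
  assumes \<omega>: "norm \<omega> = 1" and n: "norm n = 1" and n\<omega>: "n \<bullet> \<omega> \<noteq> 0"
    and f[measurable]: "f \<in> borel_measurable borel"
  shows "(\<integral>\<^sup>+x. f (skew_proj \<omega> n c x) \<partial>slab_measure \<omega>) =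
         ennreal \<bar>n \<bullet> \<omega>\<bar> * (\<integral>\<^sup>+x. f x \<partial>hyperplane_measure n c)"
proof -
  have \<omega>\<omega>: "\<omega> \<bullet> \<omega> = 1" and nn: "n \<bullet> n = 1" using \<omega> n by (simp_all add: norm_eq_1)
  let ?P = "skew_proj \<omega> n c"
  \<comment> \<open>This \<open>k\<close> is tangent to the hyperplane, and \<open>n - k\<close> is
    the multiple of \<open>\<omega>\<close> with unit component along \<open>n\<close>: orthogonal
    projection after the shear along \<open>k\<close> is skew projection.\<close>
  define k where "k = n - (1 / (n \<bullet> \<omega>)) *\<^sub>R \<omega>"
  have kn: "n \<bullet> k = 0" using nn n\<omega> by (simp add: k_def inner_diff_right)
  let ?T = "\<lambda>x. x + (n \<bullet> x - c) *\<^sub>R k"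
  have Pinv: "?P (x + t *\<^sub>R \<omega>) = ?P x" for x t
    using n\<omega> by (simp add: skew_proj_def inner_add_right diff_divide_distrib add_divide_distrib algebra_simps)
  have nT: "n \<bullet> ?T x = n \<bullet> x" for x using kn by (simp add: inner_add_right)
  have PT: "?T x - (n \<bullet> ?T x - c) *\<^sub>R n = ?P x" for x
    unfolding nT using n\<omega> by (simp add: skew_proj_def k_def algebra_simps diff_divide_distrib)
  have "(\<integral>\<^sup>+x. f (?P x) \<partial>slab_measure \<omega>) = (\<integral>\<^sup>+x. f (?P x) * indicator (slab \<omega> 0) x \<partial>lborel)"
    by (simp add: slab_measure_def nn_integral_density mult.commute)
  also have "\<dots> = ennreal \<bar>n \<bullet> \<omega>\<bar> * (\<integral>\<^sup>+x. f (?P x) * indicator (slab n c) x \<partial>lborel)"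
    using nn_integral_slab_change[of n \<omega> \<omega> "\<lambda>x. f (?P x)" 0 c] \<omega>\<omega> n\<omega> by (simp add: Pinv)
  also have "(\<integral>\<^sup>+x. f (?P x) * indicator (slab n c) x \<partial>lborel) =
      (\<integral>\<^sup>+x. f (?T x - (n \<bullet> ?T x - c) *\<^sub>R n) * indicator (slab n c) (?T x) \<partial>lborel)"
    unfolding PT by (simp add: indicator_def nT)
  also have "\<dots> = (\<integral>\<^sup>+x. f (x - (n \<bullet> x - c) *\<^sub>R n) * indicator (slab n c) x \<partial>lborel)"
    by (rule nn_integral_shear) (simp_all add: inner_add_right kn)
  finally show ?thesis by (simp add: nn_integral_hyperplane_measure)
qed

text \<open>Stated as an equality of measures, the change of variables passes from nonnegative to
  signed integrands.\<close>

lemma distr_skew_proj: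
  fixes n \<omega> :: "real^'d::finite"
  assumes "norm \<omega> = 1" "norm n = 1" "n \<bullet> \<omega> \<noteq> 0"
  shows "distr (slab_measure \<omega>) borel (skew_proj \<omega> n c) =
         density (hyperplane_measure n c) (\<lambda>_. ennreal \<bar>n \<bullet> \<omega>\<bar>)"
proof (rule measure_eqI)
  fix A assume "A \<in> sets (distr (slab_measure \<omega>) borel (skew_proj \<omega> n c))"
  then have A[measurable]: "A \<in> sets borel" by simp
  have "emeasure (distr (slab_measure \<omega>) borel (skew_proj \<omega> n c)) A =
      (\<integral>\<^sup>+x. indicator A x \<partial>distr (slab_measure \<omega>) borel (skew_proj \<omega> n c))" by simp
  also have "\<dots> = (\<integral>\<^sup>+x. indicator A (skew_proj \<omega> n c x) \<partial>slab_measure \<omega>)"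
    by (subst nn_integral_distr) simp_all
  also have "\<dots> = emeasure (density (hyperplane_measure n c) (\<lambda>_. ennreal \<bar>n \<bullet> \<omega>\<bar>)) A"
    by (subst nn_integral_skew_proj[OF assms]) (simp_all add: emeasure_density nn_integral_cmult)
  finally show "emeasure (distr (slab_measure \<omega>) borel (skew_proj \<omega> n c)) A =
      emeasure (density (hyperplane_measure n c) (\<lambda>_. ennreal \<bar>n \<bullet> \<omega>\<bar>)) A" .
qed simp

lemma integral_skew_proj:
  fixes n \<omega> :: "real^'d::finite" and f :: "real^'d \<Rightarrow> real"
  assumes "norm \<omega> = 1" "norm n = 1" "n \<bullet> \<omega> \<noteq> 0" and f: "integrable (hyperplane_measure n c) f"
  shows "integrable (slab_measure \<omega>) (\<lambda>x. f (skew_proj \<omega> n c x))"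
    and "(\<integral>x. f (skew_proj \<omega> n c x) \<partial>slab_measure \<omega>) = \<bar>n \<bullet> \<omega>\<bar> * (\<integral>x. f x \<partial>hyperplane_measure n c)"
proof -
  have [measurable]: "f \<in> borel_measurable borel" using f by (auto dest: borel_measurable_integrable)
  have "integrable (density (hyperplane_measure n c) (\<lambda>_. ennreal \<bar>n \<bullet> \<omega>\<bar>)) f"
    using f by (subst integrable_density) auto
  then have "integrable (distr (slab_measure \<omega>) borel (skew_proj \<omega> n c)) f"
    by (simp only: distr_skew_proj[OF assms(1-3)])
  then show "integrable (slab_measure \<omega>) (\<lambda>x. f (skew_proj \<omega> n c x))"
    by (subst (asm) integrable_distr_eq) simp_all
  have "(\<integral>x. f (skew_proj \<omega> n c x) \<partial>slab_measure \<omega>) =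
      (\<integral>x. f x \<partial>distr (slab_measure \<omega>) borel (skew_proj \<omega> n c))"
    by (subst integral_distr) simp_all
  also have "\<dots> = (\<integral>x. \<bar>n \<bullet> \<omega>\<bar> * f x \<partial>hyperplane_measure n c)"
    unfolding distr_skew_proj[OF assms(1-3)] by (subst integral_density) auto
  finally show "(\<integral>x. f (skew_proj \<omega> n c x) \<partial>slab_measure \<omega>) =
      \<bar>n \<bullet> \<omega>\<bar> * (\<integral>x. f x \<partial>hyperplane_measure n c)" by simp
qed

lemma sigma_finite_slab_measure: "sigma_finite_measure (slab_measure \<omega>)"
  unfolding slab_measure_def
  by (subst sigma_finite_measure.sigma_finite_iff_density_finite[OF sigma_finite_lborel]) (auto simp: indicator_def)

lemma integral_slab_fubini:
  fixes \<omega> :: "'a::euclidean_space" and f :: "'a \<Rightarrow> real"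
  assumes \<omega>: "norm \<omega> = 1" and f: "integrable lborel f"
  shows "(\<integral>x. f x \<partial>lborel) = (\<integral>x. (\<integral>t. f (x + t *\<^sub>R \<omega>) \<partial>lborel) \<partial>slab_measure \<omega>)"
proof -
  interpret sigma_finite_measure "slab_measure \<omega>" by (rule sigma_finite_slab_measure)
  interpret P: pair_sigma_finite "slab_measure \<omega>" "lborel :: real measure" ..
  have \<omega>\<omega>: "\<omega> \<bullet> \<omega> = 1" using \<omega> by (simp add: norm_eq_1)
  have [measurable]: "f \<in> borel_measurable borel" using f by (auto dest: borel_measurable_integrable)
  let ?s = "\<lambda>(x, t). x + t *\<^sub>R \<omega>"
  have [measurable]: "?s \<in> slab_measure \<omega> \<Otimes>\<^sub>M lborel \<rightarrow>\<^sub>M borel" by measurable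
  \<comment> \<open>Lebesgue measure is the image of lines times parameter; the density
    \<open>\<omega> \<bullet> \<omega>\<close> is 1.\<close>
  have eq: "distr (slab_measure \<omega> \<Otimes>\<^sub>M lborel) borel ?s = lborel"
  proof (rule measure_eqI)
    fix A assume "A \<in> sets (distr (slab_measure \<omega> \<Otimes>\<^sub>M lborel) borel ?s)"
    then have A[measurable]: "A \<in> sets borel" by simp
    have "emeasure (distr (slab_measure \<omega> \<Otimes>\<^sub>M lborel) borel ?s) A =
        (\<integral>\<^sup>+z. indicator A z \<partial>distr (slab_measure \<omega> \<Otimes>\<^sub>M lborel) borel ?s)" by simp
    also have "\<dots> = (\<integral>\<^sup>+z. indicator A (?s z) \<partial>(slab_measure \<omega> \<Otimes>\<^sub>M lborel))"
      by (subst nn_integral_distr) simp_all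
    also have "\<dots> = (\<integral>\<^sup>+x. \<integral>\<^sup>+t. indicator A (x + t *\<^sub>R \<omega>) \<partial>lborel \<partial>slab_measure \<omega>)"
      by (subst lborel.nn_integral_fst[symmetric]) (simp_all add: case_prod_beta)
    also have "\<dots> = (\<integral>\<^sup>+x. indicator (slab \<omega> 0) x * (\<integral>\<^sup>+t. indicator A (x + t *\<^sub>R \<omega>) \<partial>lborel) \<partial>lborel)"
      unfolding slab_measure_def by (subst nn_integral_density) simp_all
    also have "\<dots> = (\<integral>\<^sup>+x. indicator A x \<partial>lborel)"
      by (subst nn_integral_slab_fubini[of \<omega> \<omega> _ 0]) (simp_all add: \<omega>\<omega>)
    finally show "emeasure (distr (slab_measure \<omega> \<Otimes>\<^sub>M lborel) borel ?s) A = emeasure lborel A"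
      by simp
  qed simp
  have int: "integrable (slab_measure \<omega> \<Otimes>\<^sub>M lborel) (\<lambda>z. f (?s z))"
    using f by (subst integrable_distr_eq[of _ _ borel, symmetric]) (simp_all add: eq)
  have "(\<integral>x. f x \<partial>lborel) = (\<integral>z. f (?s z) \<partial>(slab_measure \<omega> \<Otimes>\<^sub>M lborel))"
    by (subst integral_distr[of _ _ borel, symmetric]) (simp_all add: eq)
  also have "\<dots> = (\<integral>x. (\<integral>t. f (x + t *\<^sub>R \<omega>) \<partial>lborel) \<partial>slab_measure \<omega>)"
    using P.integral_fst'[OF int] by simp
  finally show ?thesis .
qed

lemma emeasure_hyperplane_measure:
  fixes n :: "real^'d::finite"
  assumes [measurable]: "A \<in> sets borel"
  shows "emeasure (hyperplane_measure n c) A =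
    emeasure lborel {x \<in> slab n c. x - (n \<bullet> x - c) *\<^sub>R n \<in> A}"
proof -
  have "emeasure (hyperplane_measure n c) A = (\<integral>\<^sup>+x. indicator A x \<partial>hyperplane_measure n c)" by simp
  also have "\<dots> = (\<integral>\<^sup>+x. indicator A (x - (n \<bullet> x - c) *\<^sub>R n) * indicator (slab n c) x \<partial>lborel)"
    by (subst nn_integral_hyperplane_measure) simp_all
  also have "\<dots> = (\<integral>\<^sup>+x. indicator {x \<in> slab n c. x - (n \<bullet> x - c) *\<^sub>R n \<in> A} x \<partial>lborel)"
    by (intro nn_integral_cong) (auto simp: indicator_def)
  also have "\<dots> = emeasure lborel {x \<in> slab n c. x - (n \<bullet> x - c) *\<^sub>R n \<in> A}"
    by (rule nn_integral_indicator) measurable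
  finally show ?thesis .
qed

lemma integrable_hyperplane_measure_compact:
  fixes n :: "real^'d::finite" and f :: "real^'d \<Rightarrow> real"
  assumes e: "compact e" and f: "continuous_on UNIV f" and n: "norm n = 1"
  shows "integrable (hyperplane_measure n c) (\<lambda>x. indicator e x * f x)"
proof -
  have [measurable]: "e \<in> sets borel" "f \<in> borel_measurable borel"
    using e f by (auto simp: borel_compact intro: borel_measurable_continuous_onI)
  obtain R where R: "\<And>x. x \<in> e \<Longrightarrow> norm x \<le> R"
    using compact_imp_bounded[OF e] by (auto simp: bounded_iff)
  \<comment> \<open>The radius grows by 1, the thickness of the slab and thus the largest distance
    between a point and its projection.\<close>
  have "{x \<in> slab n c. x - (n \<bullet> x - c) *\<^sub>R n \<in> e} \<subseteq> cball 0 (R + 1)"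
  proof clarify
    fix x assume x: "c \<le> n \<bullet> x" "n \<bullet> x \<le> c + 1" "x - (n \<bullet> x - c) *\<^sub>R n \<in> e"
    have "norm x \<le> norm (x - (n \<bullet> x - c) *\<^sub>R n) + norm ((n \<bullet> x - c) *\<^sub>R n)"
      using norm_triangle_ineq[of "x - (n \<bullet> x - c) *\<^sub>R n" "(n \<bullet> x - c) *\<^sub>R n"] by simp
    also have "\<dots> \<le> R + 1" using R[OF x(3)] x n by simp
    finally show "x \<in> cball 0 (R + 1)" by simp
  qed
  then have "emeasure lborel {x \<in> slab n c. x - (n \<bullet> x - c) *\<^sub>R n \<in> e} \<le> emeasure lborel (cball 0 (R + 1) :: (real^'d) set)"
    by (rule emeasure_mono) simp
  also have "\<dots> < \<infinity>" by (rule emeasure_lborel_cball_finite)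
  finally have fin: "emeasure (hyperplane_measure n c) e < \<infinity>"
    by (simp add: emeasure_hyperplane_measure)
  obtain C where C: "\<And>x. x \<in> e \<Longrightarrow> \<bar>f x\<bar> \<le> C"
    using compact_imp_bounded[OF compact_continuous_image[OF continuous_on_subset[OF f subset_UNIV] e]]
    by (auto simp: bounded_iff)
  show ?thesis
  proof (rule Bochner_Integration.integrable_bound)
    show "integrable (hyperplane_measure n c) (\<lambda>x. C * indicator e x)"
      using fin by (intro integrable_mult_right) (simp add: integrable_indicator_iff)
    show "AE x in hyperplane_measure n c. norm (indicator e x * f x) \<le> norm (C * indicator e x)"
    proof (rule AE_I2)
      fix x show "norm (indicator e x * f x) \<le> norm (C * indicator e x)"
        using C[of x] by (cases "x \<in> e") auto
    qed
  qed simp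
qed

section \<open>Green's formula for domains with flat faces\<close>

lemma AE_notin_hyperplane:
  fixes a :: "'a::euclidean_space"
  assumes "a \<noteq> 0"
  shows "AE x in lborel. a \<bullet> x \<noteq> b"
proof -
  have "negligible {x. a \<bullet> x = b}" using assms by (intro negligible_hyperplane) auto
  then have "AE x in lebesgue. x \<notin> {x. a \<bullet> x = b}"
    by (intro AE_not_in) (simp add: negligible_iff_null_sets)
  then show ?thesis by (simp add: AE_completion_iff)
qed

text \<open>A line parallel to the hyperplane that meets it lies in it, so the bad starting points
  form a null set, the hyperplane itself.\<close>

lemma AE_line_avoids_parallel:
  fixes n \<omega> :: "'a::euclidean_space"
  assumes "n \<noteq> 0" "n \<bullet> \<omega> = 0" "A \<subseteq> {x. n \<bullet> x = c}"
  shows "AE x in lborel. \<forall>t. x + t *\<^sub>R \<omega> \<notin> A"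
  using AE_notin_hyperplane[OF assms(1), of c]
  by eventually_elim (use assms(2,3) in \<open>auto simp: inner_add_right\<close>)

text \<open>The lines through a set of codimension 2 sweep out at most one more dimension, hence
  stay within a hyperplane.\<close>

lemma AE_line_avoids_lowdim:
  fixes \<omega> :: "'a::euclidean_space"
  assumes "aff_dim A \<le> int DIM('a) - 2"
  shows "AE x in lborel. \<forall>t. x + t *\<^sub>R \<omega> \<notin> A"
proof (cases "A = {}")
  case False
  then obtain x0 where x0: "x0 \<in> A" by blast
  \<comment> \<open>Adjoining \<open>x0 + \<omega>\<close> raises the dimension by at most 1 and
    forces the resulting hyperplane to be parallel to \<open>\<omega>\<close>.\<close>
  have "aff_dim (insert (x0 + \<omega>) A) < int DIM('a)"
    using assms by (simp add: aff_dim_insert)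
  then obtain a b where ab: "a \<noteq> 0" "insert (x0 + \<omega>) A \<subseteq> {x. a \<bullet> x = b}"
    by (rule aff_lowdim_subset_hyperplane)
  then have "a \<bullet> \<omega> = 0" using x0 by (auto simp: inner_add_right)
  with ab show ?thesis by (intro AE_line_avoids_parallel[of a _ _ b]) auto
qed simp

lemma polytopal_set_compact: "polytopal_set k S \<Longrightarrow> compact S"
  unfolding polytopal_set_def by (auto intro: compact_Union polytope_imp_compact)

lemma polytopal_set_nonempty: "polytopal_set k S \<Longrightarrow> 0 \<le> k \<Longrightarrow> S \<noteq> {}"
  unfolding polytopal_set_def by force

lemma flat_polytope_affine_hull:
  fixes n :: "'a::euclidean_space"
  assumes "n \<noteq> 0" "C \<subseteq> {x. n \<bullet> x = c}" "aff_dim C = int DIM('a) - 1"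
  shows "affine hull C = {x. n \<bullet> x = c}"
proof (rule affine_dim_equal)
  show "affine hull C \<subseteq> {x. n \<bullet> x = c}"
    using assms(2) by (rule hull_minimal) (rule affine_hyperplane)
  show "affine hull C \<noteq> {}"
    using assms(3) by (auto simp: aff_dim_empty_eq)
  show "aff_dim (affine hull C) = aff_dim {x. n \<bullet> x = c}"
    using assms by simp
qed (simp_all add: affine_hyperplane)

text \<open>Each convex piece spans the whole hyperplane, so its relative interior lies in that of
  \<open>S\<close>. A point of \<open>S\<close> outside \<open>rel_interior S\<close> is therefore
  on a facet of its piece, and the finitely many facets have codimension 2 in space.\<close>

lemma AE_line_avoids_rel_boundary:
  fixes n \<omega> :: "'a::euclidean_space"
  assumes n: "n \<noteq> 0" and S: "S \<subseteq> {x. n \<bullet> x = c}" "polytopal_set (int DIM('a) - 1) S"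
  shows "AE x in lborel. \<forall>t. x + t *\<^sub>R \<omega> \<notin> S - rel_interior S"
proof -
  obtain P where P: "finite P" "P \<noteq> {}" "S = \<Union>P"
    "\<And>C. C \<in> P \<Longrightarrow> polytope C" "\<And>C. C \<in> P \<Longrightarrow> aff_dim C = int DIM('a) - 1"
    using S(2) unfolding polytopal_set_def by blast
  define \<F> where "\<F> = (\<Union>C\<in>P. {F. F facet_of C})"
  have fin: "finite \<F>"
    unfolding \<F>_def using P finite_polytope_facets by blast
  have hullC: "affine hull C = {x. n \<bullet> x = c}" if "C \<in> P" for C
    using n S(1) P(3,5) that by (intro flat_polytope_affine_hull) auto
  have hullS: "affine hull S = {x. n \<bullet> x = c}"
  proof
    show "affine hull S \<subseteq> {x. n \<bullet> x = c}"
      using S(1) by (rule hull_minimal) (rule affine_hyperplane)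
    obtain C where "C \<in> P" using P(2) by blast
    then show "{x. n \<bullet> x = c} \<subseteq> affine hull S"
      using hullC[of C] hull_mono[of C S affine] P(3) by blast
  qed
  have sub: "S - rel_interior S \<subseteq> \<Union>\<F>"
  proof
    fix x assume x: "x \<in> S - rel_interior S"
    then obtain C where C: "C \<in> P" "x \<in> C" using P(3) by blast
    have "rel_interior C \<subseteq> rel_interior S"
      using C P(3) hullC hullS by (intro subset_rel_interior) auto
    then have "x \<in> C - rel_interior C" using x C by blast
    then show "x \<in> \<Union>\<F>"
      using rel_boundary_of_polyhedron[OF polytope_imp_polyhedron[OF P(4)[OF C(1)]]] C(1)
      by (auto simp: \<F>_def)
  qed
  have "AE x in lborel. \<forall>F\<in>\<F>. \<forall>t. x + t *\<^sub>R \<omega> \<notin> F"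
  proof (rule AE_finite_allI[OF fin])
    fix F assume "F \<in> \<F>"
    then have "aff_dim F \<le> int DIM('a) - 2"
      using P(5) by (auto simp: \<F>_def facet_of_def)
    then show "AE x in lborel. \<forall>t. x + t *\<^sub>R \<omega> \<notin> F" by (rule AE_line_avoids_lowdim)
  qed
  then show ?thesis by eventually_elim (use sub in blast)
qed

text \<open>A face has one normal \<open>\<nu> e\<close> shared by its neighbours. The sign
  \<open>s e\<close> turns it into the outward normal of \<open>K\<close>, so that the formulas for
  two adjacent elements refer to the same hyperplane measure.\<close>

locale flat_faced_domain =
  fixes K :: "(real^'d::finite) set" and E :: "(real^'d) set set"
    and \<nu> :: "(real^'d) set \<Rightarrow> real^'d" and s :: "(real^'d) set \<Rightarrow> real"
  assumes open_K: "open K" and bounded_K: "bounded K" and finite_E: "finite E"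
    and frontier_K: "frontier K = \<Union>E"
    and polytopal_face: "\<And>e. e \<in> E \<Longrightarrow> polytopal_set (int CARD('d) - 1) e"
    and normal: "\<And>e. e \<in> E \<Longrightarrow> outward_unit_normal K e (s e *\<^sub>R \<nu> e)"
    and sign: "\<And>e. e \<in> E \<Longrightarrow> s e = 1 \<or> s e = - 1"
    and disjoint_E: "pairwise (\<lambda>e e'. rel_interior e \<inter> rel_interior e' = {}) E"
begin

text \<open>The same choice of a point as in \<open>face_measure\<close>, so that both denote one
  measure by unfolding.\<close>

definition offset :: "(real^'d) set \<Rightarrow> real" where
  "offset e = \<nu> e \<bullet> (SOME x. x \<in> e)"

lemma norm_nu: "e \<in> E \<Longrightarrow> norm (\<nu> e) = 1"
  using normal[of e] sign[of e] by (auto simp: outward_unit_normal_def)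

lemma compact_face: "e \<in> E \<Longrightarrow> compact e"
  using polytopal_face polytopal_set_compact by blast

lemma face_plane: "e \<in> E \<Longrightarrow> x \<in> e \<Longrightarrow> \<nu> e \<bullet> x = offset e"
proof -
  assume e: "e \<in> E" "x \<in> e"
  then have "(SOME x. x \<in> e) \<in> e" by (metis someI_ex)
  then have "(s e *\<^sub>R \<nu> e) \<bullet> (x - (SOME x. x \<in> e)) = 0"
    using normal[OF e(1)] e(2) unfolding outward_unit_normal_def by blast
  then show ?thesis using sign[OF e(1)] by (auto simp: offset_def inner_diff_right)
qed

text \<open>The normal condition speaks only of the normal line through \<open>y\<close>. Close to
  \<open>y\<close> the frontier lies in the plane of \<open>e\<close>, so each open half ball is
  connected and misses the frontier; hence it lies entirely inside or entirely outside
  \<open>K\<close>, and a point of the normal line decides which.\<close>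

lemma half_ball:
  assumes e: "e \<in> E" and y: "y \<in> rel_interior e" and other: "\<And>e'. e' \<in> E \<Longrightarrow> e' \<noteq> e \<Longrightarrow> y \<notin> e'"
  shows "\<exists>r>0. \<forall>z\<in>ball y r. (s e * (\<nu> e \<bullet> (z - y)) < 0 \<longrightarrow> z \<in> K) \<and>
                           (0 < s e * (\<nu> e \<bullet> (z - y)) \<longrightarrow> z \<notin> K)"
proof -
  define n where "n = s e *\<^sub>R \<nu> e"
  note normal_n = normal[OF e, folded n_def]
  have ye: "y \<in> e" using y rel_interior_subset by blast
  have "closed (\<Union>(E - {e}))"
    using finite_E compact_face by (intro closed_Union) (auto intro: compact_imp_closed)
  then have "open (- \<Union>(E - {e}))" by (rule open_Compl)
  moreover have "y \<in> - \<Union>(E - {e})" using other by auto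
  ultimately obtain r where r: "r > 0" "ball y r \<subseteq> - \<Union>(E - {e})"
    by (meson open_contains_ball)
  have fr: "z \<in> e" if "z \<in> frontier K" "z \<in> ball y r" for z
    using that r(2) frontier_K by blast
  have flat: "n \<bullet> (z - y) = 0" if "z \<in> e" for z
    using face_plane[OF e that] face_plane[OF e ye] by (simp add: n_def inner_diff_right)
  obtain d where d: "d > 0" "\<And>t. 0 < t \<Longrightarrow> t < d \<Longrightarrow> y - t *\<^sub>R n \<in> K \<and> y + t *\<^sub>R n \<notin> closure K"
    using normal_n y unfolding outward_unit_normal_def by blast
  have norm_n: "norm n = 1" using normal_n unfolding outward_unit_normal_def by blast
  then have nn: "n \<bullet> n = 1" by (simp only: norm_eq_1)
  define t where "t = min d r / 2"
  have t: "0 < t" "t < d" "t < r" using d r by (auto simp: t_def)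
  define Hm where "Hm = ball y r \<inter> {z. n \<bullet> z < n \<bullet> y}"
  define Hp where "Hp = ball y r \<inter> {z. n \<bullet> z > n \<bullet> y}"
  have conn: "connected Hm" "connected Hp"
    unfolding Hm_def Hp_def
    by (intro convex_connected convex_Int convex_ball convex_halfspace_lt convex_halfspace_gt)+
  have flat': "n \<bullet> z = n \<bullet> y" if "z \<in> e" for z
    using flat[OF that] unfolding inner_diff_right by linarith
  have "z \<notin> Hm \<and> z \<notin> Hp" if "z \<in> frontier K" for z
    using fr[OF that] flat'[of z] unfolding Hm_def Hp_def
    by (metis (no_types, lifting) IntE mem_Collect_eq less_irrefl)
  then have disj: "Hm \<inter> frontier K = {}" "Hp \<inter> frontier K = {}" by blast+
  have dist: "dist y (y - t *\<^sub>R n) < r" "dist y (y + t *\<^sub>R n) < r"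
    using t norm_n by (simp_all add: dist_norm)
  have "y - t *\<^sub>R n \<in> Hm \<inter> K"
    using d(2)[OF t(1,2)] dist t nn unfolding Hm_def by (simp add: inner_diff_right)
  then have Hm: "Hm \<subseteq> K" using connected_Int_frontier[OF conn(1), of K] disj(1) by blast
  have "y + t *\<^sub>R n \<in> Hp - K"
    using d(2)[OF t(1,2)] dist t nn closure_subset[of K] unfolding Hp_def
    by (auto simp: inner_add_right)
  then have Hp: "Hp \<inter> K = {}" using connected_Int_frontier[OF conn(2), of K] disj(2) by blast
  show ?thesis
    using r(1) Hm Hp
    by (intro exI[of _ r]) (auto simp: Hm_def Hp_def n_def inner_diff_right right_diff_distrib)
qed

definition hit :: "real^'d \<Rightarrow> real^'d \<Rightarrow> (real^'d) set \<Rightarrow> real" where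
  "hit \<omega> x e = (offset e - \<nu> e \<bullet> x) / (\<nu> e \<bullet> \<omega>)"

definition good_line :: "real^'d \<Rightarrow> real^'d \<Rightarrow> bool" where
  "good_line \<omega> x \<longleftrightarrow> (\<forall>e\<in>E. (\<nu> e \<bullet> \<omega> = 0 \<longrightarrow> (\<forall>t. x + t *\<^sub>R \<omega> \<notin> e)) \<and>
     (\<forall>t. x + t *\<^sub>R \<omega> \<notin> e - rel_interior e))"

lemma AE_good_line: "AE x in lborel. good_line \<omega> x"
  unfolding good_line_def
proof (rule AE_finite_allI[OF finite_E])
  fix e assume e: "e \<in> E"
  have sub: "e \<subseteq> {x. \<nu> e \<bullet> x = offset e}" using face_plane[OF e] by blast
  have nz: "\<nu> e \<noteq> 0" using norm_nu[OF e] by auto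
  have "AE x in lborel. \<nu> e \<bullet> \<omega> = 0 \<longrightarrow> (\<forall>t. x + t *\<^sub>R \<omega> \<notin> e)"
    using AE_line_avoids_parallel[OF nz _ sub, of \<omega>] by (cases "\<nu> e \<bullet> \<omega> = 0") auto
  moreover have "AE x in lborel. \<forall>t. x + t *\<^sub>R \<omega> \<notin> e - rel_interior e"
    using AE_line_avoids_rel_boundary[OF nz sub] polytopal_face[OF e] by simp
  ultimately show "AE x in lborel. (\<nu> e \<bullet> \<omega> = 0 \<longrightarrow> (\<forall>t. x + t *\<^sub>R \<omega> \<notin> e)) \<and>
     (\<forall>t. x + t *\<^sub>R \<omega> \<notin> e - rel_interior e)" by eventually_elim blast
qed

lemma hit_unique:
  assumes "e \<in> E" "\<nu> e \<bullet> \<omega> \<noteq> 0" "x + t *\<^sub>R \<omega> \<in> e"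
  shows "t = hit \<omega> x e"
  using face_plane[OF assms(1,3)] assms(2) by (simp add: hit_def inner_add_right field_simps)

text \<open>Entering and leaving faces use different conventions at the crossing point itself, where
  the line is not in the open set K; so the next identity holds at every parameter.\<close>

definition crossing :: "real^'d \<Rightarrow> real^'d \<Rightarrow> (real^'d) set \<Rightarrow> real \<Rightarrow> real" where
  "crossing \<omega> x e t =
     (if \<nu> e \<bullet> \<omega> \<noteq> 0 \<and> x + hit \<omega> x e *\<^sub>R \<omega> \<in> e
      then (if 0 < s e * (\<nu> e \<bullet> \<omega>) then indicator {..<hit \<omega> x e} t else - indicator {..hit \<omega> x e} t)
      else 0)"

lemma crossing_locally_const:
  assumes "\<nu> e \<bullet> \<omega> \<noteq> 0 \<Longrightarrow> x + hit \<omega> x e *\<^sub>R \<omega> \<in> e \<Longrightarrow> t0 \<noteq> hit \<omega> x e"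
  shows "eventually (\<lambda>t. crossing \<omega> x e t = crossing \<omega> x e t0) (at t0)"
proof (cases "\<nu> e \<bullet> \<omega> \<noteq> 0 \<and> x + hit \<omega> x e *\<^sub>R \<omega> \<in> e")
  case True
  then have ne: "t0 \<noteq> hit \<omega> x e" using assms by blast
  have "eventually (\<lambda>t. (t < hit \<omega> x e) = (t0 < hit \<omega> x e) \<and> (t \<le> hit \<omega> x e) = (t0 \<le> hit \<omega> x e)) (at t0)"
  proof (cases "t0 < hit \<omega> x e")
    case True
    then have "eventually (\<lambda>t. t < hit \<omega> x e) (at t0)"
      by (rule order_tendstoD(2)[OF tendsto_ident_at])
    then show ?thesis by eventually_elim (use True in auto)
  next
    case False
    then have "hit \<omega> x e < t0" using ne by simp
    then have "eventually (\<lambda>t. hit \<omega> x e < t) (at t0)"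
      by (rule order_tendstoD(1)[OF tendsto_ident_at])
    then show ?thesis by eventually_elim (use False ne in auto)
  qed
  then show ?thesis by eventually_elim (auto simp: crossing_def indicator_def)
qed (auto simp: crossing_def)

text \<open>The difference \<open>D\<close> of the two sides is locally constant in the parameter:
  away from the frontier both sides are, and at a crossing their jumps cancel. So \<open>D\<close>
  is constant on the whole line, and far out it is zero.\<close>

lemma indicator_line_eq_crossings:
  assumes good: "good_line \<omega> x" and \<omega>: "norm \<omega> = 1"
  shows "indicator K (x + t *\<^sub>R \<omega>) = (\<Sum>e\<in>E. crossing \<omega> x e t)"
proof -
  let ?i = "\<lambda>t. indicator K (x + t *\<^sub>R \<omega>) :: real"
  define D where "D = (\<lambda>t. ?i t - (\<Sum>e\<in>E. crossing \<omega> x e t))"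
  have cont: "((\<lambda>t. x + t *\<^sub>R \<omega>) \<longlongrightarrow> x + t0 *\<^sub>R \<omega>) (at t0)" for t0
    by (intro tendsto_intros)
  have line: "eventually (\<lambda>t. x + t *\<^sub>R \<omega> \<in> S) (at t0)" if "open S" "x + t0 *\<^sub>R \<omega> \<in> S" for S t0
    using topological_tendstoD[OF cont that] .
  have loc: "eventually (\<lambda>t. D t0 = D t) (at t0)" for t0
  proof (cases "x + t0 *\<^sub>R \<omega> \<in> frontier K")
    case False
    then have nf: "x + t0 *\<^sub>R \<omega> \<notin> e" if "e \<in> E" for e using frontier_K that by blast
    have "eventually (\<lambda>t. \<forall>e\<in>E. crossing \<omega> x e t = crossing \<omega> x e t0) (at t0)"
      using nf by (intro eventually_ball_finite[OF finite_E] ballI crossing_locally_const) metis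
    moreover have "eventually (\<lambda>t. ?i t = ?i t0) (at t0)"
    proof (cases "x + t0 *\<^sub>R \<omega> \<in> K")
      case True
      then have "eventually (\<lambda>t. x + t *\<^sub>R \<omega> \<in> K) (at t0)" by (rule line[OF open_K])
      then show ?thesis by eventually_elim (use True in auto)
    next
      case nK: False
      then have "x + t0 *\<^sub>R \<omega> \<in> - closure K"
        using False open_K by (auto simp: frontier_def interior_open)
      then have "eventually (\<lambda>t. x + t *\<^sub>R \<omega> \<in> - closure K) (at t0)" by (intro line) auto
      then show ?thesis
        by eventually_elim (use nK closure_subset[of K] in \<open>auto simp: indicator_def\<close>)
    qed
    ultimately show ?thesis by eventually_elim (simp add: D_def)
  next
    case True
    define y where "y = x + t0 *\<^sub>R \<omega>"
    obtain e where e: "e \<in> E" "y \<in> e" using True frontier_K y_def by blast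
    have nz: "\<nu> e \<bullet> \<omega> \<noteq> 0" using good e unfolding good_line_def y_def by blast
    have ri: "y \<in> rel_interior e'" if "e' \<in> E" "y \<in> e'" for e'
      using good that unfolding good_line_def y_def by blast
    \<comment> \<open>On a good line a frontier point is in the relative interior of every face
      containing it; as these interiors are disjoint, exactly one face is crossed.\<close>
    have other: "y \<notin> e'" if "e' \<in> E" "e' \<noteq> e" for e'
      using ri[OF e] ri[OF that(1)] disjoint_E that e(1) unfolding pairwise_def by blast
    have hit: "t0 = hit \<omega> x e" using hit_unique[OF e(1) nz] e(2) by (simp add: y_def)
    have "eventually (\<lambda>t. \<forall>e'\<in>E - {e}. crossing \<omega> x e' t = crossing \<omega> x e' t0) (at t0)"
    proof (rule eventually_ball_finite)
      show "finite (E - {e})" using finite_E by simp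
      show "\<forall>e'\<in>E - {e}. eventually (\<lambda>t. crossing \<omega> x e' t = crossing \<omega> x e' t0) (at t0)"
        using other unfolding y_def by (intro ballI crossing_locally_const) auto
    qed
    moreover have "eventually (\<lambda>t. ?i t - crossing \<omega> x e t = ?i t0 - crossing \<omega> x e t0) (at t0)"
    proof -
      obtain r where r: "r > 0" "\<And>z. z \<in> ball y r \<Longrightarrow> s e * (\<nu> e \<bullet> (z - y)) < 0 \<Longrightarrow> z \<in> K"
        "\<And>z. z \<in> ball y r \<Longrightarrow> 0 < s e * (\<nu> e \<bullet> (z - y)) \<Longrightarrow> z \<notin> K"
        using half_ball[OF e(1) ri[OF e] other] by metis
      have "eventually (\<lambda>t. x + t *\<^sub>R \<omega> \<in> ball y r) (at t0)"
        by (rule line) (use r in \<open>auto simp: y_def\<close>)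
      moreover have "eventually (\<lambda>t. t \<noteq> t0) (at t0)" by (simp add: eventually_neq_at_within)
      ultimately show ?thesis
      proof eventually_elim
        case (elim t)
        have inn: "s e * (\<nu> e \<bullet> (x + t *\<^sub>R \<omega> - y)) = (t - t0) * (s e * (\<nu> e \<bullet> \<omega>))"
          by (simp add: y_def inner_diff_right inner_add_right algebra_simps)
        note in_K = r(2)[OF elim(1), unfolded inn] and out_K = r(3)[OF elim(1), unfolded inn]
        have yK: "x + t0 *\<^sub>R \<omega> \<notin> K" using True open_K by (auto simp: frontier_def interior_open)
        have snz: "s e * (\<nu> e \<bullet> \<omega>) \<noteq> 0" using nz sign[OF e(1)] by auto
        have cr: "crossing \<omega> x e t' = (if 0 < s e * (\<nu> e \<bullet> \<omega>) then indicator {..<t0} t' else - indicator {..t0} t')" for t'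
          using e(2) nz by (simp add: crossing_def y_def flip: hit)
        consider "t < t0" | "t > t0" using elim(2) by linarith
        then show ?case
        proof cases
          case 1
          then show ?thesis
            using in_K out_K yK snz
            by (cases "0 < s e * (\<nu> e \<bullet> \<omega>)")
               (auto simp: cr indicator_def mult_less_0_iff zero_less_mult_iff not_less)
        next
          case 2
          then show ?thesis
            using in_K out_K yK snz
            by (cases "0 < s e * (\<nu> e \<bullet> \<omega>)")
               (auto simp: cr indicator_def mult_less_0_iff zero_less_mult_iff not_less)
        qed
      qed
    qed
    ultimately show ?thesis
    proof eventually_elim
      case (elim t)
      have "D t = (?i t - crossing \<omega> x e t) - (\<Sum>e'\<in>E - {e}. crossing \<omega> x e' t)" for t
        using sum.remove[OF finite_E e(1), of "\<lambda>e. crossing \<omega> x e t"] by (simp add: D_def)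
      then show ?case using elim by simp
    qed
  qed
  have const: "D t = D t'" for t t'
    by (rule connected_local_const[of UNIV]) (use loc in auto)
  obtain R where R: "\<And>z. z \<in> K \<Longrightarrow> norm z \<le> R" using bounded_K by (auto simp: bounded_iff)
  \<comment> \<open>A parameter beyond \<open>K\<close> and beyond every crossing. All rays in
    \<open>crossing\<close> extend towards minus infinity, so each of them vanishes at
    \<open>T\<close>.\<close>
  define T where "T = Max (insert (R + norm x + 1) ((\<lambda>e. hit \<omega> x e + 1) ` E))"
  have T1: "R + norm x + 1 \<le> T" and T2: "hit \<omega> x e + 1 \<le> T" if "e \<in> E" for e
    using finite_E that by (auto simp: T_def)
  have T1: "R + norm x + 1 \<le> T" using finite_E by (auto simp: T_def)
  have "norm (T *\<^sub>R \<omega>) \<le> norm (x + T *\<^sub>R \<omega>) + norm x"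
    using norm_triangle_ineq4[of "x + T *\<^sub>R \<omega>" x] by simp
  then have "x + T *\<^sub>R \<omega> \<notin> K" using R[of "x + T *\<^sub>R \<omega>"] T1 \<omega> by auto
  moreover have "crossing \<omega> x e T = 0" if "e \<in> E" for e
    using T2[OF that] by (auto simp: crossing_def indicator_def)
  ultimately have "D T = 0" by (simp add: D_def)
  then have "D t = 0" using const[of t T] by simp
  then show ?thesis by (simp add: D_def)
qed

text \<open>With the indicator written as a signed sum of rays, the fundamental theorem applies to
  each ray separately and the crossings need not be ordered or paired. The rays are cut at a common
  parameter \<open>- R\<close>, where the contributions cancel.\<close>

lemma line_integral:
  fixes F :: "real^'d \<Rightarrow> real" and G :: "real^'d \<Rightarrow> real^'d"
  assumes good: "good_line \<omega> x" and \<omega>: "norm \<omega> = 1"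
    and F: "\<And>y. (F has_derivative (\<lambda>h. G y \<bullet> h)) (at y)" and G: "continuous_on UNIV G"
  shows "(\<integral>t. indicator K (x + t *\<^sub>R \<omega>) * (G (x + t *\<^sub>R \<omega>) \<bullet> \<omega>) \<partial>lborel) =
    (\<Sum>e\<in>E. sgn (s e * (\<nu> e \<bullet> \<omega>)) * (indicator e (skew_proj \<omega> (\<nu> e) (offset e) x)
        * F (skew_proj \<omega> (\<nu> e) (offset e) x)))"
proof -
  let ?g = "\<lambda>t. F (x + t *\<^sub>R \<omega>)" and ?g' = "\<lambda>t. G (x + t *\<^sub>R \<omega>) \<bullet> \<omega>"
  define a where "a = (\<lambda>e. sgn (s e * (\<nu> e \<bullet> \<omega>)) * (indicator e (x + hit \<omega> x e *\<^sub>R \<omega>) :: real))"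
  have proj: "skew_proj \<omega> (\<nu> e) (offset e) x = x + hit \<omega> x e *\<^sub>R \<omega>" for e
    by (simp add: skew_proj_def hit_def)
  obtain r where r: "\<And>z. z \<in> K \<Longrightarrow> norm z \<le> r" using bounded_K by (auto simp: bounded_iff)
  \<comment> \<open>Large enough that the line is outside \<open>K\<close> before \<open>- R\<close>
    and that no face is hit before \<open>- R\<close>; each cut ray is then an interval ending at
    its hit.\<close>
  define R where "R = Max (insert (r + norm x) ((\<lambda>e. - hit \<omega> x e) ` E))"
  have R1: "r + norm x \<le> R" using finite_E by (auto simp: R_def)
  have R2: "- R \<le> hit \<omega> x e" if "e \<in> E" for e
  proof -
    have "- hit \<omega> x e \<le> R" using finite_E that by (auto simp: R_def)
    then show ?thesis by simp
  qed
  have outside: "x + t *\<^sub>R \<omega> \<notin> K" if "t < - R" for t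
  proof
    assume "x + t *\<^sub>R \<omega> \<in> K"
    then have "norm (x + t *\<^sub>R \<omega>) \<le> r" by (rule r)
    moreover have "norm (t *\<^sub>R \<omega>) \<le> norm (x + t *\<^sub>R \<omega>) + norm x"
      using norm_triangle_ineq4[of "x + t *\<^sub>R \<omega>" x] by simp
    ultimately show False using that R1 \<omega> by simp
  qed
  have cr: "crossing \<omega> x e t = a e * indicator {- R..hit \<omega> x e} t"
    if "e \<in> E" "- R \<le> t" "t \<noteq> hit \<omega> x e" for e t
    using that sign[OF that(1)]
    by (auto simp: crossing_def a_def indicator_def sgn_if mult_less_0_iff zero_less_mult_iff)
  have cr_before: "crossing \<omega> x e (- R - 1) = a e" if "e \<in> E" for e
    using R2[OF that] sign[OF that]
    by (auto simp: crossing_def a_def indicator_def sgn_if mult_less_0_iff zero_less_mult_iff)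
  \<comment> \<open>At \<open>- R - 1\<close> the line is outside \<open>K\<close> while all rays
    are present, so the signs of entries and exits add up to zero.\<close>
  have sum_a: "(\<Sum>e\<in>E. a e) = 0"
    using indicator_line_eq_crossings[OF good \<omega>, of "- R - 1"] outside[of "- R - 1"] cr_before by simp
  have cont: "isCont ?g' t" for t
    using G by (intro continuous_intros continuous_on_interior[OF continuous_on_compose2[OF G, of UNIV "\<lambda>t. x + t *\<^sub>R \<omega>"]] )
      (auto intro!: continuous_intros)
  then have contU: "continuous_on UNIV ?g'" by (simp add: continuous_on_eq_continuous_at)
  have [measurable]: "?g' \<in> borel_measurable borel" "K \<in> sets borel"
    using contU open_K by (auto intro: borel_measurable_continuous_onI)
  have deriv: "(?g has_real_derivative ?g' t) (at t)" for t
  proof -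
    have "((\<lambda>t. x + t *\<^sub>R \<omega>) has_derivative (\<lambda>h. h *\<^sub>R \<omega>)) (at t)"
      by (auto intro!: derivative_eq_intros)
    from diff_chain_at[OF this F] show ?thesis
      by (simp add: has_field_derivative_def o_def mult_commute_abs)
  qed
  \<comment> \<open>The rays of \<open>crossing\<close> and the closed intervals differ at most at
    the finitely many hitting parameters.\<close>
  have eq: "AE t in lborel. indicator K (x + t *\<^sub>R \<omega>) * ?g' t =
     (\<Sum>e\<in>E. a e * (?g' t * indicator {- R..hit \<omega> x e} t))"
  proof -
    have "AE t in lborel. t \<notin> hit \<omega> x ` E"
      using finite_E by (intro AE_not_in finite_imp_null_set_lborel) simp
    then show ?thesis
    proof eventually_elim
      case (elim t)
      show ?case
      proof (cases "t < - R")
        case True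
        then show ?thesis using outside[OF True] by (auto simp: indicator_def)
      next
        case False
        have "crossing \<omega> x e t = a e * indicator {- R..hit \<omega> x e} t" if "e \<in> E" for e
          by (rule cr[OF that]) (use False elim that in auto)
        then show ?thesis
          using indicator_line_eq_crossings[OF good \<omega>, of t]
          by (simp add: sum_distrib_left sum_distrib_right ac_simps)
      qed
    qed
  qed
  have "(\<integral>t. indicator K (x + t *\<^sub>R \<omega>) * ?g' t \<partial>lborel) =
      (\<integral>t. (\<Sum>e\<in>E. a e * (?g' t * indicator {- R..hit \<omega> x e} t)) \<partial>lborel)"
    by (rule integral_cong_AE[OF _ _ eq]) measurable
  also have "\<dots> = (\<Sum>e\<in>E. a e * (\<integral>t. ?g' t * indicator {- R..hit \<omega> x e} t \<partial>lborel))"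
    using cont by (subst Bochner_Integration.integral_sum)
      (auto intro!: integrable_mult_right borel_integrable_atLeastAtMost)
  also have "\<dots> = (\<Sum>e\<in>E. a e * (?g (hit \<omega> x e) - ?g (- R)))"
  proof (rule sum.cong[OF refl])
    fix e assume "e \<in> E"
    from integral_FTC_Icc_real[OF R2[OF this] deriv cont]
    show "a e * (\<integral>t. ?g' t * indicator {- R..hit \<omega> x e} t \<partial>lborel) = a e * (?g (hit \<omega> x e) - ?g (- R))"
      by simp
  qed
  also have "\<dots> = (\<Sum>e\<in>E. a e * ?g (hit \<omega> x e)) - (\<Sum>e\<in>E. a e) * ?g (- R)"
    by (simp add: right_diff_distrib sum_subtractf sum_distrib_right)
  finally show ?thesis by (simp add: sum_a proj) (simp add: a_def mult.assoc)
qed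

lemma integrable_indicator_continuous:
  assumes "continuous_on UNIV (f :: real^'d \<Rightarrow> real)"
  shows "integrable lborel (\<lambda>x. indicator K x * f x)"
proof -
  have "set_integrable lborel (closure K) f"
    unfolding set_integrable_def
    using bounded_K continuous_on_subset[OF assms] by (intro borel_integrable_compact) auto
  then have "set_integrable lborel K f"
    by (rule set_integrable_subset) (use open_K closure_subset in auto)
  then show ?thesis by (simp add: set_integrable_def)
qed

text \<open>Integrate \<open>line_integral\<close> over all lines. Projecting the lines to the plane
  of a face contributes \<open>\<bar>\<nu> e \<bullet> \<omega>\<bar>\<close>, which combines with
  the sign of the crossing to the factor in the formula; faces parallel to \<open>\<omega>\<close>
  give zero on both sides.\<close>

theorem green:
  fixes F :: "real^'d \<Rightarrow> real" and G :: "real^'d \<Rightarrow> real^'d"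
  assumes \<omega>: "norm \<omega> = 1"
    and F: "\<And>y. (F has_derivative (\<lambda>h. G y \<bullet> h)) (at y)" and G: "continuous_on UNIV G"
  shows "(\<integral>x. indicator K x * (G x \<bullet> \<omega>) \<partial>lborel) =
    (\<Sum>e\<in>E. s e * (\<nu> e \<bullet> \<omega>) * (\<integral>x. indicator e x * F x \<partial>hyperplane_measure (\<nu> e) (offset e)))"
proof -
  let ?P = "\<lambda>e. skew_proj \<omega> (\<nu> e) (offset e)"
  have contF: "continuous_on UNIV F"
    using F by (meson continuous_at_imp_continuous_on has_derivative_continuous)
  have intF: "integrable (hyperplane_measure (\<nu> e) (offset e)) (\<lambda>x. indicator e x * F x)" if "e \<in> E" for e
    using compact_face[OF that] contF norm_nu[OF that] by (rule integrable_hyperplane_measure_compact)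
  have [measurable]: "K \<in> sets borel" "G \<in> borel_measurable borel" "F \<in> borel_measurable borel"
    using open_K G contF by (auto intro: borel_measurable_continuous_onI)
  have [measurable]: "e \<in> E \<Longrightarrow> e \<in> sets borel" for e
    using compact_face borel_compact by blast
  have ae: "AE x in slab_measure \<omega>. good_line \<omega> x"
    unfolding slab_measure_def using AE_good_line[of \<omega>] by (subst AE_density) auto
  have "(\<integral>x. indicator K x * (G x \<bullet> \<omega>) \<partial>lborel) =
      (\<integral>x. (\<integral>t. indicator K (x + t *\<^sub>R \<omega>) * (G (x + t *\<^sub>R \<omega>) \<bullet> \<omega>) \<partial>lborel) \<partial>slab_measure \<omega>)"
    by (intro integral_slab_fubini \<omega> integrable_indicator_continuous continuous_intros G)
  also have "\<dots> = (\<integral>x. (\<Sum>e\<in>E. sgn (s e * (\<nu> e \<bullet> \<omega>)) * (indicator e (?P e x) * F (?P e x))) \<partial>slab_measure \<omega>)"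
  proof (rule integral_cong_AE)
    show "AE x in slab_measure \<omega>. (\<integral>t. indicator K (x + t *\<^sub>R \<omega>) * (G (x + t *\<^sub>R \<omega>) \<bullet> \<omega>) \<partial>lborel) =
        (\<Sum>e\<in>E. sgn (s e * (\<nu> e \<bullet> \<omega>)) * (indicator e (?P e x) * F (?P e x)))"
      using ae by eventually_elim (rule line_integral[OF _ \<omega> F G])
  qed measurable
  also have "\<dots> = (\<Sum>e\<in>E. sgn (s e * (\<nu> e \<bullet> \<omega>)) * (\<integral>x. indicator e (?P e x) * F (?P e x) \<partial>slab_measure \<omega>))"
  proof (subst Bochner_Integration.integral_sum)
    fix e assume e: "e \<in> E"
    show "integrable (slab_measure \<omega>) (\<lambda>x. sgn (s e * (\<nu> e \<bullet> \<omega>)) * (indicator e (?P e x) * F (?P e x)))"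
      using integral_skew_proj(1)[OF \<omega> norm_nu[OF e] _ intF[OF e]]
      by (cases "\<nu> e \<bullet> \<omega> = 0") (auto intro: integrable_mult_right)
  qed simp
  also have "\<dots> = (\<Sum>e\<in>E. s e * (\<nu> e \<bullet> \<omega>) * (\<integral>x. indicator e x * F x \<partial>hyperplane_measure (\<nu> e) (offset e)))"
  proof (rule sum.cong[OF refl])
    fix e assume e: "e \<in> E"
    show "sgn (s e * (\<nu> e \<bullet> \<omega>)) * (\<integral>x. indicator e (?P e x) * F (?P e x) \<partial>slab_measure \<omega>) =
        s e * (\<nu> e \<bullet> \<omega>) * (\<integral>x. indicator e x * F x \<partial>hyperplane_measure (\<nu> e) (offset e))"
    proof (cases "\<nu> e \<bullet> \<omega> = 0")
      case False
      have "sgn (s e * (\<nu> e \<bullet> \<omega>)) * \<bar>\<nu> e \<bullet> \<omega>\<bar> = s e * (\<nu> e \<bullet> \<omega>)"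
        using sign[OF e] by (auto simp: sgn_mult sgn_mult_abs)
      then show ?thesis
        using integral_skew_proj(2)[OF \<omega> norm_nu[OF e] False intF[OF e]]
        by (simp flip: mult.assoc)
    qed simp
  qed
  finally show ?thesis .
qed

end

text \<open>A piece of \<open>S\<close> contains a relative ball, and the points of the open slab
  that project into it form a nonempty open set. Positivity is what makes a constant jump of zero
  norm vanish.\<close>

lemma emeasure_flat_polytopal_set_pos:
  fixes n :: "real^'d::finite"
  assumes n: "norm n = 1" and S: "S \<subseteq> {x. n \<bullet> x = c}" "polytopal_set (int CARD('d) - 1) S"
  shows "0 < emeasure (hyperplane_measure n c) S"
proof -
  have nn: "n \<bullet> n = 1" and nz: "n \<noteq> 0" using n by (auto simp: norm_eq_1)
  obtain C where C: "C \<subseteq> S" "polytope C" "aff_dim C = int CARD('d) - 1"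
    using S(2) unfolding polytopal_set_def by blast
  have hull: "affine hull C = {x. n \<bullet> x = c}"
    using C S by (intro flat_polytope_affine_hull nz) auto
  have "C \<noteq> {}"
  proof
    assume "C = {}"
    then have "int CARD('d) = 0" using C(3) by simp
    then show False by simp
  qed
  then have "rel_interior C \<noteq> {}"
    using C(2) polytope_imp_convex rel_interior_eq_empty by blast
  then obtain y r where y: "r > 0" "ball y r \<inter> affine hull C \<subseteq> C" "y \<in> C"
    by (auto simp: rel_interior_ball)
  have [measurable]: "S \<in> sets borel" using polytopal_set_compact[OF S(2)] by (rule borel_compact)
  let ?P = "\<lambda>x. x - (n \<bullet> x - c) *\<^sub>R n"
  let ?O = "{x. c < n \<bullet> x} \<inter> {x. n \<bullet> x < c + 1} \<inter> ?P -` ball y r"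
  have op: "open ?O"
    by (intro open_Int open_halfspace_gt open_halfspace_lt open_vimage) (auto intro!: continuous_intros)
  have yc: "n \<bullet> y = c" using y(3) C(1) S(1) by blast
  \<comment> \<open>Half way through the slab, straight above the centre of the relative
    ball.\<close>
  have "y + (1/2) *\<^sub>R n \<in> ?O" using y(1) yc nn by (simp add: inner_add_right)
  then have "\<not> negligible ?O" using op open_not_negligible by blast
  then have "0 < emeasure lborel ?O"
    using op by (simp add: negligible_iff_null_sets null_sets_def zero_less_iff_neq_zero)
  also have "emeasure lborel ?O \<le> emeasure lborel {x \<in> slab n c. ?P x \<in> S}"
  proof (rule emeasure_mono)
    have "?P x \<in> S" if "?P x \<in> ball y r" for x
    proof -
      have "?P x \<in> affine hull C" unfolding hull using nn by (simp add: inner_diff_right)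
      then show ?thesis using that y(2) C(1) by blast
    qed
    then show "?O \<subseteq> {x \<in> slab n c. ?P x \<in> S}" by auto
  qed measurable
  finally show ?thesis by (simp add: emeasure_hyperplane_measure)
qed

section \<open>Polynomials, traces and inner products\<close>

text \<open>On the line from \<open>a\<close> through \<open>x\<close> the function is a polynomial
  in one variable that vanishes on an interval, hence identically.\<close>

lemma real_polynomial_function_zero_on_open:
  fixes f :: "'a::real_normed_vector \<Rightarrow> real"
  assumes f: "real_polynomial_function f" and S: "open S" "a \<in> S" "\<And>x. x \<in> S \<Longrightarrow> f x = 0"
  shows "f x = 0"
proof -
  let ?l = "\<lambda>t. a + t *\<^sub>R (x - a)"
  have "polynomial_function ?l" by (intro polynomial_function_add) (auto intro: polynomial_function_bounded_linear bounded_linear_scaleR_left)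
  then have "real_polynomial_function (f \<circ> ?l)" using f by (rule real_polynomial_function_compose)
  then obtain c n where c: "\<And>t. f (?l t) = (\<Sum>i\<le>n. c i * t ^ i)"
    by (auto simp: real_polynomial_function_iff_sum fun_eq_iff)
  have "eventually (\<lambda>t. ?l t \<in> S) (nhds 0)"
    using S(1,2) by (intro topological_tendstoD[of _ a]) (auto intro!: tendsto_eq_intros filterlim_ident)
  then obtain d where d: "d > 0" "\<And>t. \<bar>t\<bar> < d \<Longrightarrow> ?l t \<in> S"
    by (auto simp: eventually_nhds_metric dist_real_def)
  then have "{0<..<d} \<subseteq> {t. (\<Sum>i\<le>n. c i * t ^ i) = 0}"
    using S(3) by (auto simp flip: c)
  then have "infinite {t. (\<Sum>i\<le>n. c i * t ^ i) = 0}"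
    using d(1) infinite_Ioo finite_subset by blast
  then have "f (?l 1) = 0" unfolding c by (simp add: polyfun_finite_roots)
  then show ?thesis by simp
qed

text \<open>The points of \<open>S\<close> where \<open>f\<close> is nonzero form an open null set,
  which is empty.\<close>

lemma continuous_zero_of_L2_zero:
  fixes f :: "'a::euclidean_space \<Rightarrow> real"
  assumes S: "open S" and f: "continuous_on UNIV f"
    and int: "integrable lborel (\<lambda>x. indicator S x * (f x * f x))"
    and zero: "(\<integral>x. indicator S x * (f x * f x) \<partial>lborel) = 0" and x: "x \<in> S"
  shows "f x = 0"
proof (rule ccontr)
  assume nz: "f x \<noteq> 0"
  have "AE x in lborel. indicator S x * (f x * f x) = 0"
    using zero by (subst (asm) integral_nonneg_eq_0_iff_AE[OF int]) auto
  then have ae: "AE y in lborel. y \<notin> S \<inter> f -` (- {0})"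
    by eventually_elim auto
  have op: "open (S \<inter> f -` (- {0}))"
    using S f by (intro open_Int open_vimage) auto
  then have "S \<inter> f -` (- {0}) \<in> null_sets lborel"
    using ae by (simp add: AE_iff_null_sets)
  then have "negligible (S \<inter> f -` (- {0}))"
    using op by (simp add: negligible_iff_null_sets null_sets_completionI)
  then show False using op open_not_negligible x nz by blast
qed

definition monomial :: "('d::finite \<Rightarrow> nat) \<Rightarrow> real^'d \<Rightarrow> real" where
  "monomial \<alpha> x = (\<Prod>i\<in>UNIV. (x $ i) ^ \<alpha> i)"

definition multi_indices :: "nat \<Rightarrow> ('d::finite \<Rightarrow> nat) set" where
  "multi_indices p = {\<alpha>. (\<Sum>i\<in>UNIV. \<alpha> i) \<le> p}"

lemma finite_multi_indices: "finite (multi_indices p :: ('d::finite \<Rightarrow> nat) set)"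
proof (rule finite_subset)
  show "multi_indices p \<subseteq> {\<alpha> :: 'd \<Rightarrow> nat. \<forall>x. (x \<in> UNIV \<longrightarrow> \<alpha> x \<in> {..p}) \<and> (x \<notin> UNIV \<longrightarrow> \<alpha> x = 0)}"
  proof
    fix \<alpha> :: "'d \<Rightarrow> nat" assume "\<alpha> \<in> multi_indices p"
    then have "\<alpha> x \<le> p" for x
      using member_le_sum[of x UNIV \<alpha>] by (simp add: multi_indices_def)
    then show "\<alpha> \<in> {\<alpha>. \<forall>x. (x \<in> UNIV \<longrightarrow> \<alpha> x \<in> {..p}) \<and> (x \<notin> UNIV \<longrightarrow> \<alpha> x = 0)}" by simp
  qed
qed (rule finite_set_of_finite_funs; simp)

lemma polys_iff: "q \<in> polys p \<longleftrightarrow> (\<exists>c. q = (\<lambda>x. \<Sum>\<alpha>\<in>multi_indices p. c \<alpha> * monomial \<alpha> x))"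
  unfolding polys_def monomial_def multi_indices_def by (auto simp: fun_eq_iff)

lemma polys_lincomb:
  assumes "q \<in> polys p" "r \<in> polys p"
  shows "(\<lambda>x. a * q x + b * r x) \<in> polys p"
proof -
  obtain c d where "q = (\<lambda>x. \<Sum>\<alpha>\<in>multi_indices p. c \<alpha> * monomial \<alpha> x)"
      "r = (\<lambda>x. \<Sum>\<alpha>\<in>multi_indices p. d \<alpha> * monomial \<alpha> x)"
    using assms unfolding polys_iff by blast
  then have "(\<lambda>x. a * q x + b * r x) = (\<lambda>x. \<Sum>\<alpha>\<in>multi_indices p. (a * c \<alpha> + b * d \<alpha>) * monomial \<alpha> x)"
    by (simp add: sum_distrib_left sum.distrib algebra_simps)
  then show ?thesis
    unfolding polys_iff by (intro exI[of _ "\<lambda>\<alpha>. a * c \<alpha> + b * d \<alpha>"])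
qed

lemma polys_zero: "(\<lambda>x. 0) \<in> polys p"
  unfolding polys_iff by (rule exI[of _ "\<lambda>_. 0"]) simp

lemma polys_sum:
  assumes "finite I" "\<And>i. i \<in> I \<Longrightarrow> q i \<in> polys p"
  shows "(\<lambda>x. \<Sum>i\<in>I. a i * q i x) \<in> polys p"
  using assms
proof (induction I rule: finite_induct)
  case (insert i I)
  then have "(\<lambda>x. a i * q i x + 1 * (\<Sum>i\<in>I. a i * q i x)) \<in> polys p"
    by (intro polys_lincomb) auto
  then show ?case using insert by simp
qed (simp add: polys_zero)

lemma monomial_in_polys: "\<alpha> \<in> multi_indices p \<Longrightarrow> monomial \<alpha> \<in> polys p"
  unfolding polys_iff
  by (rule exI[of _ "\<lambda>\<beta>. if \<beta> = \<alpha> then 1 else 0"], rule ext)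
     (simp add: finite_multi_indices if_distrib[of "\<lambda>c. c * _"] cong: if_cong)

lemma polys_const: "(\<lambda>x. c) \<in> polys p"
proof -
  have "monomial (\<lambda>_. 0) \<in> polys p" by (rule monomial_in_polys) (simp add: multi_indices_def)
  from polys_lincomb[OF this polys_zero, of c 0] show ?thesis by (simp add: monomial_def)
qed

lemma polys_real_polynomial_function:
  assumes "q \<in> polys p"
  shows "real_polynomial_function q"
proof -
  have "real_polynomial_function (monomial \<alpha> :: real^'a \<Rightarrow> real)" for \<alpha>
    unfolding monomial_def[abs_def]
    by (intro real_polynomial_function_prod real_polynomial_function_power
        real_polynomial_function.intros(1) bounded_linear_vec_nth) simp
  then show ?thesis
    using assms unfolding polys_iff
    by (auto intro!: real_polynomial_function_sum real_polynomial_function.intros(2,4) finite_multi_indices)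
qed

text \<open>For \<open>\<alpha> i = 0\<close> the subtraction on naturals leaves the exponent at 0,
  but then the coefficient \<open>real (\<alpha> i)\<close> removes the term.\<close>

lemma monomial_has_derivative:
  "(monomial \<alpha> has_derivative
     (\<lambda>h. \<Sum>i\<in>UNIV. h $ i * (real (\<alpha> i) * monomial (\<alpha>(i := \<alpha> i - 1)) x))) (at x)"
proof -
  have d: "((\<lambda>x. (x $ i) ^ \<alpha> i) has_derivative (\<lambda>h. real (\<alpha> i) * (h $ i) * (x $ i) ^ (\<alpha> i - 1))) (at x)" for i
    by (auto intro!: derivative_eq_intros bounded_linear_imp_has_derivative bounded_linear_vec_nth)
  have "((\<lambda>x. \<Prod>i\<in>UNIV. (x $ i) ^ \<alpha> i) has_derivative
     (\<lambda>h. \<Sum>i\<in>UNIV. real (\<alpha> i) * (h $ i) * (x $ i) ^ (\<alpha> i - 1) * (\<Prod>j\<in>UNIV - {i}. (x $ j) ^ \<alpha> j))) (at x)"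
    by (rule has_derivative_prod) (rule d)
  moreover have "monomial (\<alpha>(i := \<alpha> i - 1)) x = (x $ i) ^ (\<alpha> i - 1) * (\<Prod>j\<in>UNIV - {i}. (x $ j) ^ \<alpha> j)" for i
    unfolding monomial_def by (subst prod.remove[of _ i]) (auto intro!: prod.cong)
  ultimately show ?thesis by (simp add: monomial_def[abs_def] ac_simps)
qed

lemma grad_eqI:
  assumes "(f has_derivative (\<lambda>h. \<Sum>i\<in>UNIV. h $ i * G i)) (at x)"
  shows "grad f x = (\<chi> i. G i)"
proof -
  have "frechet_derivative f (at x) = (\<lambda>h. \<Sum>i\<in>UNIV. h $ i * G i)"
    using frechet_derivative_at[OF assms] by simp
  then show ?thesis
    by (simp add: grad_def vec_eq_iff axis_def if_distrib[of "\<lambda>c. c * _"] cong: if_cong)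
qed

text \<open>That directional derivatives stay in the same \<open>polys p\<close> makes them
  admissible test functions in \<open>no_gap_imp_zero\<close>.\<close>

lemma polys_grad:
  assumes "q \<in> polys p"
  shows "(q has_derivative (\<lambda>h. grad q x \<bullet> h)) (at x)"
    and "(\<lambda>x. \<omega> \<bullet> grad q x) \<in> polys p"
    and "continuous_on UNIV (grad q)"
proof -
  obtain c where q: "q = (\<lambda>x. \<Sum>\<alpha>\<in>multi_indices p. c \<alpha> * monomial \<alpha> x)"
    using assms unfolding polys_iff by blast
  define G where "G = (\<lambda>i x. \<Sum>\<alpha>\<in>multi_indices p. c \<alpha> * real (\<alpha> i) * monomial (\<alpha>(i := \<alpha> i - 1)) x)"
  have "(q has_derivative (\<lambda>h. \<Sum>\<alpha>\<in>multi_indices p. c \<alpha> *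
      (\<Sum>i\<in>UNIV. h $ i * (real (\<alpha> i) * monomial (\<alpha>(i := \<alpha> i - 1)) x)))) (at x)" for x
    unfolding q by (intro has_derivative_sum has_derivative_mult_right monomial_has_derivative)
  also have "(\<lambda>h :: real^'a. \<Sum>\<alpha>\<in>multi_indices p. c \<alpha> *
      (\<Sum>i\<in>UNIV. h $ i * (real (\<alpha> i) * monomial (\<alpha>(i := \<alpha> i - 1)) x))) = (\<lambda>h. \<Sum>i\<in>UNIV. h $ i * G i x)" for x
    unfolding G_def sum_distrib_left
    by (subst sum.swap) (simp add: ac_simps)
  finally have d: "(q has_derivative (\<lambda>h. \<Sum>i\<in>UNIV. h $ i * G i x)) (at x)" for x .
  have g: "grad q x = (\<chi> i. G i x)" for x using grad_eqI[OF d] .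
  show "(q has_derivative (\<lambda>h. grad q x \<bullet> h)) (at x)"
    using d by (simp add: g inner_vec_def mult.commute)
  have G: "G i \<in> polys p" for i
    unfolding G_def
  proof (intro polys_sum finite_multi_indices monomial_in_polys)
    fix \<alpha> :: "'a \<Rightarrow> nat" assume "\<alpha> \<in> multi_indices p"
    moreover have "(\<Sum>j\<in>UNIV. (\<alpha>(i := \<alpha> i - 1)) j) \<le> (\<Sum>j\<in>UNIV. \<alpha> j)"
      by (rule sum_mono) auto
    ultimately show "\<alpha>(i := \<alpha> i - 1) \<in> multi_indices p" by (simp add: multi_indices_def)
  qed
  then show "(\<lambda>x. \<omega> \<bullet> grad q x) \<in> polys p"
    unfolding g inner_vec_def by (simp add: polys_sum)
  have "continuous_on UNIV (G i)" for i
    using polys_real_polynomial_function[OF G]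
    by (intro continuous_on_polymonial_function) (simp add: real_polynomial_function_eq)
  then show "continuous_on UNIV (grad q)"
    unfolding g[abs_def] by (intro continuous_on_vec_lambda)
qed

lemma polys_continuous: "q \<in> polys p \<Longrightarrow> continuous_on UNIV q"
  using polys_grad(1)[THEN has_derivative_continuous] by (intro continuous_at_imp_continuous_on) blast

lemma grad_cong_open:
  assumes "open S" "x \<in> S" "\<And>y. y \<in> S \<Longrightarrow> f y = q y" "q differentiable (at x)"
  shows "grad f x = grad q x"
proof -
  have "(q has_derivative frechet_derivative q (at x)) (at x)"
    using assms(4) frechet_derivative_works by blast
  then have "(f has_derivative frechet_derivative q (at x)) (at x)"
    using assms(1,2) by (rule has_derivative_transform_within_open) (simp add: assms(3))
  then show ?thesis by (simp add: grad_def frechet_derivative_at[symmetric])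
qed

lemma trace_from_eq:
  assumes "open K" "x \<in> frontier K" "continuous_on UNIV q" "\<And>y. y \<in> K \<Longrightarrow> v y = q y"
  shows "trace_from K v x = q x"
  unfolding trace_from_def
proof (rule tendsto_Lim)
  have "x \<notin> K" "x \<in> closure K" using assms(1,2) by (auto simp: frontier_def interior_open)
  then show "\<not> trivial_limit (at x within K)"
    by (auto simp: trivial_limit_within closure_def)
  have "(q \<longlongrightarrow> q x) (at x within K)"
    using assms(3) by (meson UNIV_I continuous_on_def tendsto_within_subset subset_UNIV)
  moreover have "eventually (\<lambda>y. q y = v y) (at x within K)"
    using assms(4) by (simp add: eventually_at_filter)
  ultimately show "(v \<longlongrightarrow> q x) (at x within K)"
    by (rule Lim_transform_eventually)
qed

text \<open>Traces and gradients of discrete functions have useful values only on a face or an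
  element. Agreement there with a globally continuous function supplies integrability, and
  measurability, of their restrictions.\<close>

definition agrees_cont :: "'a::topological_space set \<Rightarrow> ('a \<Rightarrow> real) \<Rightarrow> bool" where
  "agrees_cont S f \<longleftrightarrow> (\<exists>q. continuous_on UNIV q \<and> (\<forall>x\<in>S. f x = q x))"

lemma agrees_contI: "continuous_on UNIV q \<Longrightarrow> (\<And>x. x \<in> S \<Longrightarrow> f x = q x) \<Longrightarrow> agrees_cont S f"
  unfolding agrees_cont_def by blast

lemma agrees_cont_intros:
  shows "agrees_cont S (\<lambda>x. c)"
    and "agrees_cont S f \<Longrightarrow> agrees_cont S g \<Longrightarrow> agrees_cont S (\<lambda>x. f x - g x)"
    and "agrees_cont S f \<Longrightarrow> agrees_cont S g \<Longrightarrow> agrees_cont S (\<lambda>x. f x * g x)"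
proof -
  show "agrees_cont S (\<lambda>x. c)" by (rule agrees_contI[of "\<lambda>x. c"]) auto
  assume "agrees_cont S f" "agrees_cont S g"
  then obtain q r where q: "continuous_on UNIV q" "\<And>x. x \<in> S \<Longrightarrow> f x = q x"
    and r: "continuous_on UNIV r" "\<And>x. x \<in> S \<Longrightarrow> g x = r x"
    unfolding agrees_cont_def by blast
  show "agrees_cont S (\<lambda>x. f x - g x)"
    by (rule agrees_contI[of "\<lambda>x. q x - r x"]) (auto intro!: continuous_intros q(1) r(1) simp: q(2) r(2))
  show "agrees_cont S (\<lambda>x. f x * g x)"
    by (rule agrees_contI[of "\<lambda>x. q x * r x"]) (auto intro!: continuous_intros q(1) r(1) simp: q(2) r(2))
qed

text \<open>Both elements and faces are of this kind, so that the volume and the face terms of the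
  transport form are treated alike.\<close>

definition continuous_integrable :: "'a::topological_space measure \<Rightarrow> 'a set \<Rightarrow> bool" where
  "continuous_integrable N S \<longleftrightarrow> (\<forall>q :: 'a \<Rightarrow> real. continuous_on UNIV q \<longrightarrow> integrable N (\<lambda>x. indicator S x * q x))"

definition ip :: "'a::topological_space measure \<Rightarrow> 'a set \<Rightarrow> ('a \<Rightarrow> real) \<Rightarrow> ('a \<Rightarrow> real) \<Rightarrow> real" where
  "ip N S u v = (\<integral>x. indicator S x * (u x * v x) \<partial>N)"

lemma inner_L2_ip: "inner_L2 S u v = ip lborel S u v"
  and inner_face_ip: "inner_face M e u v = ip (face_measure M e) e u v"
  by (simp_all add: inner_L2_def inner_face_def ip_def set_lebesgue_integral_def)

lemma ip_integrable:
  assumes "continuous_integrable N S" "agrees_cont S u" "agrees_cont S v"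
  shows "integrable N (\<lambda>x. indicator S x * (u x * v x))"
proof -
  obtain q where "continuous_on UNIV q" "\<And>x. x \<in> S \<Longrightarrow> u x * v x = q x"
    using agrees_cont_intros(3)[OF assms(2,3)] unfolding agrees_cont_def by blast
  then have "integrable N (\<lambda>x. indicator S x * q x)" "(\<lambda>x. indicator S x * (u x * v x)) = (\<lambda>x. indicator S x * q x)"
    using assms(1) by (auto simp: continuous_integrable_def fun_eq_iff indicator_def)
  then show ?thesis by simp
qed

lemma ip_commute: "ip N S u v = ip N S v u"
  by (simp add: ip_def mult.commute)

lemma ip_cong: "(\<And>x. x \<in> S \<Longrightarrow> u x = u' x) \<Longrightarrow> (\<And>x. x \<in> S \<Longrightarrow> v x = v' x) \<Longrightarrow> ip N S u v = ip N S u' v'"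
  unfolding ip_def by (rule Bochner_Integration.integral_cong) (auto simp: indicator_def)

lemma ip_scale: "ip N S (\<lambda>x. a * u x) v = a * ip N S u v"
proof -
  have "indicator S x * (a * u x * v x) = a * (indicator S x * (u x * v x))" for x by simp
  then show ?thesis by (simp only: ip_def integral_mult_right_zero)
qed

lemma ip_lincomb:
  assumes "continuous_integrable N S" "agrees_cont S u" "agrees_cont S u'" "agrees_cont S v"
  shows "ip N S (\<lambda>x. a * u x + b * u' x) v = a * ip N S u v + b * ip N S u' v"
    and "ip N S v (\<lambda>x. a * u x + b * u' x) = a * ip N S v u + b * ip N S v u'"
proof -
  have "ip N S (\<lambda>x. a * u x + b * u' x) v =
      (\<integral>x. a * (indicator S x * (u x * v x)) + b * (indicator S x * (u' x * v x)) \<partial>N)"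
    unfolding ip_def by (rule Bochner_Integration.integral_cong) (auto simp: algebra_simps)
  also have "\<dots> = a * ip N S u v + b * ip N S u' v"
    using ip_integrable[OF assms(1,2,4)] ip_integrable[OF assms(1,3,4)] by (simp add: ip_def)
  finally show "ip N S (\<lambda>x. a * u x + b * u' x) v = a * ip N S u v + b * ip N S u' v" .
  then show "ip N S v (\<lambda>x. a * u x + b * u' x) = a * ip N S v u + b * ip N S v u'"
    by (simp add: ip_commute[of N S v])
qed

lemma ip_diff:
  assumes "continuous_integrable N S" "agrees_cont S u" "agrees_cont S u'" "agrees_cont S v"
  shows "ip N S (\<lambda>x. u x - u' x) v = ip N S u v - ip N S u' v"
    and "ip N S v (\<lambda>x. u x - u' x) = ip N S v u - ip N S v u'"
  using ip_lincomb[OF assms, of 1 "-1"] by simp_all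

lemma ip_nonneg: "0 \<le> ip N S u u"
  unfolding ip_def by (rule Bochner_Integration.integral_nonneg) (auto simp: indicator_def)

text \<open>Zero norm makes \<open>u\<close> vanish almost everywhere on \<open>S\<close>, and with
  it the product.\<close>

lemma ip_zero_left:
  assumes "continuous_integrable N S" "agrees_cont S u" "ip N S u u = 0"
  shows "ip N S u v = 0"
proof -
  have "AE x in N. indicator S x * (u x * u x) = 0"
    using assms(3) ip_integrable[OF assms(1,2,2)]
    by (subst (asm) ip_def, subst (asm) integral_nonneg_eq_0_iff_AE) (auto simp: indicator_def)
  then have ae: "AE x in N. indicator S x * (u x * v x) = 0"
    by eventually_elim (auto simp: indicator_def split: if_splits)
  then show ?thesis unfolding ip_def by (rule integral_eq_zero_AE)
qed

section \<open>The mesh and the discontinuous polynomial space\<close>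

text \<open>Excludes slits: at a frontier point the open region below the Lipschitz graph is
  disjoint from \<open>U\<close>, hence from its closure, but it comes arbitrarily close to the
  point and so meets \<open>A\<close>.\<close>

lemma lipschitz_domain_absorbs_open:
  fixes U :: "'a::euclidean_space set"
  assumes U: "lipschitz_domain U" and A: "open A" "A \<subseteq> closure U"
  shows "A \<subseteq> U"
proof (rule ccontr)
  assume "\<not> A \<subseteq> U"
  then obtain x where x: "x \<in> A" "x \<notin> U" by blast
  have oU: "open U" using U by (simp add: lipschitz_domain_def)
  have "x \<in> frontier U" using x A oU by (auto simp: frontier_def interior_open)
  then obtain \<nu> r L and \<phi> :: "'a \<Rightarrow> real" where nu: "norm \<nu> = 1" and r: "0 < r"
    and lip: "L-lipschitz_on {z. \<nu> \<bullet> z = 0} \<phi>"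
    and graph: "\<And>y. y \<in> ball x r \<Longrightarrow> y \<in> U \<longleftrightarrow> \<phi> (y - (\<nu> \<bullet> y) *\<^sub>R \<nu>) < \<nu> \<bullet> y"
    using U unfolding lipschitz_domain_def by metis
  have nn: "\<nu> \<bullet> \<nu> = 1" using nu by (simp add: norm_eq_1)
  let ?f = "\<lambda>y. \<phi> (y - (\<nu> \<bullet> y) *\<^sub>R \<nu>)"
  have cont: "continuous_on UNIV ?f"
    by (rule continuous_on_compose2[OF lipschitz_on_continuous_on[OF lip]])
       (auto intro!: continuous_intros simp: inner_diff_right nn)
  obtain d where d: "d > 0" "ball x d \<subseteq> A" using A(1) x(1) open_contains_ball by blast
  define t where "t = min d r / 2"
  have t: "0 < t" "t < d" "t < r" using d r by (auto simp: t_def)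
  \<comment> \<open>Moving along \<open>\<nu>\<close> leaves the orthogonal projection, and thereby
    the height of the graph, unchanged.\<close>
  define y where "y = x - t *\<^sub>R \<nu>"
  have y: "y \<in> ball x d" "y \<in> ball x r" using t nu by (auto simp: y_def dist_norm)
  have "\<nu> \<bullet> x \<le> ?f x" using graph[of x] x(2) r by simp
  moreover have "?f y = ?f x" by (simp add: y_def inner_diff_right nn algebra_simps)
  moreover have "\<nu> \<bullet> y < \<nu> \<bullet> x" using t nn by (simp add: y_def inner_diff_right)
  ultimately have below: "\<nu> \<bullet> y < ?f y" by simp
  have "open {y. \<nu> \<bullet> y < ?f y}"
    using cont by (intro open_Collect_less) (auto intro!: continuous_intros)
  then have op: "open (ball x r \<inter> {y. \<nu> \<bullet> y < ?f y})" by auto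
  have "(ball x r \<inter> {y. \<nu> \<bullet> y < ?f y}) \<inter> U = {}" using graph by force
  then have "(ball x r \<inter> {y. \<nu> \<bullet> y < ?f y}) \<inter> closure U = {}"
    using op open_Int_closure_eq_empty by blast
  then show False using y below d(2) A(2) by blast
qed

locale transport_mesh =
  fixes \<Omega> :: "(real^'d::finite) set" and M :: "'d mesh" and p :: nat and st \<epsilon> :: real
  assumes domain: "lipschitz_polytope \<Omega>" and mesh: "is_mesh \<Omega> M"
    and st: "0 < st" and \<epsilon>: "0 < \<epsilon>"
begin

abbreviation "V \<equiv> Vh M p"

lemma mesh_conjuncts:
  "finite (elems M)" "finite (faces M)"
  "\<forall>K\<in>elems M. lipschitz_polytope K"
  "pairwise disjnt (elems M)"
  "closure \<Omega> = (\<Union>K\<in>elems M. closure K)"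
  "\<forall>e\<in>faces M. polytopal_set (int CARD('d) - 1) e"
  "\<forall>K\<in>elems M. frontier K = \<Union>{e \<in> faces M. e \<subseteq> frontier K}"
  "pairwise (\<lambda>e e'. rel_interior e \<inter> rel_interior e' = {}) (faces M)"
  "\<forall>e\<in>interior_faces \<Omega> M.
     Kplus M e \<noteq> Kminus M e \<and> adjacent_elems M e = {Kplus M e, Kminus M e} \<and>
     outward_unit_normal (Kplus M e) e (nrm M e) \<and>
     outward_unit_normal (Kminus M e) e (- nrm M e)"
  "\<forall>e\<in>boundary_faces \<Omega> M.
     adjacent_elems M e = {Kplus M e} \<and> outward_unit_normal (Kplus M e) e (nrm M e)"
  "\<forall>K\<in>elems M. \<forall>K'\<in>elems M.
     (K, K') \<in> {(A, B). \<exists>e\<in>interior_faces \<Omega> M. {A, B} = {Kplus M e, Kminus M e}}\<^sup>*"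
  using mesh unfolding is_mesh_def by - (elim conjE, assumption)+

lemma meshD:
  "finite (elems M)" "finite (faces M)"
  "K \<in> elems M \<Longrightarrow> lipschitz_polytope K"
  "pairwise disjnt (elems M)"
  "closure \<Omega> = (\<Union>K\<in>elems M. closure K)"
  "e \<in> faces M \<Longrightarrow> polytopal_set (int CARD('d) - 1) e"
  "K \<in> elems M \<Longrightarrow> frontier K = \<Union>{e \<in> faces M. e \<subseteq> frontier K}"
  "pairwise (\<lambda>e e'. rel_interior e \<inter> rel_interior e' = {}) (faces M)"
  by - (fact mesh_conjuncts(1,2,4,5,8) mesh_conjuncts(3,6,7)[THEN bspec])+

lemma interior_faceD:
  assumes "e \<in> interior_faces \<Omega> M"
  shows "Kplus M e \<noteq> Kminus M e" "adjacent_elems M e = {Kplus M e, Kminus M e}"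
    "outward_unit_normal (Kplus M e) e (nrm M e)" "outward_unit_normal (Kminus M e) e (- nrm M e)"
  using bspec[OF mesh_conjuncts(9) assms] by - (elim conjE, assumption)+

lemma boundary_faceD:
  assumes "e \<in> boundary_faces \<Omega> M"
  shows "adjacent_elems M e = {Kplus M e}" "outward_unit_normal (Kplus M e) e (nrm M e)"
  using bspec[OF mesh_conjuncts(10) assms] by - (elim conjE, assumption)+

lemma mesh_connected:
  assumes "K \<in> elems M" "K' \<in> elems M"
  shows "(K, K') \<in> {(A, B). \<exists>e\<in>interior_faces \<Omega> M. {A, B} = {Kplus M e, Kminus M e}}\<^sup>*"
  by (rule bspec[OF bspec[OF mesh_conjuncts(11) assms(1)] assms(2)])

lemma face_cases:
  assumes "e \<in> faces M"
  obtains "e \<in> interior_faces \<Omega> M" "e \<notin> boundary_faces \<Omega> M" | "e \<in> boundary_faces \<Omega> M"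
  using assms unfolding interior_faces_def by blast

lemma elem_open: "K \<in> elems M \<Longrightarrow> open K"
  using meshD(3) by (auto simp: lipschitz_polytope_def lipschitz_domain_def)

lemma lipschitz_polytope_bounded:
  fixes U :: "(real^'d) set"
  assumes "lipschitz_polytope U"
  shows "bounded U"
proof -
  have "compact (closure U)"
    using assms polytopal_set_compact unfolding lipschitz_polytope_def by blast
  from bounded_subset[OF compact_imp_bounded[OF this] closure_subset] show ?thesis .
qed

lemma lipschitz_polytope_nonempty:
  fixes U :: "(real^'d) set"
  assumes "lipschitz_polytope U"
  shows "U \<noteq> {}"
proof -
  have "closure U \<noteq> {}"
    using assms unfolding lipschitz_polytope_def by (intro polytopal_set_nonempty) auto
  then show ?thesis by auto
qed

lemma elem_nonempty: "K \<in> elems M \<Longrightarrow> K \<noteq> {}"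
  using meshD(3) lipschitz_polytope_nonempty by blast

lemma elems_nonempty: "elems M \<noteq> {}"
proof
  assume "elems M = {}"
  then have "closure \<Omega> = {}" using meshD(5) by simp
  then show False using lipschitz_polytope_nonempty[OF domain] by simp
qed

lemma elem_subset_domain:
  assumes "K \<in> elems M"
  shows "K \<subseteq> \<Omega>"
proof (rule lipschitz_domain_absorbs_open[OF _ elem_open[OF assms]])
  show "lipschitz_domain \<Omega>" using domain by (simp add: lipschitz_polytope_def)
  show "K \<subseteq> closure \<Omega>" unfolding meshD(5) using closure_subset[of K] assms by blast
qed

definition nsign :: "(real^'d) set \<Rightarrow> (real^'d) set \<Rightarrow> real" where
  "nsign K e = (if K = Kplus M e then 1 else - 1)"

lemma flat_faced_elem:
  assumes K: "K \<in> elems M"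
  shows "flat_faced_domain K {e \<in> faces M. e \<subseteq> frontier K} (nrm M) (nsign K)"
proof
  show "open K" "bounded K" using K elem_open meshD(3) lipschitz_polytope_bounded by auto
  show "finite {e \<in> faces M. e \<subseteq> frontier K}" using meshD(2) by simp
  show "frontier K = \<Union>{e \<in> faces M. e \<subseteq> frontier K}" using meshD(7)[OF K] .
  fix e assume "e \<in> {e \<in> faces M. e \<subseteq> frontier K}"
  then have e: "e \<in> faces M" "K \<in> adjacent_elems M e" using K by (auto simp: adjacent_elems_def)
  show "polytopal_set (int CARD('d) - 1) e" using meshD(6)[OF e(1)] .
  show "outward_unit_normal K e (nsign K e *\<^sub>R nrm M e)"
    using e(1)
  proof (cases rule: face_cases)
    case 1
    then show ?thesis
      using e(2) interior_faceD[OF 1(1)] by (auto simp: nsign_def)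
  next
    case 2
    then show ?thesis using e(2) boundary_faceD[OF 2] by (auto simp: nsign_def)
  qed
next
  show "pairwise (\<lambda>e e'. rel_interior e \<inter> rel_interior e' = {}) {e \<in> faces M. e \<subseteq> frontier K}"
    using meshD(8) by (rule pairwise_subset) auto
qed (simp add: nsign_def)

lemma Kplus_elem:
  assumes "e \<in> faces M"
  shows "Kplus M e \<in> elems M \<and> e \<subseteq> frontier (Kplus M e)"
proof -
  have "Kplus M e \<in> adjacent_elems M e"
    using assms by (cases rule: face_cases) (simp_all add: interior_faceD(2) boundary_faceD(1))
  then show ?thesis by (simp add: adjacent_elems_def)
qed

lemma Kminus_elem:
  assumes "e \<in> interior_faces \<Omega> M"
  shows "Kminus M e \<in> elems M \<and> e \<subseteq> frontier (Kminus M e)"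
proof -
  have "Kminus M e \<in> adjacent_elems M e" by (simp add: interior_faceD(2)[OF assms])
  then show ?thesis by (simp add: adjacent_elems_def)
qed

lemma elem_integrable: "K \<in> elems M \<Longrightarrow> continuous_integrable lborel K"
  using flat_faced_domain.integrable_indicator_continuous[OF flat_faced_elem]
  by (simp add: continuous_integrable_def)

lemma norm_nrm:
  assumes "e \<in> faces M"
  shows "norm (nrm M e) = 1"
  using flat_faced_domain.norm_nu[OF flat_faced_elem, of "Kplus M e" e] Kplus_elem[OF assms] assms
  by simp

lemma face_integrable:
  assumes e: "e \<in> faces M"
  shows "continuous_integrable (face_measure M e) e"
  unfolding continuous_integrable_def face_measure_def
  using polytopal_set_compact[OF meshD(6)[OF e]] norm_nrm[OF e]
  by (auto intro: integrable_hyperplane_measure_compact)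

lemma face_measure_pos:
  assumes e: "e \<in> faces M"
  shows "0 < ip (face_measure M e) e (\<lambda>x. 1) (\<lambda>x. 1)"
proof -
  interpret K: flat_faced_domain "Kplus M e" "{e' \<in> faces M. e' \<subseteq> frontier (Kplus M e)}" "nrm M" "nsign (Kplus M e)"
    by (rule flat_faced_elem[OF conjunct1[OF Kplus_elem[OF e]]])
  have mem: "e \<in> {e' \<in> faces M. e' \<subseteq> frontier (Kplus M e)}" using e Kplus_elem by blast
  have fm: "face_measure M e = hyperplane_measure (nrm M e) (K.offset e)"
    by (simp add: face_measure_def K.offset_def)
  have "0 < emeasure (face_measure M e) e"
    unfolding fm using norm_nrm[OF e] K.face_plane[OF mem] meshD(6)[OF e]
    by (intro emeasure_flat_polytopal_set_pos) auto
  moreover have "integrable (face_measure M e) (\<lambda>x. indicator e x * (1 :: real))"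
    using face_integrable[OF e, unfolded continuous_integrable_def, THEN spec[of _ "\<lambda>x. 1"]] by simp
  then have "emeasure (face_measure M e) e < \<infinity>"
    using borel_compact[OF polytopal_set_compact[OF meshD(6)[OF e]]]
    by (simp add: integrable_indicator_iff fm)
  ultimately have "0 < measure (face_measure M e) e"
    by (simp add: measure_def enn2real_positive_iff)
  then show ?thesis
    by (simp add: ip_def fm)
qed

lemma Vh_poly: "v \<in> V \<Longrightarrow> K \<in> elems M \<Longrightarrow> \<exists>q\<in>polys p. \<forall>x\<in>K. v x = q x"
  unfolding Vh_def by blast

lemma Vh_outside: "v \<in> V \<Longrightarrow> x \<notin> \<Union>(elems M) \<Longrightarrow> v x = 0"
  unfolding Vh_def by blast

lemma Vh_lincomb:
  assumes "u \<in> V" "v \<in> V"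
  shows "(\<lambda>x. a * u x + b * v x) \<in> V"
proof -
  have "\<exists>q\<in>polys p. \<forall>x\<in>K. a * u x + b * v x = q x" if K: "K \<in> elems M" for K
  proof -
    obtain q where q: "q \<in> polys p" "\<And>x. x \<in> K \<Longrightarrow> u x = q x" using Vh_poly[OF assms(1) K] by blast
    obtain r where r: "r \<in> polys p" "\<And>x. x \<in> K \<Longrightarrow> v x = r x" using Vh_poly[OF assms(2) K] by blast
    show ?thesis using polys_lincomb[OF q(1) r(1), of a b] q(2) r(2) by (intro bexI) auto
  qed
  moreover have "a * u x + b * v x = 0" if "x \<notin> \<Union>(elems M)" for x
    using Vh_outside[OF assms(1) that] Vh_outside[OF assms(2) that] by simp
  ultimately show ?thesis unfolding Vh_def by simp
qed

section \<open>Gluing polynomial pieces, a finite spanning set, and traces\<close>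

lemma elem_unique: "K \<in> elems M \<Longrightarrow> K' \<in> elems M \<Longrightarrow> x \<in> K \<Longrightarrow> x \<in> K' \<Longrightarrow> K = K'"
  using meshD(4) by (auto simp: pairwise_def disjnt_def)

text \<open>Disjointness of the elements leaves at most one nonzero summand, and off the elements
  the sum has the value 0 that \<open>Vh\<close> prescribes.\<close>

definition glue :: "((real^'d) set \<Rightarrow> real^'d \<Rightarrow> real) \<Rightarrow> real^'d \<Rightarrow> real" where
  "glue Q x = (\<Sum>K\<in>elems M. indicator K x * Q K x)"

lemma glue_eq: "K \<in> elems M \<Longrightarrow> x \<in> K \<Longrightarrow> glue Q x = Q K x"
proof -
  assume K: "K \<in> elems M" "x \<in> K"
  have "glue Q x = (\<Sum>K'\<in>elems M. if K' = K then Q K x else 0)"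
    unfolding glue_def using K elem_unique by (intro sum.cong) (auto simp: indicator_def)
  then show ?thesis using K meshD(1) by simp
qed

lemma glue_in:
  assumes "\<And>K. K \<in> elems M \<Longrightarrow> Q K \<in> polys p"
  shows "glue Q \<in> V"
proof -
  have "\<exists>q\<in>polys p. \<forall>x\<in>K. glue Q x = q x" if "K \<in> elems M" for K
    using assms[OF that] glue_eq[OF that] by (intro bexI[of _ "Q K"]) auto
  moreover have "glue Q x = 0" if "x \<notin> \<Union>(elems M)" for x
    unfolding glue_def using that by (intro sum.neutral) auto
  ultimately show ?thesis unfolding Vh_def by simp
qed

lemma Vh_eq_glue: "v \<in> V \<Longrightarrow> (\<And>K x. K \<in> elems M \<Longrightarrow> x \<in> K \<Longrightarrow> v x = Q K x) \<Longrightarrow> v = glue Q"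
proof
  fix x assume v: "v \<in> V" "\<And>K x. K \<in> elems M \<Longrightarrow> x \<in> K \<Longrightarrow> v x = Q K x"
  show "v x = glue Q x"
  proof (cases "x \<in> \<Union>(elems M)")
    case True
    then show ?thesis using v(2) glue_eq by auto
  next
    case False
    then show ?thesis using Vh_outside[OF v(1)] by (auto simp: glue_def indicator_def)
  qed
qed

definition basis :: "(real^'d \<Rightarrow> real) set" where
  "basis = (\<lambda>(K, \<alpha>) x. indicator K x * monomial \<alpha> x) ` (elems M \<times> multi_indices p)"

lemma finite_basis: "finite basis"
  unfolding basis_def by (intro finite_imageI finite_cartesian_product meshD(1) finite_multi_indices)

lemma Vh_eq_span: "V = fs.span basis"
proof
  show "V \<subseteq> fs.span basis"
  proof
    fix v assume v: "v \<in> V"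
    have "\<forall>K\<in>elems M. \<exists>c. \<forall>x\<in>K. v x = (\<Sum>\<alpha>\<in>multi_indices p. c \<alpha> * monomial \<alpha> x)"
    proof
      fix K assume "K \<in> elems M"
      then obtain q where "q \<in> polys p" "\<forall>x\<in>K. v x = q x" using Vh_poly[OF v] by blast
      then show "\<exists>c. \<forall>x\<in>K. v x = (\<Sum>\<alpha>\<in>multi_indices p. c \<alpha> * monomial \<alpha> x)"
        unfolding polys_iff by auto
    qed
    from bchoice[OF this] obtain c where
      c: "\<And>K x. K \<in> elems M \<Longrightarrow> x \<in> K \<Longrightarrow> v x = (\<Sum>\<alpha>\<in>multi_indices p. c K \<alpha> * monomial \<alpha> x)"
      by auto
    let ?f = "\<lambda>(K, \<alpha>) x. indicator K x * monomial \<alpha> x"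
    have "v = glue (\<lambda>K x. \<Sum>\<alpha>\<in>multi_indices p. c K \<alpha> * monomial \<alpha> x)"
      by (rule Vh_eq_glue[OF v c])
    also have "\<dots> = (\<lambda>x. \<Sum>k\<in>elems M \<times> multi_indices p. c (fst k) (snd k) * ?f k x)"
      unfolding glue_def[abs_def] sum_distrib_left sum.cartesian_product
      by (simp add: case_prod_beta mult.left_commute)
    also have "\<dots> \<in> fs.span basis"
      using meshD(1) finite_multi_indices
      by (intro span_sum_fun) (auto simp: basis_def intro!: fs.span_base)
    finally show "v \<in> fs.span basis" .
  qed
  show "fs.span basis \<subseteq> V"
  proof (rule fs.span_minimal)
    show "basis \<subseteq> V"
    proof
      fix b assume "b \<in> basis"
      then obtain K \<alpha> where K: "K \<in> elems M" "\<alpha> \<in> multi_indices p" "b = (\<lambda>x. indicator K x * monomial \<alpha> x)"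
        by (auto simp: basis_def)
      have "b = glue (\<lambda>K' x. if K' = K then monomial \<alpha> x else 0)"
        using K meshD(1) by (simp add: glue_def fun_eq_iff if_distrib[of "\<lambda>c. _ * c"] cong: if_cong)
      also have "\<dots> \<in> V"
      proof (rule glue_in)
        fix K' show "(\<lambda>x. if K' = K then monomial \<alpha> x else 0) \<in> polys p"
          using monomial_in_polys[OF K(2)] polys_zero by (cases "K' = K") auto
      qed
      finally show "b \<in> V" .
    qed
    show "fs.subspace V"
    proof (rule fs.subspaceI)
      show "0 \<in> V" using polys_zero[of p] by (auto simp: Vh_def intro!: bexI[of _ "\<lambda>x. 0"])
      fix u v :: "real^'d \<Rightarrow> real" and c assume "u \<in> V" "v \<in> V"
      then show "u + v \<in> V" "(\<lambda>x. c * u x) \<in> V"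
        using Vh_lincomb[of u v 1 1] Vh_lincomb[of u u c 0] by (simp_all add: plus_fun_def)
    qed
  qed
qed

lemma agrees_elem:
  assumes "v \<in> V" "K \<in> elems M"
  shows "agrees_cont K v" "agrees_cont K (\<lambda>x. \<omega> \<bullet> grad v x)"
    "\<And>e. e \<subseteq> frontier K \<Longrightarrow> agrees_cont e (trace_from K v)"
proof -
  obtain q where q: "q \<in> polys p" "\<And>x. x \<in> K \<Longrightarrow> v x = q x" using Vh_poly[OF assms] by blast
  show "agrees_cont K v" using polys_continuous[OF q(1)] q(2) by (rule agrees_contI)
  show "agrees_cont K (\<lambda>x. \<omega> \<bullet> grad v x)"
  proof (rule agrees_contI)
    show "continuous_on UNIV (\<lambda>x. \<omega> \<bullet> grad q x)"
      using polys_continuous[OF polys_grad(2)[OF q(1)]] .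
    fix x assume "x \<in> K"
    then have "grad v x = grad q x"
      by (rule grad_cong_open[OF elem_open[OF assms(2)] _ q(2) differentiableI[OF polys_grad(1)[OF q(1)]]])
    then show "\<omega> \<bullet> grad v x = \<omega> \<bullet> grad q x" by simp
  qed
  show "agrees_cont e (trace_from K v)" if "e \<subseteq> frontier K" for e
    using that polys_continuous[OF q(1)] trace_from_eq[OF elem_open[OF assms(2)] _ polys_continuous[OF q(1)] q(2)]
    by (intro agrees_contI[of q]) auto
qed

lemma grad_lincomb:
  assumes "u \<in> V" "v \<in> V" "K \<in> elems M" "x \<in> K"
  shows "\<omega> \<bullet> grad (\<lambda>x. a * u x + b * v x) x = a * (\<omega> \<bullet> grad u x) + b * (\<omega> \<bullet> grad v x)"
proof -
  obtain q where q: "q \<in> polys p" "\<And>x. x \<in> K \<Longrightarrow> u x = q x" using Vh_poly[OF assms(1,3)] by blast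
  obtain r where r: "r \<in> polys p" "\<And>x. x \<in> K \<Longrightarrow> v x = r x" using Vh_poly[OF assms(2,3)] by blast
  have d: "f differentiable (at x)" if "f \<in> polys p" for f
    using polys_grad(1)[OF that] by (rule differentiableI)
  have "((\<lambda>x. a * q x + b * r x) has_derivative (\<lambda>h. a * (grad q x \<bullet> h) + b * (grad r x \<bullet> h))) (at x)"
    by (intro has_derivative_add has_derivative_mult_right polys_grad(1)[OF q(1)] polys_grad(1)[OF r(1)])
  then have "grad (\<lambda>x. a * q x + b * r x) x = a *\<^sub>R grad q x + b *\<^sub>R grad r x"
    by (intro trans[OF grad_eqI[of _ "\<lambda>i. (a *\<^sub>R grad q x + b *\<^sub>R grad r x) $ i"]])
       (auto simp: inner_vec_def vec_eq_iff sum_distrib_left sum.distrib algebra_simps)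
  moreover have "grad u x = grad q x"
    by (rule grad_cong_open[OF elem_open[OF assms(3)] assms(4) q(2) d[OF q(1)]])
  moreover have "grad v x = grad r x"
    by (rule grad_cong_open[OF elem_open[OF assms(3)] assms(4) r(2) d[OF r(1)]])
  moreover have "grad (\<lambda>x. a * u x + b * v x) x = grad (\<lambda>x. a * q x + b * r x) x"
    using q(2) r(2) by (intro grad_cong_open[OF elem_open[OF assms(3)] assms(4)] d polys_lincomb q(1) r(1)) simp
  ultimately show ?thesis by (simp add: inner_add_right)
qed

lemma trace_lincomb:
  assumes "u \<in> V" "v \<in> V" "K \<in> elems M" "x \<in> frontier K"
  shows "trace_from K (\<lambda>x. a * u x + b * v x) x = a * trace_from K u x + b * trace_from K v x"
proof -
  obtain q where q: "q \<in> polys p" "\<And>x. x \<in> K \<Longrightarrow> u x = q x" using Vh_poly[OF assms(1,3)] by blast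
  obtain r where r: "r \<in> polys p" "\<And>x. x \<in> K \<Longrightarrow> v x = r x" using Vh_poly[OF assms(2,3)] by blast
  note tr = trace_from_eq[OF elem_open[OF assms(3)] assms(4)]
  show ?thesis
    using tr[OF polys_continuous[OF q(1)] q(2)] tr[OF polys_continuous[OF r(1)] r(2)]
      tr[OF polys_continuous[OF polys_lincomb[OF q(1) r(1)]], of "\<lambda>x. a * u x + b * v x" a b] q(2) r(2)
    by simp
qed

lemma agrees_trace:
  assumes "v \<in> V" "e \<in> faces M"
  shows "agrees_cont e (trace_plus M e v)" "agrees_cont e (trace_minus \<Omega> M e v)"
    "agrees_cont e (upwind \<Omega> M \<omega> e v)" "agrees_cont e (jump \<Omega> M e v)"
proof -
  show p: "agrees_cont e (trace_plus M e v)"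
    unfolding trace_plus_def using Kplus_elem[OF assms(2)] assms by (intro agrees_elem) auto
  show m: "agrees_cont e (trace_minus \<Omega> M e v)"
    using assms(2)
  proof (cases rule: face_cases)
    case 1
    then show ?thesis
      unfolding trace_minus_def using Kminus_elem[OF 1(1)] assms by (auto intro: agrees_elem)
  next
    case 2
    then show ?thesis unfolding trace_minus_def by (simp add: agrees_cont_intros)
  qed
  show "agrees_cont e (upwind \<Omega> M \<omega> e v)" using p m by (simp add: upwind_def)
  show "agrees_cont e (jump \<Omega> M e v)"
    unfolding jump_def[abs_def] by (intro agrees_cont_intros p m)
qed

lemma face_trace_lincomb:
  assumes "u \<in> V" "v \<in> V" "e \<in> faces M" "x \<in> e"
  shows "trace_plus M e (\<lambda>x. a * u x + b * v x) x = a * trace_plus M e u x + b * trace_plus M e v x"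
    "trace_minus \<Omega> M e (\<lambda>x. a * u x + b * v x) x = a * trace_minus \<Omega> M e u x + b * trace_minus \<Omega> M e v x"
    "upwind \<Omega> M \<omega> e (\<lambda>x. a * u x + b * v x) x = a * upwind \<Omega> M \<omega> e u x + b * upwind \<Omega> M \<omega> e v x"
    "jump \<Omega> M e (\<lambda>x. a * u x + b * v x) x = a * jump \<Omega> M e u x + b * jump \<Omega> M e v x"
proof -
  show p: "trace_plus M e (\<lambda>x. a * u x + b * v x) x = a * trace_plus M e u x + b * trace_plus M e v x"
    unfolding trace_plus_def using Kplus_elem[OF assms(3)] assms by (intro trace_lincomb) auto
  show m: "trace_minus \<Omega> M e (\<lambda>x. a * u x + b * v x) x = a * trace_minus \<Omega> M e u x + b * trace_minus \<Omega> M e v x"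
    using assms(3)
  proof (cases rule: face_cases)
    case 1
    then show ?thesis
      unfolding trace_minus_def using Kminus_elem[OF 1(1)] assms
      by (simp del: mult_cancel_left) (intro trace_lincomb; auto)
  next
    case 2
    then show ?thesis unfolding trace_minus_def by simp
  qed
  show "upwind \<Omega> M \<omega> e (\<lambda>x. a * u x + b * v x) x = a * upwind \<Omega> M \<omega> e u x + b * upwind \<Omega> M \<omega> e v x"
    using p m by (simp add: upwind_def)
  show "jump \<Omega> M e (\<lambda>x. a * u x + b * v x) x = a * jump \<Omega> M e u x + b * jump \<Omega> M e v x"
    using p m by (simp add: jump_def algebra_simps)
qed

text \<open>The representative \<open>v\<close> is 0 off the elements and every element lies in the
  domain, so the integrands agree at every point and the faces need no null set argument.\<close>

lemma inner_L2_domain: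
  assumes "v \<in> V" "\<And>K. K \<in> elems M \<Longrightarrow> agrees_cont K u"
  shows "inner_L2 \<Omega> u v = (\<Sum>K\<in>elems M. ip lborel K u v)"
proof -
  have "indicator \<Omega> x * (u x * v x) = (\<Sum>K\<in>elems M. indicator K x * (u x * v x))" for x
  proof (cases "x \<in> \<Union>(elems M)")
    case True
    then obtain K where K: "K \<in> elems M" "x \<in> K" by blast
    have "(\<Sum>K\<in>elems M. indicator K x * (u x * v x)) = u x * v x"
      using glue_eq[OF K, of "\<lambda>_ x. u x * v x"] by (simp add: glue_def)
    moreover have "x \<in> \<Omega>" using elem_subset_domain[OF K(1)] K(2) by blast
    ultimately show ?thesis by simp
  next
    case False
    then show ?thesis using Vh_outside[OF assms(1)] by simp
  qed
  then show ?thesis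
    unfolding inner_L2_ip ip_def
    using ip_integrable[OF elem_integrable assms(2) agrees_elem(1)[OF assms(1)]]
    by (simp add: Bochner_Integration.integral_sum)
qed

end

section \<open>The transport form\<close>

context transport_mesh
begin

abbreviation fip :: "(real^'d) set \<Rightarrow> (real^'d \<Rightarrow> real) \<Rightarrow> (real^'d \<Rightarrow> real) \<Rightarrow> real" where
  "fip e \<equiv> ip (face_measure M e) e"

abbreviation mesh_ip :: "(real^'d \<Rightarrow> real) \<Rightarrow> (real^'d \<Rightarrow> real) \<Rightarrow> real" where
  "mesh_ip u v \<equiv> (\<Sum>K\<in>elems M. ip lborel K u v)"

lemma jump_diff: "jump \<Omega> M e v = (\<lambda>x. trace_plus M e v x - trace_minus \<Omega> M e v x)"
  by (simp add: jump_def fun_eq_iff)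

lemma inner_L2_scaled:
  assumes "u \<in> V" "v \<in> V"
  shows "inner_L2 \<Omega> (\<lambda>x. c * u x) v = c * mesh_ip u v"
proof -
  have "inner_L2 \<Omega> (\<lambda>x. c * u x) v = mesh_ip (\<lambda>x. c * u x) v"
    using assms by (intro inner_L2_domain agrees_cont_intros agrees_elem)
  then show ?thesis by (simp add: ip_scale sum_distrib_left)
qed

lemma m_t_eq: "u \<in> V \<Longrightarrow> v \<in> V \<Longrightarrow> m_t \<Omega> st u v = st * mesh_ip u v"
  unfolding m_t_def by (rule inner_L2_scaled)

lemma transport_form_eq:
  assumes "u \<in> V" "v \<in> V"
  shows "transport_form \<Omega> M st \<epsilon> \<omega> u v =
    - (\<Sum>K\<in>elems M. ip lborel K u (\<lambda>x. \<omega> \<bullet> grad v x))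
    + (\<Sum>e\<in>faces M. (\<omega> \<bullet> nrm M e) * fip e (upwind \<Omega> M \<omega> e u) (jump \<Omega> M e v))
    + st / \<epsilon> * mesh_ip u v"
  unfolding transport_form_def inner_L2_scaled[OF assms] unfolding inner_L2_ip inner_face_ip ip_scale sigma_t_def ..

lemma ip_lincomb_V:
  assumes "u \<in> V" "v \<in> V" "z \<in> V" "K \<in> elems M"
  shows "ip lborel K (\<lambda>x. a * u x + b * v x) z = a * ip lborel K u z + b * ip lborel K v z"
    and "ip lborel K z (\<lambda>x. a * u x + b * v x) = a * ip lborel K z u + b * ip lborel K z v"
    and "ip lborel K (\<lambda>x. a * u x + b * v x) (\<lambda>x. \<omega> \<bullet> grad z x) =
      a * ip lborel K u (\<lambda>x. \<omega> \<bullet> grad z x) + b * ip lborel K v (\<lambda>x. \<omega> \<bullet> grad z x)"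
    and "ip lborel K z (\<lambda>x. \<omega> \<bullet> grad (\<lambda>x. a * u x + b * v x) x) =
      a * ip lborel K z (\<lambda>x. \<omega> \<bullet> grad u x) + b * ip lborel K z (\<lambda>x. \<omega> \<bullet> grad v x)"
proof -
  note ag = agrees_elem(1)[OF assms(1,4)] agrees_elem(1)[OF assms(2,4)] agrees_elem(1)[OF assms(3,4)]
  note lin = ip_lincomb[OF elem_integrable[OF assms(4)]]
  show "ip lborel K (\<lambda>x. a * u x + b * v x) z = a * ip lborel K u z + b * ip lborel K v z"
    "ip lborel K z (\<lambda>x. a * u x + b * v x) = a * ip lborel K z u + b * ip lborel K z v"
    by (rule lin[OF ag])+
  show "ip lborel K (\<lambda>x. a * u x + b * v x) (\<lambda>x. \<omega> \<bullet> grad z x) =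
      a * ip lborel K u (\<lambda>x. \<omega> \<bullet> grad z x) + b * ip lborel K v (\<lambda>x. \<omega> \<bullet> grad z x)"
    by (rule lin(1)[OF ag(1,2) agrees_elem(2)[OF assms(3,4)]])
  have "ip lborel K z (\<lambda>x. \<omega> \<bullet> grad (\<lambda>x. a * u x + b * v x) x) =
      ip lborel K z (\<lambda>x. a * (\<omega> \<bullet> grad u x) + b * (\<omega> \<bullet> grad v x))"
    by (rule ip_cong) (simp_all add: grad_lincomb[OF assms(1,2,4)])
  also have "\<dots> = a * ip lborel K z (\<lambda>x. \<omega> \<bullet> grad u x) + b * ip lborel K z (\<lambda>x. \<omega> \<bullet> grad v x)"
    by (rule lin(2)[OF agrees_elem(2)[OF assms(1,4)] agrees_elem(2)[OF assms(2,4)] ag(3)])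
  finally show "ip lborel K z (\<lambda>x. \<omega> \<bullet> grad (\<lambda>x. a * u x + b * v x) x) =
      a * ip lborel K z (\<lambda>x. \<omega> \<bullet> grad u x) + b * ip lborel K z (\<lambda>x. \<omega> \<bullet> grad v x)" .
qed

lemma fip_lincomb:
  assumes "u \<in> V" "v \<in> V" "z \<in> V" "e \<in> faces M"
  shows "fip e (upwind \<Omega> M \<omega> e (\<lambda>x. a * u x + b * v x)) (jump \<Omega> M e z) =
      a * fip e (upwind \<Omega> M \<omega> e u) (jump \<Omega> M e z) + b * fip e (upwind \<Omega> M \<omega> e v) (jump \<Omega> M e z)"
    and "fip e (upwind \<Omega> M \<omega> e z) (jump \<Omega> M e (\<lambda>x. a * u x + b * v x)) =
      a * fip e (upwind \<Omega> M \<omega> e z) (jump \<Omega> M e u) + b * fip e (upwind \<Omega> M \<omega> e z) (jump \<Omega> M e v)"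
proof -
  note lin = ip_lincomb[OF face_integrable[OF assms(4)]]
  note ag = agrees_trace[OF assms(1,4)] agrees_trace[OF assms(2,4)] agrees_trace[OF assms(3,4)]
  note tr = face_trace_lincomb[OF assms(1,2,4)]
  have "fip e (upwind \<Omega> M \<omega> e (\<lambda>x. a * u x + b * v x)) (jump \<Omega> M e z) =
      fip e (\<lambda>x. a * upwind \<Omega> M \<omega> e u x + b * upwind \<Omega> M \<omega> e v x) (jump \<Omega> M e z)"
    by (rule ip_cong) (simp_all add: tr)
  then show "fip e (upwind \<Omega> M \<omega> e (\<lambda>x. a * u x + b * v x)) (jump \<Omega> M e z) =
      a * fip e (upwind \<Omega> M \<omega> e u) (jump \<Omega> M e z) + b * fip e (upwind \<Omega> M \<omega> e v) (jump \<Omega> M e z)"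
    using lin(1)[OF ag(3) ag(7) ag(12)] by simp
  have "fip e (upwind \<Omega> M \<omega> e z) (jump \<Omega> M e (\<lambda>x. a * u x + b * v x)) =
      fip e (upwind \<Omega> M \<omega> e z) (\<lambda>x. a * jump \<Omega> M e u x + b * jump \<Omega> M e v x)"
    by (rule ip_cong) (simp_all add: tr)
  then show "fip e (upwind \<Omega> M \<omega> e z) (jump \<Omega> M e (\<lambda>x. a * u x + b * v x)) =
      a * fip e (upwind \<Omega> M \<omega> e z) (jump \<Omega> M e u) + b * fip e (upwind \<Omega> M \<omega> e z) (jump \<Omega> M e v)"
    using lin(2)[OF ag(4) ag(8) ag(11)] by simp
qed

lemma transport_form_bilinear: "bilinear_form_on V (transport_form \<Omega> M st \<epsilon> \<omega>)"
  unfolding bilinear_form_on_def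
proof (intro ballI allI)
  fix u v z a b assume V: "u \<in> V" "v \<in> V" "z \<in> V"
  have uv: "(\<lambda>x. a * u x + b * v x) \<in> V" by (rule Vh_lincomb[OF V(1,2)])
  have 1: "transport_form \<Omega> M st \<epsilon> \<omega> (\<lambda>x. a * u x + b * v x) z =
      a * transport_form \<Omega> M st \<epsilon> \<omega> u z + b * transport_form \<Omega> M st \<epsilon> \<omega> v z"
    unfolding transport_form_eq[OF uv V(3)] transport_form_eq[OF V(1,3)] transport_form_eq[OF V(2,3)]
    by (simp add: ip_lincomb_V(1,3)[OF V] fip_lincomb(1)[OF V] sum.distrib sum_distrib_left algebra_simps
        cong: sum.cong)
  have 2: "transport_form \<Omega> M st \<epsilon> \<omega> z (\<lambda>x. a * u x + b * v x) =
      a * transport_form \<Omega> M st \<epsilon> \<omega> z u + b * transport_form \<Omega> M st \<epsilon> \<omega> z v"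
    unfolding transport_form_eq[OF V(3) uv] transport_form_eq[OF V(3,1)] transport_form_eq[OF V(3,2)]
    by (simp add: ip_lincomb_V(2,4)[OF V] fip_lincomb(2)[OF V] sum.distrib sum_distrib_left algebra_simps
        cong: sum.cong)
  show "transport_form \<Omega> M st \<epsilon> \<omega> (\<lambda>x. a * u x + b * v x) z =
      a * transport_form \<Omega> M st \<epsilon> \<omega> u z + b * transport_form \<Omega> M st \<epsilon> \<omega> v z \<and>
      transport_form \<Omega> M st \<epsilon> \<omega> z (\<lambda>x. a * u x + b * v x) =
      a * transport_form \<Omega> M st \<epsilon> \<omega> z u + b * transport_form \<Omega> M st \<epsilon> \<omega> z v"
    using 1 2 by blast
qed

lemma elem_L2_zero:
  assumes "K \<in> elems M" "q \<in> polys p" "ip lborel K q q = 0" "x \<in> K"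
  shows "q x = 0"
proof (rule continuous_zero_of_L2_zero[OF elem_open[OF assms(1)] polys_continuous[OF assms(2)] _ _ assms(4)])
  have "agrees_cont K q" using polys_continuous[OF assms(2)] by (rule agrees_contI) simp
  then show "integrable lborel (\<lambda>x. indicator K x * (q x * q x))"
    by (intro ip_integrable elem_integrable assms)
  show "(\<integral>x. indicator K x * (q x * q x) \<partial>lborel) = 0" using assms(3) by (simp add: ip_def)
qed

lemma mesh_ip_nonneg: "0 \<le> mesh_ip u u"
  by (intro sum_nonneg ip_nonneg)

lemma mesh_ip_zero:
  assumes "v \<in> V" "mesh_ip v v = 0"
  shows "v = (\<lambda>x. 0)"
proof
  fix x
  show "v x = 0"
  proof (cases "x \<in> \<Union>(elems M)")
    case True
    then obtain K where K: "K \<in> elems M" "x \<in> K" by blast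
    obtain q where q: "q \<in> polys p" "\<And>x. x \<in> K \<Longrightarrow> v x = q x" using Vh_poly[OF assms(1) K(1)] by blast
    have "\<forall>K\<in>elems M. ip lborel K v v = 0"
      using assms(2) by (subst (asm) sum_nonneg_eq_0_iff[OF meshD(1)]) (auto intro: ip_nonneg)
    then have "ip lborel K v v = 0" using K(1) by blast
    moreover have "ip lborel K v v = ip lborel K q q" by (rule ip_cong) (simp_all add: q(2))
    ultimately have "ip lborel K q q = 0" by simp
    then show ?thesis using elem_L2_zero[OF K(1) q(1) _ K(2)] q(2)[OF K(2)] by simp
  next
    case False
    then show ?thesis using Vh_outside[OF assms(1)] by simp
  qed
qed

lemma m_t_spd: "spd_form_on V (m_t \<Omega> st)"
  unfolding spd_form_on_def bilinear_form_on_def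
proof (intro conjI ballI allI impI)
  fix u v z :: "real^'d \<Rightarrow> real" and r s :: real assume V: "u \<in> V" "v \<in> V" "z \<in> V"
  have uv: "(\<lambda>x. r * u x + s * v x) \<in> V" by (rule Vh_lincomb[OF V(1,2)])
  show "m_t \<Omega> st (\<lambda>x. r * u x + s * v x) z = r * m_t \<Omega> st u z + s * m_t \<Omega> st v z"
    unfolding m_t_eq[OF uv V(3)] m_t_eq[OF V(1,3)] m_t_eq[OF V(2,3)]
    by (simp add: ip_lincomb_V[OF V] sum.distrib sum_distrib_left algebra_simps cong: sum.cong)
  show "m_t \<Omega> st z (\<lambda>x. r * u x + s * v x) = r * m_t \<Omega> st z u + s * m_t \<Omega> st z v"
    unfolding m_t_eq[OF V(3) uv] m_t_eq[OF V(3,1)] m_t_eq[OF V(3,2)]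
    by (simp add: ip_lincomb_V[OF V] sum.distrib sum_distrib_left algebra_simps cong: sum.cong)
next
  fix u v assume "u \<in> V" "v \<in> V"
  then show "m_t \<Omega> st u v = m_t \<Omega> st v u" by (simp add: m_t_eq ip_commute[of _ _ v u])
next
  fix v assume "v \<in> V" "v \<noteq> (\<lambda>x. 0)"
  then show "0 < m_t \<Omega> st v v"
    using mesh_ip_zero[of v] mesh_ip_nonneg[of v] st by (auto simp: m_t_eq order_less_le)
qed

text \<open>Green's formula for the product of the two polynomial representatives; the product rule
  splits its gradient into the two volume terms.\<close>

lemma elem_green:
  assumes K: "K \<in> elems M" and V: "u \<in> V" "v \<in> V" and \<omega>: "norm \<omega> = 1"
  shows "ip lborel K u (\<lambda>x. \<omega> \<bullet> grad v x) + ip lborel K v (\<lambda>x. \<omega> \<bullet> grad u x) =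
    (\<Sum>e | e \<in> faces M \<and> e \<subseteq> frontier K. nsign K e * (nrm M e \<bullet> \<omega>) * fip e (trace_from K u) (trace_from K v))"
proof -
  interpret flat_faced_domain K "{e \<in> faces M. e \<subseteq> frontier K}" "nrm M" "nsign K"
    by (rule flat_faced_elem[OF K])
  obtain q where q: "q \<in> polys p" "\<And>x. x \<in> K \<Longrightarrow> u x = q x" using Vh_poly[OF V(1) K] by blast
  obtain r where r: "r \<in> polys p" "\<And>x. x \<in> K \<Longrightarrow> v x = r x" using Vh_poly[OF V(2) K] by blast
  define G where "G = (\<lambda>x. q x *\<^sub>R grad r x + r x *\<^sub>R grad q x)"
  have dF: "((\<lambda>x. q x * r x) has_derivative (\<lambda>h. G y \<bullet> h)) (at y)" for y
    by (rule has_derivative_eq_rhs[OF has_derivative_mult[OF polys_grad(1)[OF q(1)] polys_grad(1)[OF r(1)]]])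
       (auto simp: G_def inner_add_left)
  have cG: "continuous_on UNIV G"
    unfolding G_def
    by (intro continuous_intros polys_continuous[OF q(1)] polys_continuous[OF r(1)] polys_grad(3)[OF q(1)] polys_grad(3)[OF r(1)])
  have gu: "grad u x = grad q x" if "x \<in> K" for x
    by (rule grad_cong_open[OF open_K that q(2) differentiableI[OF polys_grad(1)[OF q(1)]]])
  have gv: "grad v x = grad r x" if "x \<in> K" for x
    by (rule grad_cong_open[OF open_K that r(2) differentiableI[OF polys_grad(1)[OF r(1)]]])
  have "ip lborel K u (\<lambda>x. \<omega> \<bullet> grad v x) + ip lborel K v (\<lambda>x. \<omega> \<bullet> grad u x) =
      (\<integral>x. indicator K x * (u x * (\<omega> \<bullet> grad v x)) + indicator K x * (v x * (\<omega> \<bullet> grad u x)) \<partial>lborel)"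
    unfolding ip_def
    by (intro Bochner_Integration.integral_add[symmetric] ip_integrable elem_integrable agrees_elem K V)
  also have "\<dots> = (\<integral>x. indicator K x * (G x \<bullet> \<omega>) \<partial>lborel)"
    by (rule Bochner_Integration.integral_cong)
       (auto simp: indicator_def G_def gu gv q(2) r(2) inner_commute[of _ \<omega>] inner_add_right)
  also have "\<dots> = (\<Sum>e | e \<in> faces M \<and> e \<subseteq> frontier K. nsign K e * (nrm M e \<bullet> \<omega>) *
      (\<integral>x. indicator e x * (q x * r x) \<partial>hyperplane_measure (nrm M e) (offset e)))"
    by (rule green[OF \<omega> dF cG])
  also have "\<dots> = (\<Sum>e | e \<in> faces M \<and> e \<subseteq> frontier K. nsign K e * (nrm M e \<bullet> \<omega>) * fip e (trace_from K u) (trace_from K v))"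
  proof (rule sum.cong[OF refl])
    fix e assume "e \<in> {e \<in> faces M. e \<subseteq> frontier K}"
    then have e: "x \<in> e \<Longrightarrow> x \<in> frontier K" for x by blast
    have "fip e (trace_from K u) (trace_from K v) = fip e q r"
      by (intro ip_cong trace_from_eq[OF open_K e] polys_continuous[OF q(1)] polys_continuous[OF r(1)] q(2) r(2))
    then show "nsign K e * (nrm M e \<bullet> \<omega>) * (\<integral>x. indicator e x * (q x * r x) \<partial>hyperplane_measure (nrm M e) (offset e))
       = nsign K e * (nrm M e \<bullet> \<omega>) * fip e (trace_from K u) (trace_from K v)"
      by (simp add: ip_def face_measure_def offset_def)
  qed
  finally show ?thesis .
qed

text \<open>Exchanging the sums over elements and faces, an interior face is met from its two sides
  with opposite signs. A boundary face is met once, which fits the zero exterior trace.\<close>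

lemma integration_by_parts:
  assumes V: "u \<in> V" "v \<in> V" and \<omega>: "norm \<omega> = 1"
  shows "(\<Sum>K\<in>elems M. ip lborel K u (\<lambda>x. \<omega> \<bullet> grad v x)) + (\<Sum>K\<in>elems M. ip lborel K v (\<lambda>x. \<omega> \<bullet> grad u x)) =
    (\<Sum>e\<in>faces M. (\<omega> \<bullet> nrm M e) * (fip e (trace_plus M e u) (trace_plus M e v)
       - fip e (trace_minus \<Omega> M e u) (trace_minus \<Omega> M e v)))"
proof -
  let ?f = "\<lambda>K e. nsign K e * (nrm M e \<bullet> \<omega>) * fip e (trace_from K u) (trace_from K v)"
  have "(\<Sum>K\<in>elems M. ip lborel K u (\<lambda>x. \<omega> \<bullet> grad v x)) + (\<Sum>K\<in>elems M. ip lborel K v (\<lambda>x. \<omega> \<bullet> grad u x)) =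
      (\<Sum>K\<in>elems M. \<Sum>e | e \<in> faces M \<and> e \<subseteq> frontier K. ?f K e)"
    unfolding sum.distrib[symmetric] by (intro sum.cong refl elem_green V \<omega>)
  also have "\<dots> = (\<Sum>e\<in>faces M. \<Sum>K | K \<in> elems M \<and> e \<subseteq> frontier K. ?f K e)"
    by (rule sum.swap_restrict[OF meshD(1,2)])
  also have "\<dots> = (\<Sum>e\<in>faces M. (\<omega> \<bullet> nrm M e) * (fip e (trace_plus M e u) (trace_plus M e v)
       - fip e (trace_minus \<Omega> M e u) (trace_minus \<Omega> M e v)))"
  proof (rule sum.cong[OF refl])
    fix e assume "e \<in> faces M"
    then show "(\<Sum>K | K \<in> elems M \<and> e \<subseteq> frontier K. ?f K e) = (\<omega> \<bullet> nrm M e) * (fip e (trace_plus M e u) (trace_plus M e v)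
       - fip e (trace_minus \<Omega> M e u) (trace_minus \<Omega> M e v))"
    proof (cases rule: face_cases)
      case 1
      have "{K \<in> elems M. e \<subseteq> frontier K} = {Kplus M e, Kminus M e}"
        using interior_faceD(2)[OF 1(1)] by (simp add: adjacent_elems_def)
      then show ?thesis
        using interior_faceD(1)[OF 1(1)] 1(2)
        by (simp add: nsign_def trace_plus_def[abs_def] trace_minus_def inner_commute algebra_simps)
    next
      case 2
      have "{K \<in> elems M. e \<subseteq> frontier K} = {Kplus M e}"
        using boundary_faceD(1)[OF 2] by (simp add: adjacent_elems_def)
      then show ?thesis
        using 2 by (simp add: nsign_def trace_plus_def[abs_def] trace_minus_def inner_commute ip_def)
    qed
  qed
  finally show ?thesis .
qed

lemma fip_jump:
  assumes "u \<in> V" "e \<in> faces M" "agrees_cont e f"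
  shows "fip e f (jump \<Omega> M e u) = fip e f (trace_plus M e u) - fip e f (trace_minus \<Omega> M e u)"
    and "fip e (jump \<Omega> M e u) f = fip e (trace_plus M e u) f - fip e (trace_minus \<Omega> M e u) f"
  unfolding jump_diff
  by (rule ip_diff[OF face_integrable[OF assms(2)] agrees_trace(1,2)[OF assms(1,2)] assms(3)])+

text \<open>Reversing the direction moves the upwind value to the other side of a face. With
  \<open>\<omega> \<bullet> n > 0\<close> the two fluxes combine to
  \<open>u+ (v+ - v-) + v- (u+ - u-) = u+ v+ - u- v-\<close>, the face term of integration by
  parts.\<close>

lemma transport_form_adjoint:
  assumes V: "u \<in> V" "v \<in> V" and \<omega>: "norm \<omega> = 1"
  shows "transport_form \<Omega> M st \<epsilon> \<omega> u v = transport_form \<Omega> M st \<epsilon> (- \<omega>) v u"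
proof -
  let ?A = "\<Sum>K\<in>elems M. ip lborel K u (\<lambda>x. \<omega> \<bullet> grad v x)" and ?B = "\<Sum>K\<in>elems M. ip lborel K v (\<lambda>x. \<omega> \<bullet> grad u x)"
  let ?J = "\<lambda>\<omega> u v e. fip e (upwind \<Omega> M \<omega> e u) (jump \<Omega> M e v)"
  have face: "(\<omega> \<bullet> nrm M e) * (fip e (trace_plus M e u) (trace_plus M e v)
       - fip e (trace_minus \<Omega> M e u) (trace_minus \<Omega> M e v)) =
     (\<omega> \<bullet> nrm M e) * ?J \<omega> u v e + (\<omega> \<bullet> nrm M e) * ?J (- \<omega>) v u e" if e: "e \<in> faces M" for e
  proof -
    note J = fip_jump(1)[OF V(2) e agrees_trace(3)[OF V(1) e]] fip_jump(1)[OF V(1) e agrees_trace(3)[OF V(2) e]]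
    show ?thesis
      unfolding J
      by (cases "\<omega> \<bullet> nrm M e" "0 :: real" rule: linorder_cases)
         (auto simp: upwind_def ip_commute[of _ _ "trace_plus M e v"] ip_commute[of _ _ "trace_minus \<Omega> M e v"] algebra_simps)
  qed
  have "?A + ?B = (\<Sum>e\<in>faces M. (\<omega> \<bullet> nrm M e) * ?J \<omega> u v e) + (\<Sum>e\<in>faces M. (\<omega> \<bullet> nrm M e) * ?J (- \<omega>) v u e)"
    unfolding integration_by_parts[OF V \<omega>] unfolding sum.distrib[symmetric]
    by (intro sum.cong refl face)
  moreover have "(\<Sum>K\<in>elems M. ip lborel K v (\<lambda>x. (- \<omega>) \<bullet> grad u x)) = - ?B"
    using ip_scale[of lborel _ "-1" "\<lambda>x. \<omega> \<bullet> grad u x" v]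
    by (simp add: ip_commute[of lborel _ v] sum_negf)
  moreover have "(\<Sum>e\<in>faces M. ((- \<omega>) \<bullet> nrm M e) * ?J (- \<omega>) v u e) = - (\<Sum>e\<in>faces M. (\<omega> \<bullet> nrm M e) * ?J (- \<omega>) v u e)"
    by (simp add: sum_negf)
  moreover have "mesh_ip u v = mesh_ip v u" by (simp add: ip_commute[of _ _ u])
  ultimately show ?thesis
    unfolding transport_form_eq[OF V] transport_form_eq[OF V(2,1)] by simp
qed

text \<open>On each face \<open>(\<omega> \<bullet> n) u_up [u]\<close> is the mean-value flux
  \<open>(\<omega> \<bullet> n) (u+^2 - u-^2) / 2\<close> plus the upwind dissipation
  \<open>\<bar>\<omega> \<bullet> n\<bar> [u]^2 / 2\<close>. The former cancels the volume
  term.\<close>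

lemma transport_form_energy:
  assumes V: "u \<in> V" and \<omega>: "norm \<omega> = 1"
  shows "transport_form \<Omega> M st \<epsilon> \<omega> u u =
    (\<Sum>e\<in>faces M. \<bar>\<omega> \<bullet> nrm M e\<bar> / 2 * fip e (jump \<Omega> M e u) (jump \<Omega> M e u)) + st / \<epsilon> * mesh_ip u u"
proof -
  let ?A = "\<Sum>K\<in>elems M. ip lborel K u (\<lambda>x. \<omega> \<bullet> grad u x)"
  let ?p = "\<lambda>e. fip e (trace_plus M e u) (trace_plus M e u)" and ?m = "\<lambda>e. fip e (trace_minus \<Omega> M e u) (trace_minus \<Omega> M e u)"
    and ?c = "\<lambda>e. fip e (trace_plus M e u) (trace_minus \<Omega> M e u)"
  have A: "?A = (\<Sum>e\<in>faces M. (\<omega> \<bullet> nrm M e) / 2 * (?p e - ?m e))"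
    using integration_by_parts[OF V V \<omega>] by (simp flip: sum_divide_distrib)
  have face: "(\<omega> \<bullet> nrm M e) * fip e (upwind \<Omega> M \<omega> e u) (jump \<Omega> M e u) =
     (\<omega> \<bullet> nrm M e) / 2 * (?p e - ?m e) + \<bar>\<omega> \<bullet> nrm M e\<bar> / 2 * fip e (jump \<Omega> M e u) (jump \<Omega> M e u)"
    if e: "e \<in> faces M" for e
  proof -
    note ag = agrees_trace[OF V e]
    have JJ: "fip e (jump \<Omega> M e u) (jump \<Omega> M e u) = ?p e - 2 * ?c e + ?m e"
      unfolding fip_jump(1)[OF V e ag(4)] fip_jump(2)[OF V e ag(1)] fip_jump(2)[OF V e ag(2)]
      by (simp add: ip_commute[of _ _ "trace_minus \<Omega> M e u" "trace_plus M e u"])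
    show ?thesis
      unfolding JJ fip_jump(1)[OF V e ag(3)]
      by (cases "\<omega> \<bullet> nrm M e" "0 :: real" rule: linorder_cases)
         (auto simp: upwind_def ip_commute[of _ _ "trace_minus \<Omega> M e u" "trace_plus M e u"] field_simps)
  qed
  have "(\<Sum>e\<in>faces M. (\<omega> \<bullet> nrm M e) * fip e (upwind \<Omega> M \<omega> e u) (jump \<Omega> M e u)) =
     ?A + (\<Sum>e\<in>faces M. \<bar>\<omega> \<bullet> nrm M e\<bar> / 2 * fip e (jump \<Omega> M e u) (jump \<Omega> M e u))"
    unfolding A sum.distrib[symmetric] by (intro sum.cong refl face)
  then show ?thesis unfolding transport_form_eq[OF V V] by simp
qed

section \<open>Coercivity, solvability and the case of equality\<close>

lemma scaled_transport_energy:
  assumes V: "u \<in> V" and \<omega>: "norm \<omega> = 1"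
  shows "\<epsilon> * transport_form \<Omega> M st \<epsilon> \<omega> u u = m_t \<Omega> st u u
    + \<epsilon> * (\<Sum>e\<in>faces M. \<bar>\<omega> \<bullet> nrm M e\<bar> / 2 * fip e (jump \<Omega> M e u) (jump \<Omega> M e u))"
  unfolding transport_form_energy[OF assms] m_t_eq[OF V V] using \<epsilon> by (simp add: algebra_simps)

lemma jump_energy_nonneg:
  "0 \<le> (\<Sum>e\<in>faces M. \<bar>\<omega> \<bullet> nrm M e\<bar> / 2 * fip e (jump \<Omega> M e u) (jump \<Omega> M e u))"
  by (intro sum_nonneg mult_nonneg_nonneg ip_nonneg) simp

lemma scaled_transport_coercive:
  assumes "u \<in> V" "norm \<omega> = 1"
  shows "m_t \<Omega> st u u \<le> \<epsilon> * transport_form \<Omega> M st \<epsilon> \<omega> u u"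
  unfolding scaled_transport_energy[OF assms] using jump_energy_nonneg \<epsilon> by simp

lemma scaled_transport_bilinear: "bilinear_form_on V (\<lambda>u v. \<epsilon> * transport_form \<Omega> M st \<epsilon> \<omega> u v)"
  using transport_form_bilinear[of \<omega>] unfolding bilinear_form_on_def
  by (simp add: algebra_simps)

text \<open>Coercivity gives existence and uniqueness, which is what the definite description in
  \<open>directional_solution\<close> needs.\<close>

lemma directional_solution:
  assumes g: "g \<in> V" and \<omega>: "norm \<omega> = 1"
  shows "directional_solution \<Omega> M p st \<epsilon> \<omega> g \<in> V"
    and "\<And>v. v \<in> V \<Longrightarrow> \<epsilon> * transport_form \<Omega> M st \<epsilon> \<omega> (directional_solution \<Omega> M p st \<epsilon> \<omega> g) v = m_t \<Omega> st g v"
proof -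
  let ?b = "\<lambda>u v. \<epsilon> * transport_form \<Omega> M st \<epsilon> \<omega> u v"
  note bil = scaled_transport_bilinear[of \<omega>]
  have pos: "0 < ?b u u" if "u \<in> V" "u \<noteq> (\<lambda>x. 0)" for u
    using spd_formD(3)[OF m_t_spd that] scaled_transport_coercive[OF that(1) \<omega>] by simp
  have ex: "\<exists>\<psi>\<in>fs.span basis. \<forall>v\<in>fs.span basis. ?b \<psi> v = m_t \<Omega> st g v"
    using bil pos bilinear_formD(2)[OF spd_formD(1)[OF m_t_spd] _ _ g]
    by (intro positive_bilinear_form_solvable finite_basis) (simp_all add: Vh_eq_span)
  have "\<exists>!\<psi>. \<psi> \<in> V \<and> (\<forall>v\<in>V. ?b \<psi> v = m_t \<Omega> st g v)"
  proof (rule ex_ex1I)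
    show "\<exists>\<psi>. \<psi> \<in> V \<and> (\<forall>v\<in>V. ?b \<psi> v = m_t \<Omega> st g v)"
      using ex unfolding Vh_eq_span by blast
    fix \<psi> \<psi>'
    assume 1: "\<psi> \<in> V \<and> (\<forall>v\<in>V. ?b \<psi> v = m_t \<Omega> st g v)" and 2: "\<psi>' \<in> V \<and> (\<forall>v\<in>V. ?b \<psi>' v = m_t \<Omega> st g v)"
    let ?d = "\<lambda>x. 1 * \<psi> x + (-1) * \<psi>' x"
    have d: "?d \<in> V" using 1 2 by (intro Vh_lincomb) auto
    have "?b ?d ?d = 1 * ?b \<psi> ?d + (-1) * ?b \<psi>' ?d"
      using 1 2 by (intro bilinear_formD(1)[OF bil]) (use d in auto)
    also have "\<dots> = 0" using 1 2 d by auto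
    finally have "?d = (\<lambda>x. 0)" using pos[OF d] by force
    then show "\<psi> = \<psi>'" by (auto simp: fun_eq_iff)
  qed
  from theI'[OF this]
  show "directional_solution \<Omega> M p st \<epsilon> \<omega> g \<in> V"
    and "\<And>v. v \<in> V \<Longrightarrow> ?b (directional_solution \<Omega> M p st \<epsilon> \<omega> g) v = m_t \<Omega> st g v"
    unfolding directional_solution_def m_t_def by blast+
qed

text \<open>The open set may be disconnected, so a vanishing gradient there would give constancy on
  components only. The components of the gradient are polynomials and hence vanish everywhere, and
  the whole space is convex.\<close>

lemma gradient_zero_constant:
  assumes "q \<in> polys p" "open S" "a \<in> S" "\<And>x. x \<in> S \<Longrightarrow> grad q x = 0"
  shows "q x = q y"
proof -
  have "grad q x = 0" for x
  proof -
    have "axis i 1 \<bullet> grad q x = 0" for i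
      by (rule real_polynomial_function_zero_on_open
          [OF polys_real_polynomial_function[OF polys_grad(2)[OF assms(1)]] assms(2,3)])
         (simp add: assms(4))
    then show ?thesis by (simp add: vec_eq_iff inner_axis')
  qed
  then have "(q has_derivative (\<lambda>h. 0)) (at x)" for x
    using polys_grad(1)[OF assms(1), of x] by simp
  then show ?thesis
    by (intro has_derivative_zero_unique[of UNIV q x y]) auto
qed

text \<open>A function without jumps whose transport equations have the solution g itself has vanishing
  directional derivatives; by isotropy of the directions it is constant on every element, hence
  constant, hence zero once there is a boundary face.\<close>

lemma no_gap_imp_zero:
  assumes g: "g \<in> V" and unit: "\<And>k. k \<in> I \<Longrightarrow> norm (\<omega> k) = 1"
    and spanning: "\<And>a :: real^'d. (\<And>k. k \<in> I \<Longrightarrow> \<omega> k \<bullet> a = 0) \<Longrightarrow> a = 0"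
    and sol: "\<And>k v. k \<in> I \<Longrightarrow> v \<in> V \<Longrightarrow> \<epsilon> * transport_form \<Omega> M st \<epsilon> (\<omega> k) g v = m_t \<Omega> st g v"
    and bd: "boundary_faces \<Omega> M \<noteq> {}"
  shows "g = (\<lambda>x. 0)"
proof -
  \<comment> \<open>Testing with \<open>g\<close> itself leaves only the jump energy. As the
    directions span, each face has one that is not tangential, whose term controls the jump
    there.\<close>
  have jump0: "fip e (jump \<Omega> M e g) (jump \<Omega> M e g) = 0" if e: "e \<in> faces M" for e
  proof -
    have "nrm M e \<noteq> 0" using norm_nrm[OF e] by auto
    then obtain k where k: "k \<in> I" "\<omega> k \<bullet> nrm M e \<noteq> 0" using spanning by blast
    have "(\<Sum>e\<in>faces M. \<bar>\<omega> k \<bullet> nrm M e\<bar> / 2 * fip e (jump \<Omega> M e g) (jump \<Omega> M e g)) = 0"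
      using scaled_transport_energy[OF g unit[OF k(1)]] sol[OF k(1) g] \<epsilon> by simp
    then have "\<forall>e\<in>faces M. \<bar>\<omega> k \<bullet> nrm M e\<bar> / 2 * fip e (jump \<Omega> M e g) (jump \<Omega> M e g) = 0"
      by (subst (asm) sum_nonneg_eq_0_iff[OF meshD(2)]) (auto intro!: mult_nonneg_nonneg ip_nonneg)
    then show ?thesis using k(2) e by auto
  qed
  have jump_test: "fip e (jump \<Omega> M e g) f = 0" if "e \<in> faces M" for e f
    by (rule ip_zero_left[OF face_integrable[OF that] agrees_trace(4)[OF g that] jump0[OF that]])
  \<comment> \<open>Without jumps the two traces of \<open>g\<close> are interchangeable under the
    integral, so the upwind flux equals the face term of integration by parts.\<close>
  have upwind_test: "(\<omega> k \<bullet> nrm M e) * fip e (upwind \<Omega> M (\<omega> k) e g) (jump \<Omega> M e v) =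
      (\<omega> k \<bullet> nrm M e) * (fip e (trace_plus M e g) (trace_plus M e v) - fip e (trace_minus \<Omega> M e g) (trace_minus \<Omega> M e v))"
    if e: "e \<in> faces M" and v: "v \<in> V" for e v k
  proof -
    have eq: "fip e (trace_plus M e g) f = fip e (trace_minus \<Omega> M e g) f" if "agrees_cont e f" for f
      using jump_test[OF e, of f] fip_jump(2)[OF g e that] by simp
    show ?thesis
      unfolding fip_jump(1)[OF v e agrees_trace(3)[OF g e]]
      using eq agrees_trace[OF v e] by (simp add: upwind_def)
  qed
  \<comment> \<open>Integration by parts now removes all face terms, and the reaction term cancels
    the right-hand side.\<close>
  have deriv_test: "(\<Sum>K\<in>elems M. ip lborel K v (\<lambda>x. \<omega> k \<bullet> grad g x)) = 0" if k: "k \<in> I" and v: "v \<in> V" for k v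
  proof -
    let ?D = "\<Sum>K\<in>elems M. ip lborel K v (\<lambda>x. \<omega> k \<bullet> grad g x)"
    have "(\<Sum>e\<in>faces M. (\<omega> k \<bullet> nrm M e) * fip e (upwind \<Omega> M (\<omega> k) e g) (jump \<Omega> M e v)) =
       (\<Sum>K\<in>elems M. ip lborel K g (\<lambda>x. \<omega> k \<bullet> grad v x)) + ?D"
      unfolding integration_by_parts[OF g v unit[OF k]] by (intro sum.cong refl upwind_test v)
    then have "transport_form \<Omega> M st \<epsilon> (\<omega> k) g v = ?D + st / \<epsilon> * mesh_ip g v"
      unfolding transport_form_eq[OF g v] by simp
    then have "\<epsilon> * ?D = 0"
      using sol[OF k v] \<epsilon> by (simp add: m_t_eq[OF g v] algebra_simps)
    then show ?thesis using \<epsilon> by simp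
  qed
  define Q where "Q = (\<lambda>K. SOME q. q \<in> polys p \<and> (\<forall>x\<in>K. g x = q x))"
  have Q: "Q K \<in> polys p" "\<And>x. x \<in> K \<Longrightarrow> g x = Q K x" if "K \<in> elems M" for K
  proof -
    have "\<exists>q. q \<in> polys p \<and> (\<forall>x\<in>K. g x = q x)" using Vh_poly[OF g that] by blast
    from someI_ex[OF this] show "Q K \<in> polys p" "\<And>x. x \<in> K \<Longrightarrow> g x = Q K x" by (auto simp: Q_def)
  qed
  have gradQ: "grad g x = grad (Q K) x" if "K \<in> elems M" "x \<in> K" for K x
    by (rule grad_cong_open[OF elem_open[OF that(1)] that(2) Q(2)[OF that(1)] differentiableI[OF polys_grad(1)[OF Q(1)[OF that(1)]]]])
  have dir0: "\<omega> k \<bullet> grad (Q K) x = 0" if k: "k \<in> I" and K: "K \<in> elems M" and x: "x \<in> K" for k K x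
  proof -
    let ?d = "\<lambda>K x. \<omega> k \<bullet> grad (Q K) x"
    \<comment> \<open>The test function is the directional derivative of \<open>g\<close> itself,
      glued from its polynomial pieces.\<close>
    have "(\<Sum>K\<in>elems M. ip lborel K (?d K) (?d K)) = (\<Sum>K\<in>elems M. ip lborel K (glue ?d) (\<lambda>x. \<omega> k \<bullet> grad g x))"
      by (intro sum.cong refl ip_cong) (simp_all add: glue_eq gradQ)
    also have "\<dots> = 0" by (intro deriv_test k glue_in polys_grad(2) Q(1))
    finally have "\<forall>K\<in>elems M. ip lborel K (?d K) (?d K) = 0"
      by (subst (asm) sum_nonneg_eq_0_iff[OF meshD(1)]) (auto intro: ip_nonneg)
    then show ?thesis using K x by (intro elem_L2_zero[OF K polys_grad(2)[OF Q(1)[OF K]]]) auto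
  qed
  have Qconst: "Q K x = Q K y" if K: "K \<in> elems M" for K x y
  proof -
    obtain a where a: "a \<in> K" using elem_nonempty[OF K] by blast
    have "grad (Q K) x = 0" if "x \<in> K" for x
      by (rule spanning) (rule dir0[OF _ K that])
    then show ?thesis by (rule gradient_zero_constant[OF Q(1)[OF K] elem_open[OF K] a])
  qed
  have trace: "trace_from K g x = Q K 0" if "K \<in> elems M" "x \<in> frontier K" for K x
    using trace_from_eq[OF elem_open[OF that(1)] that(2) polys_continuous[OF Q(1)[OF that(1)]] Q(2)[OF that(1)]]
      Qconst[OF that(1), of x 0] by simp
  \<comment> \<open>A constant jump has squared norm \<open>c^2\<close> times the face area, which
    is positive.\<close>
  have const_jump: "c = 0" if e: "e \<in> faces M" and c: "\<And>x. x \<in> e \<Longrightarrow> jump \<Omega> M e g x = c" for e c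
  proof -
    have "fip e (jump \<Omega> M e g) (jump \<Omega> M e g) = fip e (\<lambda>x. c * 1) (\<lambda>x. c * 1)"
      by (rule ip_cong) (simp_all add: c)
    also have "\<dots> = c * (c * fip e (\<lambda>x. 1) (\<lambda>x. 1))"
      unfolding ip_scale by (subst ip_commute) (simp only: ip_scale)
    finally show ?thesis using jump0[OF e] face_measure_pos[OF e] by simp
  qed
  have step: "Q (Kplus M e) 0 = Q (Kminus M e) 0" if e: "e \<in> interior_faces \<Omega> M" for e
  proof -
    have f: "e \<in> faces M" "e \<notin> boundary_faces \<Omega> M" using e by (auto simp: interior_faces_def)
    have "Q (Kplus M e) 0 - Q (Kminus M e) 0 = 0"
    proof (rule const_jump[OF f(1)])
      fix x assume "x \<in> e"
      then show "jump \<Omega> M e g x = Q (Kplus M e) 0 - Q (Kminus M e) 0"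
        using Kplus_elem[OF f(1)] Kminus_elem[OF e] f(2)
        by (simp add: jump_def trace_plus_def trace_minus_def trace subset_iff)
    qed
    then show ?thesis by simp
  qed
  obtain e where e: "e \<in> boundary_faces \<Omega> M" using bd by blast
  then have ef: "e \<in> faces M" by (simp add: boundary_faces_def)
  \<comment> \<open>On a boundary face the jump is the full interior trace, so the vacuum condition
    fixes the constant on the adjacent element; chains of interior faces carry it to all
    others.\<close>
  have start: "Q (Kplus M e) 0 = 0"
  proof (rule const_jump[OF ef])
    fix x assume "x \<in> e"
    then show "jump \<Omega> M e g x = Q (Kplus M e) 0"
      using Kplus_elem[OF ef] e by (simp add: jump_def trace_plus_def trace_minus_def trace subset_iff)
  qed
  have "Q K 0 = 0" if "K \<in> elems M" for K
  proof -
    have "(Kplus M e, K) \<in> {(A, B). \<exists>e\<in>interior_faces \<Omega> M. {A, B} = {Kplus M e, Kminus M e}}\<^sup>*"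
      using mesh_connected Kplus_elem[OF ef] that by blast
    then show ?thesis
    proof (induction rule: rtrancl_induct)
      case base
      show ?case by (rule start)
    next
      case (step y z)
      then obtain e' where "e' \<in> interior_faces \<Omega> M" "{y, z} = {Kplus M e', Kminus M e'}" by blast
      then show ?case using step.IH \<open>\<And>e. e \<in> interior_faces \<Omega> M \<Longrightarrow> Q (Kplus M e) 0 = Q (Kminus M e) 0\<close>[of e']
        by (auto simp: doubleton_eq_iff)
    qed
  qed
  then have "g x = 0" if "K \<in> elems M" "x \<in> K" for K x
    using Q(2)[OF that] Qconst[OF that(1), of x 0] that(1) by simp
  then have "g x = 0" for x
    using Vh_outside[OF g, of x] by blast
  then show ?thesis by blast
qed

text \<open>Ensures that an eigenvalue exists, so that \<open>lambda_max\<close> is the maximum of a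
  nonempty set.\<close>

lemma Vh_nontrivial: "\<exists>v\<in>V. v \<noteq> (\<lambda>x. 0)"
proof -
  obtain K x where K: "K \<in> elems M" "x \<in> K" using elems_nonempty elem_nonempty by blast
  have "glue (\<lambda>K x. 1) \<in> V" by (intro glue_in polys_const)
  moreover have "glue (\<lambda>K x. 1) x = 1" using glue_eq[OF K] .
  ultimately show ?thesis by (metis zero_neq_one)
qed

end

section \<open>Isotropy and symmetry of the quadrature\<close>

lemma quadrature_isotropic:
  fixes \<omega> :: "nat \<Rightarrow> real^'d::finite"
  assumes "is_quadrature N \<omega> w"
  shows "(\<Sum>m=1..N. w m * (\<omega> m \<bullet> a)\<^sup>2) = (a \<bullet> a) / real CARD('d)"
proof -
  have T: "(\<Sum>m=1..N. w m *\<^sub>R (\<chi> i j. \<omega> m $ i * \<omega> m $ j)) = (1 / real CARD('d)) *\<^sub>R (mat 1 :: real^'d^'d)"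
    using assms unfolding is_quadrature_def by blast
  have entry: "(\<Sum>m=1..N. w m * (\<omega> m $ i * \<omega> m $ j)) = (if i = j then 1 / real CARD('d) else 0)" for i j
    using arg_cong[OF T, of "\<lambda>A. A $ i $ j"] by (simp add: mat_def)
  have "(\<Sum>m=1..N. w m * (\<omega> m \<bullet> a)\<^sup>2) =
      (\<Sum>m=1..N. \<Sum>i\<in>UNIV. \<Sum>j\<in>UNIV. a $ i * a $ j * (w m * (\<omega> m $ i * \<omega> m $ j)))"
    by (simp add: inner_vec_def power2_eq_square sum_product sum_distrib_left ac_simps)
  also have "\<dots> = (\<Sum>i\<in>UNIV. \<Sum>m=1..N. \<Sum>j\<in>UNIV. a $ i * a $ j * (w m * (\<omega> m $ i * \<omega> m $ j)))"
    by (rule sum.swap)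
  also have "\<dots> = (\<Sum>i\<in>UNIV. \<Sum>j\<in>UNIV. \<Sum>m=1..N. a $ i * a $ j * (w m * (\<omega> m $ i * \<omega> m $ j)))"
    by (intro sum.cong refl sum.swap)
  also have "\<dots> = (\<Sum>i\<in>UNIV. \<Sum>j\<in>UNIV. a $ i * a $ j * (if i = j then 1 / real CARD('d) else 0))"
    by (simp only: entry flip: sum_distrib_left)
  also have "\<dots> = (a \<bullet> a) / real CARD('d)"
    by (simp add: inner_vec_def sum_divide_distrib if_distrib[of "\<lambda>c. _ * c"] cong: if_cong)
  finally show ?thesis .
qed

lemma quadrature_spanning:
  fixes \<omega> :: "nat \<Rightarrow> real^'d::finite"
  assumes "is_quadrature N \<omega> w" "\<And>m. m \<in> {1..N} \<Longrightarrow> \<omega> m \<bullet> a = 0"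
  shows "a = 0"
  using quadrature_isotropic[OF assms(1), of a] assms(2) by simp

text \<open>A chosen opposite index determines the original direction and weight. The pairs are
  distinct, so the choice is injective, and an injective self-map of a finite set is a
  permutation.\<close>

lemma quadrature_involution:
  assumes q: "is_quadrature N \<omega> w"
  obtains s where "bij_betw s {1..N} {1..N}" "\<And>m. m \<in> {1..N} \<Longrightarrow> \<omega> (s m) = - \<omega> m \<and> w (s m) = w m"
proof -
  have "\<forall>m\<in>{1..N}. \<exists>m'. m' \<in> {1..N} \<and> \<omega> m' = - \<omega> m \<and> w m' = w m"
    and inj: "inj_on (\<lambda>m. (\<omega> m, w m)) {1..N}"
    using q unfolding is_quadrature_def by blast+
  from bchoice[OF this(1)] obtain s where
    s: "\<And>m. m \<in> {1..N} \<Longrightarrow> s m \<in> {1..N} \<and> \<omega> (s m) = - \<omega> m \<and> w (s m) = w m" by blast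
  have "inj_on s {1..N}"
  proof (rule inj_onI)
    fix k l assume kl: "k \<in> {1..N}" "l \<in> {1..N}" "s k = s l"
    then have "(\<omega> k, w k) = (\<omega> l, w l)" using s[OF kl(1)] s[OF kl(2)] by simp
    then show "k = l" using inj_onD[OF inj _ kl(1,2)] by blast
  qed
  moreover have "s ` {1..N} \<subseteq> {1..N}" using s by blast
  ultimately have "bij_betw s {1..N} {1..N}"
    by (simp add: bij_betw_def endo_inj_surj)
  then show ?thesis using s that by blast
qed

theorem lemma5p1:
  fixes \<Omega> :: "(real^'d::finite) set" and M :: "'d mesh"
    and p N :: nat
    and \<omega> :: "nat \<Rightarrow> real^'d" and w :: "nat \<Rightarrow> real"
    and st sa \<epsilon> :: real
  defines "V \<equiv> Vh M p"
    and "H \<equiv> scalar_response \<Omega> M p N \<omega> w st \<epsilon>"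
  assumes dim: "CARD('d) = 2 \<or> CARD('d) = 3"
    and domain: "connected \<Omega>" "lipschitz_polytope \<Omega>"
    and mesh: "is_mesh \<Omega> M"
    and degree: "1 \<le> p"
    and quadrature: "is_quadrature N \<omega> w"
    and coefficients: "0 < st" "0 < sa"
    and eps: "0 < \<epsilon>" "\<epsilon> < sqrt (st / sa)"
  shows "self_adjoint_on V (m_t \<Omega> st) H \<and>
         positive_definite_on V (m_t \<Omega> st) H \<and>
         loewner_less V (m_t \<Omega> st) (\<lambda>v x. 0) H \<and>
         loewner_le V (m_t \<Omega> st) H (\<lambda>v. v) \<and>
         finite (eigenvalues_on V H) \<and> eigenvalues_on V H \<noteq> {} \<and>
         0 < lambda_max V H \<and> lambda_max V H \<le> 1 \<and>
         (boundary_faces \<Omega> M \<noteq> {} \<longrightarrow>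
            loewner_less V (m_t \<Omega> st) H (\<lambda>v. v) \<and> lambda_max V H < 1) \<and>
         bij_betw H V V \<and>
         spd_form_on V (a_ex \<Omega> M p N \<omega> w st sa \<epsilon>)"
proof -
  interpret transport_mesh \<Omega> M p st \<epsilon>
    using domain(2) mesh coefficients(1) eps(1) by unfold_locales
  have unit: "norm (\<omega> k) = 1" and w_pos: "0 < w k" if "k \<in> {1..N}" for k
    using quadrature that unfolding is_quadrature_def by blast+
  have w_sum: "(\<Sum>k=1..N. w k) = 1" using quadrature unfolding is_quadrature_def by blast
  obtain s where s: "bij_betw s {1..N} {1..N}"
    "\<And>m. m \<in> {1..N} \<Longrightarrow> \<omega> (s m) = - \<omega> m \<and> w (s m) = w m"
    using quadrature_involution[OF quadrature] by blast
  have span: "V = fs.span basis" unfolding V_def by (rule Vh_eq_span)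
  interpret R: averaged_response basis "m_t \<Omega> st" "{1..N}" w s
    "\<lambda>k u v. \<epsilon> * transport_form \<Omega> M st \<epsilon> (\<omega> k) u v" "\<lambda>k. directional_solution \<Omega> M p st \<epsilon> (\<omega> k)"
  proof (unfold_locales, fold Vh_eq_span)
    show "spd_form_on (Vh M p) (m_t \<Omega> st)" by (rule m_t_spd)
    fix k u v assume "k \<in> {1..N}" "u \<in> Vh M p" "v \<in> Vh M p"
    then show "\<epsilon> * transport_form \<Omega> M st \<epsilon> (\<omega> k) u v = \<epsilon> * transport_form \<Omega> M st \<epsilon> (\<omega> (s k)) v u"
      using transport_form_adjoint[OF _ _ unit] s(2) by simp
  qed (use w_sum s in \<open>simp_all add: finite_basis w_pos scaled_transport_bilinear
      scaled_transport_coercive directional_solution unit\<close>)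
  have H: "R.H = H"
    by (rule ext) (simp only: H_def R.H_def scalar_response_def)
  have sub: "m_t \<Omega> st (\<lambda>x. v x - H v x) v = m_t \<Omega> st v v - m_t \<Omega> st (H v) v" if "v \<in> V" for v
    using R.mD(1)[folded span, of v "H v" v 1 "-1"] that R.H_in[folded span, unfolded H] by simp
  have le: "loewner_le V (m_t \<Omega> st) H (\<lambda>v. v)"
    unfolding loewner_le_def using sub R.H_le[folded span, unfolded H] by simp
  have less0: "loewner_less V (m_t \<Omega> st) (\<lambda>v x. 0) H"
    using R.H_positive[folded span, unfolded H] unfolding loewner_less_def positive_definite_on_def by simp
  have ne: "eigenvalues_on V H \<noteq> {}"
    using Vh_nontrivial R.eigenvalues_nonempty[folded span, unfolded H] unfolding V_def by blast
  note fin = R.eigenvalues_finite[folded span, unfolded H]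
  \<comment> \<open>Membership transfers the bounds proved for arbitrary eigenvalues to
    \<open>lambda_max\<close>.\<close>
  have max: "lambda_max V H \<in> eigenvalues_on V H"
    unfolding lambda_max_def using fin ne by (rule Max_in)
  have strict: "loewner_less V (m_t \<Omega> st) H (\<lambda>v. v)" if bd: "boundary_faces \<Omega> M \<noteq> {}"
    unfolding loewner_less_def
  proof (intro ballI impI)
    fix g assume g: "g \<in> V" "g \<noteq> (\<lambda>x. 0)"
    show "0 < m_t \<Omega> st (\<lambda>x. g x - H g x) g"
    proof (rule ccontr)
      assume "\<not> 0 < m_t \<Omega> st (\<lambda>x. g x - H g x) g"
      then have gap: "m_t \<Omega> st g g \<le> m_t \<Omega> st (H g) g" using sub[OF g(1)] by simp
      have "g = (\<lambda>x. 0)"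
      proof (rule no_gap_imp_zero[of g "{1..N}" \<omega>])
        show "g \<in> Vh M p" using g(1) by (simp add: V_def)
        fix k v assume kv: "k \<in> {1..N}" "v \<in> Vh M p"
        have "directional_solution \<Omega> M p st \<epsilon> (\<omega> k) g = g"
          using R.H_eqD(1)[folded span, unfolded H, OF g(1) gap kv(1)] .
        then show "\<epsilon> * transport_form \<Omega> M st \<epsilon> (\<omega> k) g v = m_t \<Omega> st g v"
          using directional_solution(2)[OF _ unit[OF kv(1)] kv(2), of g] g(1) by (simp add: V_def)
      qed (use unit quadrature_spanning[OF quadrature] bd in blast)+
      then show False using g(2) by blast
    qed
  qed
  \<comment> \<open>Here \<open>1 - c = \<epsilon>^2 sa / st\<close>, which is positive.\<close>
  have c: "c_ratio st sa \<epsilon> < 1"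
    using coefficients eps(1) by (simp add: c_ratio_def sigma_s_def sigma_t_def divide_simps)
  have "a_ex \<Omega> M p N \<omega> w st sa \<epsilon> =
      (\<lambda>u v. (1 / \<epsilon>) * m_t \<Omega> st (\<lambda>x. inv_into V H u x - c_ratio st sa \<epsilon> * u x) v)"
    by (simp add: fun_eq_iff a_ex_def m_t_def V_def H_def)
  then have "spd_form_on V (a_ex \<Omega> M p N \<omega> w st sa \<epsilon>)"
    using R.shifted_inverse_spd[folded span, unfolded H, OF c, of "1 / \<epsilon>"] eps(1) by simp
  then show ?thesis
    using R.H_self_adjoint[folded span, unfolded H] R.H_positive[folded span, unfolded H] less0 le fin ne
      R.eigenvalue_pos[folded span, unfolded H, OF max] R.eigenvalue_le_1[folded span, unfolded H, OF max]
      strict R.eigenvalue_less_1[folded span, unfolded H, OF _ max] R.H_bij[folded span, unfolded H]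
    by blast
qed

end
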